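(* Let $S$ be a locally finite $\infty$-groupoid. The cardinality of the canonical perfect pairing $$\mathcal{F}_{/S}\times\mathcal{F}^S\longrightarrow\mathcal{F},\qquad(p,f)\longmapsto f(p),$$ is precisely the canonical perfect pairing of vector spaces $$\langle\ ,\ \rangle:\mathbb{Q}_{\pi_0S}\times\mathbb{Q}^{\pi_0S}\longrightarrow\mathbb{Q},\qquad\langle\delta_s,\delta^t\rangle=\begin{cases}1&\text{if }t\simeq s\\0&\text{else.}\end{cases}$$ That is, $|f(p)|=\langle|p|,|f|\rangle$ for all $p\in\mathcal{F}_{/S}$ and $f\in\mathcal{F}^S$.
   Context: An $\infty$-groupoid $X$ is locally finite if at each base point $x$ the groups $\pi_i(X,x)$, $i\ge1$, are finite and trivial for $i$ sufficiently large; it is finite if moreover it has finitely many components. The cardinality of a finite $X$ is $|X|:=\sum_{x\in\pi_0X}\prod_{i>0}|\pi_i(X,x)|^{(-1)^i}$. $\mathcal{F}$ is the $\infty$-category of finite $\infty$-groupoids; $\mathcal{F}_{/S}$ is the $\infty$-category of maps $\alpha\to S$ with $\alpha$ finite; $\mathcal{F}^S=\operatorname{Fun}(S,\mathcal{F})$. The pairing is $f(p):=\alpha\times_SF$ for $p:\alpha\to S$ and $f:S\to\mathcal{F}$, where $F\to S$ is the Grothendieck construction of $f$ (with fibres $F_s=f(s)$). For a set $I$, $\mathbb{Q}_I$ is the vector space with basis $(\delta_i)_{i\in I}$ and $\mathbb{Q}^I$ is the profinite-dimensional space of functions $I\to\mathbb{Q}$, with pro-basis the functions $\delta^i$ taking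 value $1$ at $i$ and $0$ elsewhere; the pairing is evaluation, $\langle\sum_ic_i\delta_i,\phi\rangle=\sum_ic_i\phi(i)$. The cardinality of $p:\alpha\to S$ in $\mathcal{F}_{/S}$ is $|p|:=\sum_{s\in\pi_0S}|\alpha_s|\,|S_{[s]}|\,\delta_s\in\mathbb{Q}_{\pi_0S}$ ($\alpha_s$ the homotopy fibre, $S_{[s]}$ the connected component of $s$). The cardinality of $f\in\mathcal{F}^S$ is the function $|f|\in\mathbb{Q}^{\pi_0S}$, $s\mapsto|f(s)|$. *)

theory Defs
  imports Complex_Main
begin

section \<open>Simplicial sets\<close>

text \<open>
  A monotone map \<open>\<phi>: [m] \<rightarrow> [n]\<close> is the list \<open>[\<phi> 0, \<dots>, \<phi> m]\<close> of its values, so the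
  set of monotone maps is also the set of \<open>m\<close>-simplices of the standard simplex \<open>\<Delta>[n]\<close>.
\<close>

definition mono_maps :: "nat \<Rightarrow> nat \<Rightarrow> nat list set" where
  "mono_maps m n = {\<phi>. length \<phi> = Suc m \<and> sorted \<phi> \<and> set \<phi> \<subseteq> {..n}}"

definition mono_id :: "nat \<Rightarrow> nat list" where
  "mono_id n = [0..<Suc n]"

text \<open>\<open>mono_comp \<phi> \<psi>\<close> is \<open>\<phi> \<circ> \<psi>\<close>.\<close>

definition mono_comp :: "nat list \<Rightarrow> nat list \<Rightarrow> nat list" where
  "mono_comp \<phi> \<psi> = map (\<lambda>i. \<phi> ! i) \<psi>"

text \<open>The injection \<open>[n - 1] \<rightarrow> [n]\<close> that omits the value \<open>i\<close>.\<close>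

definition coface :: "nat \<Rightarrow> nat \<Rightarrow> nat list" where
  "coface n i = filter (\<lambda>j. j \<noteq> i) [0..<Suc n]"

text \<open>
  For \<open>\<phi>: [m] \<rightarrow> [n]\<close>, \<open>act X n \<phi>\<close> is the map \<open>\<phi>\<^sup>* : X\<^sub>n \<rightarrow> X\<^sub>m\<close>. The dimension \<open>n\<close> is an
  argument because the sets \<open>simplices X n\<close> need not be disjoint.
\<close>

record 'a simplicial =
  simplices :: "nat \<Rightarrow> 'a set"
  act :: "nat \<Rightarrow> nat list \<Rightarrow> 'a \<Rightarrow> 'a"

definition simplicial_set :: "'a simplicial \<Rightarrow> bool" where
  "simplicial_set X \<longleftrightarrow>
    (\<forall>n m \<phi> x. \<phi> \<in> mono_maps m n \<and> x \<in> simplices X n \<longrightarrow> act X n \<phi> x \<in> simplices X m) \<and>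
    (\<forall>n x. x \<in> simplices X n \<longrightarrow> act X n (mono_id n) x = x) \<and>
    (\<forall>n m k \<phi> \<psi> x. \<phi> \<in> mono_maps m n \<and> \<psi> \<in> mono_maps k m \<and> x \<in> simplices X n \<longrightarrow>
       act X n (mono_comp \<phi> \<psi>) x = act X m \<psi> (act X n \<phi> x))"

definition simplicial_map ::
  "'a simplicial \<Rightarrow> 'b simplicial \<Rightarrow> (nat \<Rightarrow> 'a \<Rightarrow> 'b) \<Rightarrow> bool" where
  "simplicial_map X Y g \<longleftrightarrow>
    (\<forall>n x. x \<in> simplices X n \<longrightarrow> g n x \<in> simplices Y n) \<and>
    (\<forall>n m \<phi> x. \<phi> \<in> mono_maps m n \<and> x \<in> simplices X n \<longrightarrow>
       g m (act X n \<phi> x) = act Y n \<phi> (g n x))"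

definition face :: "'a simplicial \<Rightarrow> nat \<Rightarrow> nat \<Rightarrow> 'a \<Rightarrow> 'a" where
  "face X n i x = act X n (coface n i) x"

text \<open>The totally degenerate \<open>n\<close>-simplex on a vertex.\<close>

definition const_simplex :: "'a simplicial \<Rightarrow> nat \<Rightarrow> 'a \<Rightarrow> 'a" where
  "const_simplex X n x = act X 0 (replicate (Suc n) 0) x"

definition standard_simplex :: "nat \<Rightarrow> nat list simplicial" where
  "standard_simplex n = \<lparr>simplices = (\<lambda>m. mono_maps m n), act = (\<lambda>_ \<psi> \<phi>. mono_comp \<phi> \<psi>)\<rparr>"

definition pullback ::
  "'a simplicial \<Rightarrow> 'b simplicial \<Rightarrow> (nat \<Rightarrow> 'a \<Rightarrow> 'c) \<Rightarrow> (nat \<Rightarrow> 'b \<Rightarrow> 'c) \<Rightarrow> ('a \<times> 'b) simplicial"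
  where
  "pullback X Y p q =
    \<lparr>simplices = (\<lambda>n. {(x, y). x \<in> simplices X n \<and> y \<in> simplices Y n \<and> p n x = q n y}),
     act = (\<lambda>n \<phi> (x, y). (act X n \<phi> x, act Y n \<phi> y))\<rparr>"

section \<open>Horn filling\<close>

text \<open>
  A map \<open>\<Lambda>\<^sup>k[n] \<rightarrow> X\<close> (for \<open>n \<ge> 1\<close>) given by the images \<open>h i\<close> of the faces of the horn. For
  \<open>n = 1\<close> the compatibility condition is vacuous.
\<close>

definition horn :: "'a simplicial \<Rightarrow> nat \<Rightarrow> nat \<Rightarrow> (nat \<Rightarrow> 'a) \<Rightarrow> bool" where
  "horn X n k h \<longleftrightarrow>
    (\<forall>i\<le>n. i \<noteq> k \<longrightarrow> h i \<in> simplices X (n - 1)) \<and>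
    (\<forall>i j. i < j \<and> j \<le> n \<and> i \<noteq> k \<and> j \<noteq> k \<longrightarrow>
       face X (n - 1) i (h j) = face X (n - 1) (j - 1) (h i))"

definition kan_complex :: "'a simplicial \<Rightarrow> bool" where
  "kan_complex X \<longleftrightarrow> simplicial_set X \<and>
    (\<forall>n k h. 1 \<le> n \<and> k \<le> n \<and> horn X n k h \<longrightarrow>
       (\<exists>x\<in>simplices X n. \<forall>i\<le>n. i \<noteq> k \<longrightarrow> face X n i x = h i))"

definition left_fibration ::
  "'a simplicial \<Rightarrow> 'b simplicial \<Rightarrow> (nat \<Rightarrow> 'a \<Rightarrow> 'b) \<Rightarrow> bool" where
  "left_fibration X Y g \<longleftrightarrow> simplicial_set X \<and> simplicial_set Y \<and> simplicial_map X Y g \<and>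
    (\<forall>n k h y. 1 \<le> n \<and> k < n \<and> horn X n k h \<and> y \<in> simplices Y n \<and>
       (\<forall>i\<le>n. i \<noteq> k \<longrightarrow> face Y n i y = g (n - 1) (h i)) \<longrightarrow>
       (\<exists>x\<in>simplices X n. g n x = y \<and> (\<forall>i\<le>n. i \<noteq> k \<longrightarrow> face X n i x = h i)))"

section \<open>Homotopy groups, finiteness and cardinality\<close>

text \<open>
  An \<open>\<infinity>\<close>-groupoid is a Kan complex. The relation \<open>path_rel\<close> (an edge from \<open>x\<close> to \<open>y\<close>) and the
  relation \<open>homotopy_rel\<close> below are equivalence relations in that case.
\<close>

definition path_rel :: "'a simplicial \<Rightarrow> ('a \<times> 'a) set" where
  "path_rel X = {(x, y). \<exists>e\<in>simplices X 1. face X 1 1 e = x \<and> face X 1 0 e = y}"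

definition pi0 :: "'a simplicial \<Rightarrow> 'a set set" where
  "pi0 X = simplices X 0 // path_rel X"

definition pi0_class :: "'a simplicial \<Rightarrow> 'a \<Rightarrow> 'a set" where
  "pi0_class X x = path_rel X `` {x}"

definition spheres :: "'a simplicial \<Rightarrow> nat \<Rightarrow> 'a \<Rightarrow> 'a set" where
  "spheres X n x = {\<sigma> \<in> simplices X n. \<forall>i\<le>n. face X n i \<sigma> = const_simplex X (n - 1) x}"

definition homotopy_rel :: "'a simplicial \<Rightarrow> nat \<Rightarrow> 'a \<Rightarrow> ('a \<times> 'a) set" where
  "homotopy_rel X n x = {(\<sigma>, \<tau>). \<sigma> \<in> spheres X n x \<and> \<tau> \<in> spheres X n x \<and>
    (\<exists>\<omega>\<in>simplices X (Suc n). face X (Suc n) n \<omega> = \<sigma> \<and> face X (Suc n) (Suc n) \<omega> = \<tau> \<and>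
       (\<forall>i<n. face X (Suc n) i \<omega> = const_simplex X n x))}"

text \<open>
  The simplicial homotopy group \<open>\<pi>\<^sub>n(X, x)\<close> for \<open>n \<ge> 1\<close>. Only its underlying set is defined:
  finiteness, triviality and the order of the group do not involve the multiplication.
\<close>

definition homotopy_group :: "'a simplicial \<Rightarrow> nat \<Rightarrow> 'a \<Rightarrow> 'a set set" where
  "homotopy_group X n x = spheres X n x // homotopy_rel X n x"

definition locally_finite_groupoid :: "'a simplicial \<Rightarrow> bool" where
  "locally_finite_groupoid X \<longleftrightarrow> kan_complex X \<and>
    (\<forall>x\<in>simplices X 0. (\<forall>i\<ge>1. finite (homotopy_group X i x)) \<and>
       (\<exists>N. \<forall>i>N. card (homotopy_group X i x) = 1))"

definition finite_groupoid :: "'a simplicial \<Rightarrow> bool" where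
  "finite_groupoid X \<longleftrightarrow> locally_finite_groupoid X \<and> finite (pi0 X)"

text \<open>
  An arbitrary vertex of a component; the quantities below do not depend on the choice.
\<close>

definition rep :: "'a set \<Rightarrow> 'a" where
  "rep c = (SOME x. x \<in> c)"

text \<open>The infinite product is taken over the finitely many factors that are not \<open>1\<close>.\<close>

definition cardinality :: "'a simplicial \<Rightarrow> rat" where
  "cardinality X = (\<Sum>c\<in>pi0 X.
     \<Prod>i | 0 < i \<and> card (homotopy_group X i (rep c)) \<noteq> 1.
       of_nat (card (homotopy_group X i (rep c))) powi ((-1) ^ i))"

text \<open>The connected component \<open>X\<^bsub>[x]\<^esub>\<close>.\<close>

definition component :: "'a simplicial \<Rightarrow> 'a \<Rightarrow> 'a simplicial" where
  "component X x =
    \<lparr>simplices = (\<lambda>n. {\<sigma> \<in> simplices X n. \<forall>i\<le>n. (x, act X n [i] \<sigma>) \<in> path_rel X}),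
     act = act X\<rparr>"

section \<open>Homotopy fibres\<close>

text \<open>
  The slice \<open>X\<^bsub>x/\<^esub>\<close>: its \<open>n\<close>-simplices are the \<open>(n + 1)\<close>-simplices of \<open>X\<close> with vertex \<open>0\<close> equal to
  \<open>x\<close>, and \<open>\<phi>\<close> acts by the extension of \<open>\<phi>\<close> that fixes the added initial vertex. The projection
  \<open>X\<^bsub>x/\<^esub> \<rightarrow> X\<close> forgets that vertex. If \<open>X\<close> is a Kan complex, this is a fibration with contractible
  total space that replaces the inclusion \<open>{x} \<rightarrow> X\<close>, so that the strict pullback along it is the
  homotopy fibre at \<open>x\<close>.
\<close>

definition slice :: "'a simplicial \<Rightarrow> 'a \<Rightarrow> 'a simplicial" where
  "slice X x =
    \<lparr>simplices = (\<lambda>n. {\<sigma> \<in> simplices X (Suc n). act X (Suc n) [0] \<sigma> = x}),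
     act = (\<lambda>n \<phi> \<sigma>. act X (Suc n) (0 # map Suc \<phi>) \<sigma>)\<rparr>"

definition slice_proj :: "'a simplicial \<Rightarrow> nat \<Rightarrow> 'a \<Rightarrow> 'a" where
  "slice_proj X n \<sigma> = face X (Suc n) 0 \<sigma>"

definition homotopy_fibre ::
  "'b simplicial \<Rightarrow> 'a simplicial \<Rightarrow> (nat \<Rightarrow> 'a \<Rightarrow> 'b) \<Rightarrow> 'b \<Rightarrow> ('a \<times> 'b) simplicial" where
  "homotopy_fibre S \<alpha> p s = pullback \<alpha> (slice S s) p (slice_proj S)"

section \<open>The infinity-category of finite infinity-groupoids\<close>

text \<open>
  Cisinski's model of the \<open>\<infinity>\<close>-category of \<open>\<infinity>\<close>-groupoids: the \<open>n\<close>-simplices are the left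
  fibrations over \<open>\<Delta>[n]\<close> together with strictly functorial choices of their pullbacks. Here a
  simplicial set over \<open>\<Delta>[n]\<close> is presented as a presheaf on the category of simplices of
  \<open>\<Delta>[n]\<close>: to each \<open>\<phi>: [m] \<rightarrow> [n]\<close> belongs the set \<open>fib E \<phi>\<close> of \<open>m\<close>-simplices over \<open>\<phi>\<close>, and each
  \<open>\<psi>: [k] \<rightarrow> [m]\<close> acts by \<open>restr E \<phi> \<psi> : fib E \<phi> \<rightarrow> fib E (\<phi> \<circ> \<psi>)\<close>. Pullback along
  \<open>\<theta>: [m] \<rightarrow> [n]\<close> is precomposition with \<open>\<theta>\<close>. Outside their domains, \<open>fib\<close> and \<open>restr\<close> take fixed
  values, so that equality of families is equality of presheaves. The type \<open>'e\<close> plays the role of the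
  universe in which the fibres live.
\<close>

record 'e family =
  fib :: "nat list \<Rightarrow> 'e set"
  restr :: "nat list \<Rightarrow> nat list \<Rightarrow> 'e \<Rightarrow> 'e"

definition family_on ::
  "nat \<Rightarrow> (nat list \<Rightarrow> 'e set) \<Rightarrow> (nat list \<Rightarrow> nat list \<Rightarrow> 'e \<Rightarrow> 'e) \<Rightarrow> 'e family" where
  "family_on n A r =
    (let A' = (\<lambda>\<phi>. if \<exists>m. \<phi> \<in> mono_maps m n then A \<phi> else {}) in
     \<lparr>fib = A',
      restr = (\<lambda>\<phi> \<psi> e. if e \<in> A' \<phi> \<and> (\<exists>k. \<psi> \<in> mono_maps k (length \<phi> - 1))
                       then r \<phi> \<psi> e else undefined)\<rparr>)"

definition total_space :: "nat \<Rightarrow> 'e family \<Rightarrow> (nat list \<times> 'e) simplicial" where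
  "total_space n E =
    \<lparr>simplices = (\<lambda>m. {(\<phi>, e). \<phi> \<in> mono_maps m n \<and> e \<in> fib E \<phi>}),
     act = (\<lambda>_ \<psi> (\<phi>, e). (mono_comp \<phi> \<psi>, restr E \<phi> \<psi> e))\<rparr>"

text \<open>
  The strict fibre over the vertex \<open>i\<close> of \<open>\<Delta>[n]\<close>. For a \<open>0\<close>-simplex \<open>E\<close> of the \<open>\<infinity>\<close>-category,
  \<open>fibre E 0\<close> is the \<open>\<infinity>\<close>-groupoid that it encodes.
\<close>

definition fibre :: "'e family \<Rightarrow> nat \<Rightarrow> 'e simplicial" where
  "fibre E i =
    \<lparr>simplices = (\<lambda>m. fib E (replicate (Suc m) i)),
     act = (\<lambda>m \<psi>. restr E (replicate (Suc m) i) \<psi>)\<rparr>"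

definition finite_groupoids :: "'e family simplicial" where
  "finite_groupoids =
    \<lparr>simplices = (\<lambda>n. {E. E = family_on n (fib E) (restr E) \<and>
        left_fibration (total_space n E) (standard_simplex n) (\<lambda>_. fst) \<and>
        (\<forall>i\<le>n. finite_groupoid (fibre E i))}),
     act = (\<lambda>n \<theta> E. family_on (length \<theta> - 1)
        (\<lambda>\<phi>. fib E (mono_comp \<theta> \<phi>)) (\<lambda>\<phi>. restr E (mono_comp \<theta> \<phi>)))\<rparr>"

text \<open>
  The Grothendieck construction of \<open>f: S \<rightarrow> finite_groupoids\<close> is the pullback along \<open>f\<close> of the
  universal left fibration, whose \<open>n\<close>-simplices over \<open>E\<close> are the sections \<open>e \<in> fib E id\<close>.
\<close>

definition grothendieck ::
  "'s simplicial \<Rightarrow> (nat \<Rightarrow> 's \<Rightarrow> 'e family) \<Rightarrow> ('s \<times> 'e) simplicial" where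
  "grothendieck S f =
    \<lparr>simplices = (\<lambda>n. {(s, e). s \<in> simplices S n \<and> e \<in> fib (f n s) (mono_id n)}),
     act = (\<lambda>n \<psi> (s, e). (act S n \<psi> s, restr (f n s) (mono_id n) \<psi> e))\<rparr>"

section \<open>The two pairings\<close>

text \<open>
  Objects of \<open>\<F>\<^bsub>/S\<^esub>\<close> and of \<open>\<F>\<^sup>S\<close>. Since \<open>S\<close> and \<open>\<alpha>\<close> are Kan complexes, every map of
  \<open>\<infinity>\<close>-groupoids \<open>\<alpha> \<rightarrow> S\<close> is a map of simplicial sets.
\<close>

definition finite_over :: "'s simplicial \<Rightarrow> ('a simplicial \<times> (nat \<Rightarrow> 'a \<Rightarrow> 's)) set" where
  "finite_over S = {(\<alpha>, p). finite_groupoid \<alpha> \<and> simplicial_map \<alpha> S p}"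

definition finite_valued :: "'s simplicial \<Rightarrow> (nat \<Rightarrow> 's \<Rightarrow> 'e family) set" where
  "finite_valued S = {f. simplicial_map S finite_groupoids f}"

text \<open>
  The strict pullback computes the \<open>\<infinity>\<close>-categorical fibre product, because the projection of the
  Grothendieck construction to the Kan complex \<open>S\<close> is a left fibration, hence a Kan fibration.
\<close>

definition pairing ::
  "'s simplicial \<Rightarrow> 'a simplicial \<Rightarrow> (nat \<Rightarrow> 'a \<Rightarrow> 's) \<Rightarrow> (nat \<Rightarrow> 's \<Rightarrow> 'e family)
    \<Rightarrow> ('a \<times> 's \<times> 'e) simplicial" where
  "pairing S \<alpha> p f = pullback \<alpha> (grothendieck S f) p (\<lambda>_. fst)"

text \<open>
  \<open>\<rat>\<^sub>I\<close>, as the finitely supported coefficient functions \<open>i \<mapsto> c\<^sub>i\<close>. In this form \<open>\<delta>\<^sub>i\<close> and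
  \<open>\<delta>\<^sup>i\<close> are given by the same function \<open>delta i\<close>.
\<close>

definition free_space :: "'i set \<Rightarrow> ('i \<Rightarrow> rat) set" where
  "free_space I = {c. finite {i. c i \<noteq> 0} \<and> {i. c i \<noteq> 0} \<subseteq> I}"

definition delta :: "'i \<Rightarrow> 'i \<Rightarrow> rat" where
  "delta i j = (if j = i then 1 else 0)"

definition evaluation :: "('i \<Rightarrow> rat) \<Rightarrow> ('i \<Rightarrow> rat) \<Rightarrow> rat" where
  "evaluation c \<phi> = (\<Sum>i | c i \<noteq> 0. c i * \<phi> i)"

definition over_cardinality ::
  "'s simplicial \<Rightarrow> 'a simplicial \<Rightarrow> (nat \<Rightarrow> 'a \<Rightarrow> 's) \<Rightarrow> 's set \<Rightarrow> rat" where
  "over_cardinality S \<alpha> p c =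
    (if c \<in> pi0 S
     then cardinality (homotopy_fibre S \<alpha> p (rep c)) * cardinality (component S (rep c)) else 0)"

definition functor_cardinality ::
  "'s simplicial \<Rightarrow> (nat \<Rightarrow> 's \<Rightarrow> 'e family) \<Rightarrow> 's set \<Rightarrow> rat" where
  "functor_cardinality S f c = (if c \<in> pi0 S then cardinality (fibre (f 0 (rep c)) 0) else 0)"

end

theory Submission
  imports Defs "HOL-Algebra.Coset"
begin

text \<open>
  The cardinality of the total space of a fibration is the sum, over the components of the base, of the
  cardinality of the fibre times the weight of the component, the weight being the alternating product of the
  orders of the homotopy groups (\<open>fibration_finite\<close>). The theorem is this formula applied to three fibrations.

  The pairing is fibred over \<open>\<alpha>\<close> with fibre \<open>f (p a)\<close> at \<open>a\<close>, so its cardinality is the sum of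
  \<open>|f (p a)| w(a)\<close> over the components \<open>[a]\<close> of \<open>\<alpha>\<close>, where \<open>w\<close> denotes weights. The slice of \<open>S\<close>
  under \<open>s\<close> is contractible and fibred over \<open>S\<close> with the spaces of paths from \<open>s\<close> as fibres; so a path
  space has cardinality \<open>1 / w(s)\<close> or is empty (\<open>path_space_cardinality\<close>). Finally the homotopy fibre
  \<open>\<alpha>\<^sub>s\<close> is fibred over \<open>\<alpha>\<close> with path spaces as fibres, whence \<open>|\<alpha>\<^sub>s| w(s)\<close> is the sum of \<open>w(a)\<close>
  over the components \<open>[a]\<close> of \<open>\<alpha>\<close> with \<open>p a\<close> in the component of \<open>s\<close> (\<open>homotopy_fibre_cardinality\<close>).
  Grouping the components of \<open>\<alpha>\<close> by their images in \<open>S\<close> now gives \<open>|f(p)| = \<langle>|p|, |f|\<rangle>\<close>.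

  The formula for a fibration \<open>F \<rightarrow> E \<rightarrow> B\<close> needs the long exact sequence only in the form of an identity
  between orders (\<open>exact_sequence\<close>), and this is reduced to fundamental groups. The loop space, defined as
  the strict fibre of a slice, has the homotopy groups of the original space, shifted by one, on the nose;
  and taking loop spaces turns the fibration into a fibration with the expected fibre. So one only has to know
  how the fundamental groups of \<open>F\<close>, \<open>E\<close>, \<open>B\<close> and the components of \<open>F\<close> are related (\<open>exact_base\<close>),
  which involves simplices of dimension at most three. The other ingredient is that the orders of
  the homotopy groups are the same at all points of a component (\<open>homotopy_group_edge\<close>); this follows by
  pushing spheres across degenerate simplices.

  The projections above are left fibrations over Kan complexes. That their total spaces are Kan complexes is
  Joyal's theorem on right horns (\<open>left_fillable_kan\<close>), proved by induction on the dimension with the help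
  of relative slices.
\<close>

section \<open>Calculus of simplicial operators\<close>

lemma all_le_Suc: "(\<forall>i\<le>Suc n. P i) \<longleftrightarrow> P 0 \<and> (\<forall>i\<le>n. P (Suc i))"
  by (metis Suc_le_mono le0 not0_implies_Suc)

lemma all_less_Suc0: "(\<forall>i<Suc n. P i) \<longleftrightarrow> P 0 \<and> (\<forall>i<n. P (Suc i))"
  using less_Suc_eq_0_disj by auto

lemma length_mono_comp [simp]: "length (mono_comp \<phi> \<psi>) = length \<psi>"
  by (simp add: mono_comp_def)

lemma nth_mono_comp [simp]: "i < length \<psi> \<Longrightarrow> mono_comp \<phi> \<psi> ! i = \<phi> ! (\<psi> ! i)"
  by (simp add: mono_comp_def)

lemma mono_maps_iff:
  "\<phi> \<in> mono_maps m n \<longleftrightarrow> length \<phi> = Suc m \<and> (\<forall>i\<le>m. \<phi> ! i \<le> n) \<and> (\<forall>i j. i \<le> j \<longrightarrow> j \<le> m \<longrightarrow> \<phi> ! i \<le> \<phi> ! j)"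
  unfolding mono_maps_def by (fastforce simp: sorted_iff_nth_mono set_conv_nth less_Suc_eq_le)

lemma mono_maps_length: "\<phi> \<in> mono_maps m n \<Longrightarrow> length \<phi> = Suc m"
  by (simp add: mono_maps_iff)

lemma mono_id_in [simp, intro]: "mono_id n \<in> mono_maps n n"
  by (auto simp: mono_maps_iff mono_id_def less_Suc_eq_le simp del: upt_Suc)

lemma length_mono_id [simp]: "length (mono_id n) = Suc n" by (simp add: mono_id_def)

lemma nth_mono_id [simp]: "i \<le> n \<Longrightarrow> mono_id n ! i = i"
  by (simp add: mono_id_def less_Suc_eq_le del: upt_Suc)

lemma mono_comp_id_left: "\<psi> \<in> mono_maps k m \<Longrightarrow> mono_comp (mono_id m) \<psi> = \<psi>"
  by (intro nth_equalityI) (auto simp: mono_maps_iff less_Suc_eq_le)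

lemma mono_comp_id_right: "\<psi> \<in> mono_maps k m \<Longrightarrow> mono_comp \<psi> (mono_id k) = \<psi>"
  by (intro nth_equalityI) (auto simp: mono_maps_iff less_Suc_eq_le)

lemma coface_alt: "i \<le> n \<Longrightarrow> coface n i = [0..<i] @ [Suc i..<Suc n]"
proof -
  assume "i \<le> n"
  then have "[0..<Suc n] = [0..<i] @ i # [Suc i..<Suc n]"
    by (metis le_imp_less_Suc less_imp_le_nat le_add_diff_inverse upt_add_eq_append upt_conv_Cons zero_le)
  moreover have "filter (\<lambda>j. j \<noteq> i) [0..<i] = [0..<i]" "filter (\<lambda>j. j \<noteq> i) [Suc i..<Suc n] = [Suc i..<Suc n]"
    by (auto intro!: filter_True)
  ultimately show ?thesis unfolding coface_def by (simp del: upt_Suc)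
qed

lemma length_coface [simp]: "i \<le> n \<Longrightarrow> length (coface n i) = n"
  by (simp add: coface_alt del: upt_Suc)

lemma nth_coface [simp]: "i \<le> n \<Longrightarrow> t < n \<Longrightarrow> coface n i ! t = (if t < i then t else Suc t)"
  by (auto simp: coface_alt nth_append simp del: upt_Suc)

lemma coface_Suc_in [intro]: "i \<le> Suc n \<Longrightarrow> coface (Suc n) i \<in> mono_maps n (Suc n)"
  by (auto simp: mono_maps_iff)

lemma coface_1 [simp]: "coface (Suc 0) 0 = [Suc 0]" "coface (Suc 0) (Suc 0) = [0]"
  by (simp_all add: coface_def)

lemma replicate_in [intro]: "i \<le> n \<Longrightarrow> replicate (Suc m) i \<in> mono_maps m n"
  by (auto simp: mono_maps_iff less_Suc_eq_le simp del: replicate_Suc)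

lemma single_in [intro]: "i \<le> n \<Longrightarrow> [i] \<in> mono_maps 0 n"
  by (auto simp: mono_maps_iff)

lemma mono_comp_replicate:
  assumes "\<psi> \<in> mono_maps k m" shows "mono_comp (replicate (Suc m) i) \<psi> = replicate (Suc k) i"
  using assms by (intro nth_equalityI) (auto simp: mono_maps_iff less_Suc_eq_le simp del: replicate_Suc)

lemma mono_comp_replicate_right:
  "mono_comp \<phi> (replicate k i) = replicate k (\<phi> ! i)"
  by (simp add: mono_comp_def)

lemma sset_act_in [intro]:
  "simplicial_set X \<Longrightarrow> x \<in> simplices X n \<Longrightarrow> \<phi> \<in> mono_maps m n \<Longrightarrow> act X n \<phi> x \<in> simplices X m"
  unfolding simplicial_set_def by blast

lemma sset_act_id: "simplicial_set X \<Longrightarrow> x \<in> simplices X n \<Longrightarrow> act X n (mono_id n) x = x"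
  unfolding simplicial_set_def by blast

lemma sset_act_act:
  "simplicial_set X \<Longrightarrow> x \<in> simplices X n \<Longrightarrow> \<phi> \<in> mono_maps m n \<Longrightarrow> \<psi> \<in> mono_maps k m \<Longrightarrow>
    act X m \<psi> (act X n \<phi> x) = act X n (mono_comp \<phi> \<psi>) x"
  unfolding simplicial_set_def by metis

lemma face_in [intro]:
  "simplicial_set X \<Longrightarrow> x \<in> simplices X (Suc n) \<Longrightarrow> i \<le> Suc n \<Longrightarrow> face X (Suc n) i x \<in> simplices X n"
  unfolding face_def by (rule sset_act_in) auto

lemma face_act:
  assumes "simplicial_set X" "x \<in> simplices X m" "\<phi> \<in> mono_maps (Suc n) m" "i \<le> Suc n"
  shows "face X (Suc n) i (act X m \<phi> x) = act X m (mono_comp \<phi> (coface (Suc n) i)) x"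
  unfolding face_def using assms by (intro sset_act_act) auto

lemma act_face:
  assumes "simplicial_set X" "x \<in> simplices X (Suc n)" "\<phi> \<in> mono_maps k n" "i \<le> Suc n"
  shows "act X n \<phi> (face X (Suc n) i x) = act X (Suc n) (mono_comp (coface (Suc n) i) \<phi>) x"
  unfolding face_def using assms by (intro sset_act_act) auto

lemma coface_coface:
  "i < j \<Longrightarrow> j \<le> Suc (Suc n) \<Longrightarrow>
   mono_comp (coface (Suc (Suc n)) j) (coface (Suc n) i) = mono_comp (coface (Suc (Suc n)) i) (coface (Suc n) (j - 1))"
  by (intro nth_equalityI) auto

lemma face_face:
  assumes "simplicial_set X" "x \<in> simplices X (Suc (Suc n))" "i < j" "j \<le> Suc (Suc n)"
  shows "face X (Suc n) i (face X (Suc (Suc n)) j x) = face X (Suc n) (j - 1) (face X (Suc (Suc n)) i x)"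
  using assms by (simp add: face_def sset_act_act[of X x "Suc (Suc n)" _ "Suc n" _ n] coface_Suc_in coface_coface)

lemma vertex_face:
  assumes "simplicial_set X" "x \<in> simplices X (Suc n)" "i \<le> Suc n" "v \<le> n"
  shows "act X n [v] (face X (Suc n) i x) = act X (Suc n) [if v < i then v else Suc v] x"
  using assms act_face[OF assms(1,2) single_in[OF assms(4)] assms(3)] by (simp add: mono_comp_def)

lemma vertex_0 [simp]: "simplicial_set X \<Longrightarrow> x \<in> simplices X 0 \<Longrightarrow> act X 0 [0] x = x"
  using sset_act_id[of X x 0] by (simp add: mono_id_def)

lemma const_simplex_0 [simp]: "simplicial_set X \<Longrightarrow> x \<in> simplices X 0 \<Longrightarrow> const_simplex X 0 x = x"
  by (simp add: const_simplex_def)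

lemma const_simplex_in [intro]: "simplicial_set X \<Longrightarrow> x \<in> simplices X 0 \<Longrightarrow> const_simplex X n x \<in> simplices X n"
  unfolding const_simplex_def by (rule sset_act_in) (auto simp del: replicate_Suc)

lemma act_const:
  assumes "simplicial_set X" "x \<in> simplices X 0" "\<phi> \<in> mono_maps k n"
  shows "act X n \<phi> (const_simplex X n x) = const_simplex X k x"
  unfolding const_simplex_def using assms
  by (subst sset_act_act[of _ _ 0 _ n]) (auto simp: mono_comp_replicate simp del: replicate_Suc)

lemma face_const:
  assumes "simplicial_set X" "x \<in> simplices X 0" "i \<le> Suc n"
  shows "face X (Suc n) i (const_simplex X (Suc n) x) = const_simplex X n x"
  unfolding face_def using assms by (intro act_const) auto

lemma simplicial_map_in [intro]: "simplicial_map X Y g \<Longrightarrow> x \<in> simplices X n \<Longrightarrow> g n x \<in> simplices Y n"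
  unfolding simplicial_map_def by blast

lemma simplicial_map_act:
  "simplicial_map X Y g \<Longrightarrow> x \<in> simplices X n \<Longrightarrow> \<phi> \<in> mono_maps m n \<Longrightarrow> g m (act X n \<phi> x) = act Y n \<phi> (g n x)"
  unfolding simplicial_map_def by blast

lemma simplicial_map_face:
  "simplicial_map X Y g \<Longrightarrow> x \<in> simplices X (Suc n) \<Longrightarrow> i \<le> Suc n \<Longrightarrow>
   g n (face X (Suc n) i x) = face Y (Suc n) i (g (Suc n) x)"
  unfolding face_def by (rule simplicial_map_act) auto

lemma simplicial_map_const:
  "simplicial_map X Y g \<Longrightarrow> x \<in> simplices X 0 \<Longrightarrow> g n (const_simplex X n x) = const_simplex Y n (g 0 x)"
  unfolding const_simplex_def by (rule simplicial_map_act) (auto simp del: replicate_Suc)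

section \<open>Horns, slices and strict fibres\<close>

abbreviation edges :: "'a simplicial \<Rightarrow> 'a set" where "edges X \<equiv> simplices X (Suc 0)"

definition fills :: "'a simplicial \<Rightarrow> nat \<Rightarrow> nat \<Rightarrow> bool" where
  "fills X n k \<longleftrightarrow> (\<forall>h. horn X n k h \<longrightarrow>
     (\<exists>x\<in>simplices X n. \<forall>i\<le>n. i \<noteq> k \<longrightarrow> face X n i x = h i))"

definition lifts :: "'a simplicial \<Rightarrow> 'b simplicial \<Rightarrow> (nat \<Rightarrow> 'a \<Rightarrow> 'b) \<Rightarrow> nat \<Rightarrow> nat \<Rightarrow> bool" where
  "lifts X Y g n k \<longleftrightarrow> (\<forall>h y. horn X n k h \<and> y \<in> simplices Y n \<and>
       (\<forall>i\<le>n. i \<noteq> k \<longrightarrow> face Y n i y = g (n - 1) (h i)) \<longrightarrow>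
     (\<exists>x\<in>simplices X n. g n x = y \<and> (\<forall>i\<le>n. i \<noteq> k \<longrightarrow> face X n i x = h i)))"

text \<open>
  The horns that a left fibration over a Kan complex allows to fill in its total space. That all other
  horns can then be filled too is \<open>left_fillable_kan\<close>.
\<close>

definition left_fillable :: "'a simplicial \<Rightarrow> bool" where
  "left_fillable X \<longleftrightarrow> simplicial_set X \<and> (\<forall>n k. 1 \<le> n \<and> k < n \<longrightarrow> fills X n k)"

lemma kan_complex_iff: "kan_complex X \<longleftrightarrow> simplicial_set X \<and> (\<forall>n k. 1 \<le> n \<and> k \<le> n \<longrightarrow> fills X n k)"
  unfolding kan_complex_def fills_def by blast

lemma left_fibration_iff:
  "left_fibration X Y g \<longleftrightarrow> simplicial_set X \<and> simplicial_set Y \<and> simplicial_map X Y g \<and>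
     (\<forall>n k. 1 \<le> n \<and> k < n \<longrightarrow> lifts X Y g n k)"
  unfolding left_fibration_def lifts_def by blast

lemma kan_left_fillable: "kan_complex X \<Longrightarrow> left_fillable X"
  by (simp add: kan_complex_iff left_fillable_def)

lemma kan_sset: "kan_complex X \<Longrightarrow> simplicial_set X" by (simp add: kan_complex_iff)

lemma fills_ext:
  assumes "fills X (Suc n) k" "horn X (Suc n) k h"
  obtains x where "x \<in> simplices X (Suc n)" "\<And>i. i \<le> Suc n \<Longrightarrow> i \<noteq> k \<Longrightarrow> face X (Suc n) i x = h i"
  using assms unfolding fills_def by blast

text \<open>
  For \<open>a < b\<close>, read \<open>F a b\<close> as the prescribed common face of the faces \<open>a\<close> and \<open>b\<close> of an
  \<open>(n + 2)\<close>-simplex. Then \<open>\<omega>\<close> fits at \<open>b\<close> if it may serve as face \<open>b\<close>. The index shift in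
  \<open>face X (Suc n) (a - 1) \<omega>\<close> is that of the simplicial identity \<open>d\<^sub>a\<^sub>-\<^sub>1 d\<^sub>b = d\<^sub>b d\<^sub>a\<close> for \<open>b < a\<close>.
\<close>

definition fits :: "'a simplicial \<Rightarrow> nat \<Rightarrow> (nat \<Rightarrow> nat \<Rightarrow> 'a) \<Rightarrow> nat \<Rightarrow> 'a \<Rightarrow> bool" where
  "fits X n F b \<omega> \<longleftrightarrow> \<omega> \<in> simplices X (Suc n) \<and> (\<forall>a<b. face X (Suc n) a \<omega> = F a b) \<and>
     (\<forall>a. b < a \<and> a \<le> Suc (Suc n) \<longrightarrow> face X (Suc n) (a - 1) \<omega> = F b a)"

text \<open>
  Simplices that fit at all positions but one form a horn, and the remaining face of a filler fits at
  the missing position.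
\<close>

lemma fits_missing:
  assumes X: "simplicial_set X" and f: "fills X (Suc (Suc n)) r" and r: "r \<le> Suc (Suc n)"
    and o: "\<And>b. b \<le> Suc (Suc n) \<Longrightarrow> b \<noteq> r \<Longrightarrow> \<exists>\<omega>. fits X n F b \<omega>"
  shows "\<exists>\<omega>. fits X n F r \<omega>"
proof -
  obtain h where h: "\<And>b. b \<le> Suc (Suc n) \<Longrightarrow> b \<noteq> r \<Longrightarrow> fits X n F b (h b)" using o by metis
  have hl: "face X (Suc n) a (h b) = F a b" if "b \<le> Suc (Suc n)" "b \<noteq> r" "a < b" for a b
    using h[OF that(1,2)] that(3) by (simp add: fits_def)
  have hg: "face X (Suc n) (a - 1) (h b) = F b a" if "b \<noteq> r" "b < a" "a \<le> Suc (Suc n)" for a b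
    using h[of b] that by (simp add: fits_def)
  have "horn X (Suc (Suc n)) r h"
    unfolding horn_def using h hl hg by (auto simp: fits_def)
  from fills_ext[OF f this] obtain w where w: "w \<in> simplices X (Suc (Suc n))"
    "\<And>i. i \<le> Suc (Suc n) \<Longrightarrow> i \<noteq> r \<Longrightarrow> face X (Suc (Suc n)) i w = h i" by metis
  have "face X (Suc n) a (face X (Suc (Suc n)) r w) = F a r" if "a < r" for a
    using face_face[OF X w(1) that r] w(2)[of a] hg[of a r] that r by simp
  moreover have "face X (Suc n) (a - 1) (face X (Suc (Suc n)) r w) = F r a" if "r < a" "a \<le> Suc (Suc n)" for a
    using face_face[OF X w(1) that] w(2)[of a] hl[of a r] that r by simp
  ultimately show ?thesis unfolding fits_def using X w(1) r by blast
qed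

lemma horn_map:
  assumes g: "simplicial_map X Y g" and h: "horn X (Suc n) k h" and k: "k \<le> Suc n"
  shows "horn Y (Suc n) k (\<lambda>i. g n (h i))"
  unfolding horn_def
proof (intro conjI allI impI)
  fix i assume "i \<le> Suc n" "i \<noteq> k"
  then show "g n (h i) \<in> simplices Y (Suc n - 1)" using g h unfolding horn_def by auto
next
  fix i j assume a: "i < j \<and> j \<le> Suc n \<and> i \<noteq> k \<and> j \<noteq> k"
  show "face Y (Suc n - 1) i (g n (h j)) = face Y (Suc n - 1) (j - 1) (g n (h i))"
  proof (cases n)
    case 0 then show ?thesis using a k by linarith
  next
    case (Suc m)
    have hh: "h i \<in> simplices X (Suc m)" "h j \<in> simplices X (Suc m)"
      "face X (Suc m) i (h j) = face X (Suc m) (j - 1) (h i)"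
      using h a Suc unfolding horn_def by auto
    have "i \<le> Suc m" "j - 1 \<le> Suc m" using a Suc by auto
    then show ?thesis
      using Suc simplicial_map_face[OF g hh(1), of "j - 1"] simplicial_map_face[OF g hh(2), of i] hh(3)
      by simp
  qed
qed

lemma left_fibration_left_fillable:
  assumes "left_fibration E B q" "left_fillable B"
  shows "left_fillable E"
  unfolding left_fillable_def fills_def
proof (intro conjI allI impI)
  show "simplicial_set E" using assms by (simp add: left_fibration_iff)
  fix n k h assume nk: "1 \<le> n \<and> k < n" and h: "horn E n k h"
  have q: "simplicial_map E B q" using assms by (simp add: left_fibration_iff)
  obtain m where m: "n = Suc m" using nk by (cases n) auto
  have "horn B n k (\<lambda>i. q (n - 1) (h i))" using horn_map[OF q, of m k h] h m nk by simp
  moreover have "fills B n k" using assms(2) nk unfolding left_fillable_def by blast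
  ultimately obtain y where "y \<in> simplices B n" "\<forall>i\<le>n. i \<noteq> k \<longrightarrow> face B n i y = q (n - 1) (h i)"
    unfolding fills_def by blast
  then show "\<exists>x\<in>simplices E n. \<forall>i\<le>n. i \<noteq> k \<longrightarrow> face E n i x = h i"
    using assms(1) nk h unfolding left_fibration_def by blast
qed

lemma slice_op_in: "\<phi> \<in> mono_maps m n \<Longrightarrow> 0 # map Suc \<phi> \<in> mono_maps (Suc m) (Suc n)"
  by (auto simp: mono_maps_iff nth_Cons split: nat.splits)

lemma slice_op_comp:
  assumes "\<phi> \<in> mono_maps m n" "\<psi> \<in> mono_maps k m"
  shows "0 # map Suc (mono_comp \<phi> \<psi>) = mono_comp (0 # map Suc \<phi>) (0 # map Suc \<psi>)"
  using assms by (auto simp: mono_comp_def mono_maps_def)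

lemma slice_op_id: "0 # map Suc (mono_id n) = mono_id (Suc n)"
  by (simp add: mono_id_def map_Suc_upt upt_conv_Cons del: upt_Suc)

lemma slice_op_coface: "i \<le> n \<Longrightarrow> 0 # map Suc (coface n i) = coface (Suc n) (Suc i)"
  by (intro nth_equalityI) (auto simp: nth_Cons split: nat.splits)

lemma simplices_slice: "simplices (slice X x) n = {\<sigma> \<in> simplices X (Suc n). act X (Suc n) [0] \<sigma> = x}"
  by (simp add: slice_def)

lemma act_slice: "act (slice X x) n \<phi> = act X (Suc n) (0 # map Suc \<phi>)"
  by (simp add: slice_def fun_eq_iff)

lemma face_slice: "i \<le> n \<Longrightarrow> face (slice X x) n i \<sigma> = face X (Suc n) (Suc i) \<sigma>"
  by (simp add: face_def act_slice slice_op_coface)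

lemma simplicial_set_slice:
  assumes "simplicial_set X" shows "simplicial_set (slice X x)"
  unfolding simplicial_set_def
proof (intro conjI allI impI)
  fix n m \<phi> \<sigma> assume "\<phi> \<in> mono_maps m n \<and> \<sigma> \<in> simplices (slice X x) n"
  then show "act (slice X x) n \<phi> \<sigma> \<in> simplices (slice X x) m"
    using assms slice_op_in[of \<phi> m n] sset_act_act[OF assms, of \<sigma> "Suc n" _ "Suc m" "[0]" 0] single_in[of 0 "Suc m"]
    by (auto simp: simplices_slice act_slice mono_comp_def)
next
  fix n \<sigma> assume "\<sigma> \<in> simplices (slice X x) n"
  then show "act (slice X x) n (mono_id n) \<sigma> = \<sigma>"
    using assms by (simp add: simplices_slice act_slice slice_op_id sset_act_id)
next
  fix n m k \<phi> \<psi> \<sigma> assume a: "\<phi> \<in> mono_maps m n \<and> \<psi> \<in> mono_maps k m \<and> \<sigma> \<in> simplices (slice X x) n"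
  then show "act (slice X x) n (mono_comp \<phi> \<psi>) \<sigma> = act (slice X x) m \<psi> (act (slice X x) n \<phi> \<sigma>)"
    using assms a slice_op_in[of \<phi> m n] slice_op_in[of \<psi> k m]
    by (auto simp: simplices_slice act_slice slice_op_comp sset_act_act[of _ _ _ _ "Suc m"])
qed

lemma simplicial_map_slice_proj:
  assumes "simplicial_set X" shows "simplicial_map (slice X x) X (slice_proj X)"
  unfolding simplicial_map_def
proof (intro conjI allI impI)
  fix n \<sigma> assume "\<sigma> \<in> simplices (slice X x) n"
  then show "slice_proj X n \<sigma> \<in> simplices X n" using assms by (auto simp: simplices_slice slice_proj_def)
next
  fix n m \<phi> \<sigma> assume a: "\<phi> \<in> mono_maps m n \<and> \<sigma> \<in> simplices (slice X x) n"
  then have \<phi>: "\<phi> \<in> mono_maps m n" and \<sigma>: "\<sigma> \<in> simplices X (Suc n)" by (auto simp: simplices_slice)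
  have "mono_comp (0 # map Suc \<phi>) (coface (Suc m) 0) = mono_comp (coface (Suc n) 0) \<phi>"
    using \<phi> by (intro nth_equalityI) (auto simp: mono_maps_iff nth_Cons less_Suc_eq_le)
  then show "slice_proj X m (act (slice X x) n \<phi> \<sigma>) = act X n \<phi> (slice_proj X n \<sigma>)"
    using face_act[OF assms \<sigma> slice_op_in[OF \<phi>], of 0] act_face[OF assms \<sigma> \<phi>, of 0]
    by (simp add: act_slice slice_proj_def)
qed

text \<open>
  Forgetting the cone point is taking face \<open>0\<close>, so a horn in the slice whose projection extends to a
  simplex \<open>z\<close> is the same as a horn one dimension higher, with \<open>z\<close> as its face \<open>0\<close>.
\<close>

lemma slice_horn:
  assumes X: "simplicial_set X" and n: "1 \<le> n" and h: "horn (slice X x) n k h"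
    and z: "z \<in> simplices X n" "\<And>i. i \<le> n \<Longrightarrow> i \<noteq> k \<Longrightarrow> face X n i z = slice_proj X (n - 1) (h i)"
  shows "horn X (Suc n) (Suc k) (\<lambda>i. case i of 0 \<Rightarrow> z | Suc j \<Rightarrow> h j)"
  unfolding horn_def
proof (intro conjI allI impI)
  fix i assume "i \<le> Suc n" "i \<noteq> Suc k"
  then show "(case i of 0 \<Rightarrow> z | Suc j \<Rightarrow> h j) \<in> simplices X (Suc n - 1)"
    using h z n by (auto simp: horn_def simplices_slice split: nat.splits)
next
  fix i j assume a: "i < j \<and> j \<le> Suc n \<and> i \<noteq> Suc k \<and> j \<noteq> Suc k"
  obtain m where m: "n = Suc m" using n by (cases n) auto
  obtain j' where j: "j = Suc j'" using a by (cases j) auto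
  show "face X (Suc n - 1) i (case j of 0 \<Rightarrow> z | Suc j \<Rightarrow> h j) =
        face X (Suc n - 1) (j - 1) (case i of 0 \<Rightarrow> z | Suc j \<Rightarrow> h j)"
  proof (cases i)
    case 0 then show ?thesis using a j m z by (simp add: slice_proj_def)
  next
    case (Suc i')
    have "face (slice X x) m i' (h j') = face (slice X x) m (j' - 1) (h i')"
      using h a j Suc m unfolding horn_def by auto
    moreover have "i' \<le> m" "j' - 1 \<le> m" "j' \<noteq> 0" using a j Suc m by auto
    ultimately show ?thesis using j Suc m by (simp add: face_slice)
  qed
qed

lemma slice_filler:
  assumes X: "simplicial_set X" and n: "1 \<le> n" and h: "horn (slice X x) n k h" and k: "k \<le> n"
    and w: "\<omega> \<in> simplices X (Suc n)" "\<And>i. i \<le> n \<Longrightarrow> i \<noteq> k \<Longrightarrow> face X (Suc n) (Suc i) \<omega> = h i"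
  shows "\<omega> \<in> simplices (slice X x) n" "\<And>i. i \<le> n \<Longrightarrow> i \<noteq> k \<Longrightarrow> face (slice X x) n i \<omega> = h i"
proof -
  obtain i where i: "i \<le> n" "i \<noteq> k" using n by (metis le0 le_eq_less_or_eq less_one not_less)
  have "act X n [0] (h i) = x" using h i n unfolding horn_def by (auto simp: simplices_slice)
  moreover have "act X n [0] (face X (Suc n) (Suc i) \<omega>) = act X (Suc n) [0] \<omega>"
    using vertex_face[OF X w(1), of "Suc i" 0] i by simp
  ultimately show "\<omega> \<in> simplices (slice X x) n" using w i by (simp add: simplices_slice)
  show "\<And>i. i \<le> n \<Longrightarrow> i \<noteq> k \<Longrightarrow> face (slice X x) n i \<omega> = h i" using w by (simp add: face_slice)
qed

text \<open>
  The horn \<open>\<Lambda>\<^sup>k[n]\<close> in the slice becomes \<open>\<Lambda>\<^sup>k\<^sup>+\<^sup>1[n+1]\<close> in \<open>X\<close>, which is inner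
  if \<open>k < n\<close>.
\<close>

lemma lifts_slice_proj:
  assumes X: "simplicial_set X" and n: "1 \<le> n" "k \<le> n" and f: "fills X (Suc n) (Suc k)"
  shows "lifts (slice X x) X (slice_proj X) n k"
  unfolding lifts_def
proof (intro allI impI, elim conjE)
  fix h y assume h: "horn (slice X x) n k h" and y: "y \<in> simplices X n"
    and m: "\<forall>i\<le>n. i \<noteq> k \<longrightarrow> face X n i y = slice_proj X (n - 1) (h i)"
  obtain w where w: "w \<in> simplices X (Suc n)"
    "\<And>i. i \<le> Suc n \<Longrightarrow> i \<noteq> Suc k \<Longrightarrow> face X (Suc n) i w = (case i of 0 \<Rightarrow> y | Suc j \<Rightarrow> h j)"
    using fills_ext[OF f slice_horn[OF X n(1) h y]] m by metis
  have w': "\<And>i. i \<le> n \<Longrightarrow> i \<noteq> k \<Longrightarrow> face X (Suc n) (Suc i) w = h i" using w(2)[of "Suc _"] by simp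
  show "\<exists>\<omega>\<in>simplices (slice X x) n. slice_proj X n \<omega> = y \<and> (\<forall>i\<le>n. i \<noteq> k \<longrightarrow> face (slice X x) n i \<omega> = h i)"
    using slice_filler[OF X n(1) h n(2) w(1) w'] w(2)[of 0] by (auto simp: slice_proj_def)
qed

lemma left_fibration_slice_proj: "left_fillable X \<Longrightarrow> left_fibration (slice X x) X (slice_proj X)"
  by (simp add: left_fibration_iff left_fillable_def simplicial_set_slice simplicial_map_slice_proj lifts_slice_proj)

definition strict_fibre :: "'a simplicial \<Rightarrow> 'b simplicial \<Rightarrow> (nat \<Rightarrow> 'a \<Rightarrow> 'b) \<Rightarrow> 'b \<Rightarrow> 'a simplicial" where
  "strict_fibre E B q b =
    \<lparr>simplices = (\<lambda>n. {\<sigma> \<in> simplices E n. q n \<sigma> = const_simplex B n b}), act = act E\<rparr>"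

lemma simplices_strict_fibre:
  "simplices (strict_fibre E B q b) n = {\<sigma> \<in> simplices E n. q n \<sigma> = const_simplex B n b}"
  by (simp add: strict_fibre_def)

lemma act_strict_fibre [simp]: "act (strict_fibre E B q b) = act E"
  by (simp add: strict_fibre_def)

lemma face_strict_fibre [simp]: "face (strict_fibre E B q b) = face E"
  by (simp add: face_def fun_eq_iff)

lemma const_strict_fibre [simp]: "const_simplex (strict_fibre E B q b) = const_simplex E"
  by (simp add: const_simplex_def fun_eq_iff)

lemma simplicial_set_strict_fibre:
  assumes "simplicial_set E" "simplicial_set B" "simplicial_map E B q" "b \<in> simplices B 0"
  shows "simplicial_set (strict_fibre E B q b)"
  unfolding simplicial_set_def
proof (intro conjI allI impI)
  fix n m \<phi> x assume "\<phi> \<in> mono_maps m n \<and> x \<in> simplices (strict_fibre E B q b) n"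
  then show "act (strict_fibre E B q b) n \<phi> x \<in> simplices (strict_fibre E B q b) m"
    using assms by (auto simp: simplices_strict_fibre simplicial_map_act act_const)
next
  fix n x assume "x \<in> simplices (strict_fibre E B q b) n"
  then show "act (strict_fibre E B q b) n (mono_id n) x = x"
    using assms by (simp add: simplices_strict_fibre sset_act_id)
next
  fix n m k \<phi> \<psi> x assume "\<phi> \<in> mono_maps m n \<and> \<psi> \<in> mono_maps k m \<and> x \<in> simplices (strict_fibre E B q b) n"
  then show "act (strict_fibre E B q b) n (mono_comp \<phi> \<psi>) x =
      act (strict_fibre E B q b) m \<psi> (act (strict_fibre E B q b) n \<phi> x)"
    by (simp add: simplices_strict_fibre) (metis assms(1) sset_act_act)
qed

lemma horn_strict_fibre:
  "horn (strict_fibre E B q b) n k h \<longleftrightarrow>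
    horn E n k h \<and> (\<forall>i\<le>n. i \<noteq> k \<longrightarrow> q (n - 1) (h i) = const_simplex B (n - 1) b)"
  by (auto simp: horn_def simplices_strict_fibre)

lemma fills_strict_fibre:
  assumes B: "simplicial_set B" "b \<in> simplices B 0" and l: "lifts E B q n k" and n: "1 \<le> n"
  shows "fills (strict_fibre E B q b) n k"
proof -
  obtain m where m: "n = Suc m" using n by (cases n) auto
  show ?thesis unfolding fills_def horn_strict_fibre
  proof (intro allI impI, elim conjE)
    fix h assume h: "horn E n k h" "\<forall>i\<le>n. i \<noteq> k \<longrightarrow> q (n - 1) (h i) = const_simplex B (n - 1) b"
    then have "\<forall>i\<le>n. i \<noteq> k \<longrightarrow> face B n i (const_simplex B n b) = q (n - 1) (h i)"
      using B m by (simp add: face_const)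
    then show "\<exists>x\<in>simplices (strict_fibre E B q b) n. \<forall>i\<le>n. i \<noteq> k \<longrightarrow> face (strict_fibre E B q b) n i x = h i"
      using l h(1) const_simplex_in[OF B, of n] unfolding lifts_def simplices_strict_fibre face_strict_fibre
      by blast
  qed
qed

lemma left_fillable_strict_fibre:
  assumes "left_fibration E B q" "b \<in> simplices B 0"
  shows "left_fillable (strict_fibre E B q b)"
  using assms by (auto simp: left_fillable_def left_fibration_iff intro: simplicial_set_strict_fibre fills_strict_fibre)

section \<open>Isomorphisms and pullbacks\<close>

definition simplicial_iso :: "'a simplicial \<Rightarrow> 'b simplicial \<Rightarrow> (nat \<Rightarrow> 'a \<Rightarrow> 'b) \<Rightarrow> bool" where
  "simplicial_iso X Y g \<longleftrightarrow> simplicial_set X \<and> simplicial_set Y \<and> simplicial_map X Y g \<and>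
     (\<forall>n. bij_betw (g n) (simplices X n) (simplices Y n))"

lemma simplicial_iso_inverse:
  assumes "simplicial_iso X Y g"
  obtains g' where "simplicial_iso Y X g'"
    "\<And>n x. x \<in> simplices X n \<Longrightarrow> g' n (g n x) = x" "\<And>n y. y \<in> simplices Y n \<Longrightarrow> g n (g' n y) = y"
proof
  let ?g' = "\<lambda>n. inv_into (simplices X n) (g n)"
  have X: "simplicial_set X" "simplicial_set Y" and g: "simplicial_map X Y g"
    and b: "bij_betw (g n) (simplices X n) (simplices Y n)" for n
    using assms by (auto simp: simplicial_iso_def)
  show 1: "?g' n (g n x) = x" if "x \<in> simplices X n" for n x
    using b that by (rule bij_betw_inv_into_left)
  show 2: "g n (?g' n y) = y" if "y \<in> simplices Y n" for n y
    using b that by (rule bij_betw_inv_into_right)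
  have 3: "?g' n y \<in> simplices X n" if "y \<in> simplices Y n" for n y
    using b[of n] that by (simp add: bij_betw_def inv_into_into)
  have "simplicial_map Y X ?g'" unfolding simplicial_map_def
  proof (intro conjI allI impI 3)
    fix n m \<phi> y assume a: "\<phi> \<in> mono_maps m n \<and> y \<in> simplices Y n"
    then have "g m (act X n \<phi> (?g' n y)) = act Y n \<phi> y"
      using 2 3 simplicial_map_act[OF g] by auto
    then show "?g' m (act Y n \<phi> y) = act X n \<phi> (?g' n y)"
      using 1 3 X a sset_act_in by metis
  qed
  then show "simplicial_iso Y X ?g'" using X bij_betw_inv_into[OF b] by (simp add: simplicial_iso_def)
qed

lemma simplicial_iso_map: "simplicial_iso X Y g \<Longrightarrow> simplicial_map X Y g"
  by (simp add: simplicial_iso_def)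

lemma simplicial_iso_fills:
  assumes i: "simplicial_iso X Y g" and f: "fills X (Suc n) k" and k: "k \<le> Suc n"
  shows "fills Y (Suc n) k"
  unfolding fills_def
proof (intro allI impI)
  fix h assume h: "horn Y (Suc n) k h"
  obtain g' where g': "simplicial_map Y X g'"
    "\<And>n x. x \<in> simplices X n \<Longrightarrow> g' n (g n x) = x" "\<And>n y. y \<in> simplices Y n \<Longrightarrow> g n (g' n y) = y"
    using simplicial_iso_inverse[OF i] simplicial_iso_map by metis
  obtain x where x: "x \<in> simplices X (Suc n)" "\<And>i. i \<le> Suc n \<Longrightarrow> i \<noteq> k \<Longrightarrow> face X (Suc n) i x = g' n (h i)"
    using fills_ext[OF f horn_map[OF g'(1) h k]] by metis
  have g: "simplicial_map X Y g" using i by (simp add: simplicial_iso_def)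
  have "face Y (Suc n) i (g (Suc n) x) = h i" if "i \<le> Suc n" "i \<noteq> k" for i
    using that x simplicial_map_face[OF g x(1)] g'(3) h unfolding horn_def by (metis diff_Suc_1)
  then show "\<exists>x\<in>simplices Y (Suc n). \<forall>i\<le>Suc n. i \<noteq> k \<longrightarrow> face Y (Suc n) i x = h i"
    using g x(1) by blast
qed

lemma simplicial_iso_left_fillable: "simplicial_iso X Y g \<Longrightarrow> left_fillable X \<Longrightarrow> left_fillable Y"
  unfolding left_fillable_def by (metis Suc_le_D One_nat_def less_imp_le_nat simplicial_iso_def simplicial_iso_fills)

lemma simplicial_iso_kan: "simplicial_iso X Y g \<Longrightarrow> kan_complex X \<Longrightarrow> kan_complex Y"
  unfolding kan_complex_iff by (metis Suc_le_D One_nat_def simplicial_iso_def simplicial_iso_fills)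

definition relabel :: "('a \<Rightarrow> 'b) \<Rightarrow> 'a simplicial \<Rightarrow> 'b simplicial" where
  "relabel f X = \<lparr>simplices = (\<lambda>n. f ` simplices X n), act = (\<lambda>n \<phi> y. f (act X n \<phi> (inv_into UNIV f y)))\<rparr>"

lemma simplicial_iso_relabel:
  assumes X: "simplicial_set X" and f: "inj f"
  shows "simplicial_iso X (relabel f X) (\<lambda>_. f)"
proof -
  have "simplicial_set (relabel f X)"
    unfolding simplicial_set_def
  proof (intro conjI allI impI)
    fix n m \<phi> x assume "\<phi> \<in> mono_maps m n \<and> x \<in> simplices (relabel f X) n"
    then show "act (relabel f X) n \<phi> x \<in> simplices (relabel f X) m" using X f by (auto simp: relabel_def)
  next
    fix n x assume "x \<in> simplices (relabel f X) n"
    then show "act (relabel f X) n (mono_id n) x = x" using X f by (auto simp: relabel_def sset_act_id)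
  next
    fix n m k \<phi> \<psi> x assume "\<phi> \<in> mono_maps m n \<and> \<psi> \<in> mono_maps k m \<and> x \<in> simplices (relabel f X) n"
    then show "act (relabel f X) n (mono_comp \<phi> \<psi>) x = act (relabel f X) m \<psi> (act (relabel f X) n \<phi> x)"
      using X f by (auto simp: relabel_def sset_act_act)
  qed
  moreover have "bij_betw f (simplices X n) (simplices (relabel f X) n)" for n
    using f by (auto simp: relabel_def bij_betw_def inj_on_def)
  ultimately show ?thesis using assms
    by (auto simp: simplicial_iso_def simplicial_map_def relabel_def)
qed

lemma simplices_pullback:
  "simplices (pullback X Y p q) n = {(x, y). x \<in> simplices X n \<and> y \<in> simplices Y n \<and> p n x = q n y}"
  by (simp add: pullback_def)

lemma act_pullback [simp]: "act (pullback X Y p q) n \<phi> (x, y) = (act X n \<phi> x, act Y n \<phi> y)"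
  by (simp add: pullback_def)

lemma face_pullback [simp]: "face (pullback X Y p q) n i (x, y) = (face X n i x, face Y n i y)"
  by (simp add: face_def)

lemma face_pullback': "face (pullback X Y p q) n i z = (face X n i (fst z), face Y n i (snd z))"
  by (cases z) simp

lemma simplicial_set_pullback:
  assumes "simplicial_set X" "simplicial_set Y" "simplicial_map X Z p" "simplicial_map Y Z q"
  shows "simplicial_set (pullback X Y p q)"
  unfolding simplicial_set_def
proof (intro conjI allI impI)
  fix n m \<phi> z assume "\<phi> \<in> mono_maps m n \<and> z \<in> simplices (pullback X Y p q) n"
  then show "act (pullback X Y p q) n \<phi> z \<in> simplices (pullback X Y p q) m"
    using assms by (auto simp: simplices_pullback simplicial_map_act)
next
  fix n z assume "z \<in> simplices (pullback X Y p q) n"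
  then show "act (pullback X Y p q) n (mono_id n) z = z"
    using assms by (auto simp: simplices_pullback sset_act_id)
next
  fix n m k \<phi> \<psi> z assume "\<phi> \<in> mono_maps m n \<and> \<psi> \<in> mono_maps k m \<and> z \<in> simplices (pullback X Y p q) n"
  then show "act (pullback X Y p q) n (mono_comp \<phi> \<psi>) z =
      act (pullback X Y p q) m \<psi> (act (pullback X Y p q) n \<phi> z)"
    using sset_act_act[OF assms(1), of "fst z" n \<phi> m \<psi> k] sset_act_act[OF assms(2), of "snd z" n \<phi> m \<psi> k]
    by (auto simp: simplices_pullback)
qed

lemma simplicial_map_pullback:
  "simplicial_map (pullback X Y p q) X (\<lambda>_. fst)" "simplicial_map (pullback X Y p q) Y (\<lambda>_. snd)"
  by (auto simp: simplicial_map_def simplices_pullback)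

lemma lifts_pullback:
  assumes l: "lifts Y Z q n k" and p: "simplicial_map X Z p" and n: "1 \<le> n"
  shows "lifts (pullback X Y p q) X (\<lambda>_. fst) n k"
  unfolding lifts_def
proof (intro allI impI, elim conjE)
  fix h x assume h: "horn (pullback X Y p q) n k h" and x: "x \<in> simplices X n"
    and m: "\<forall>i\<le>n. i \<noteq> k \<longrightarrow> face X n i x = fst (h i)"
  obtain m where nm: "n = Suc m" using n by (cases n) auto
  have "horn Y n k (\<lambda>i. snd (h i))"
    using h unfolding horn_def by (fastforce simp: simplices_pullback face_pullback')
  moreover have "p n x \<in> simplices Z n" using p x by blast
  moreover have "face Z n i (p n x) = q (n - 1) (snd (h i))" if "i \<le> n" "i \<noteq> k" for i
  proof -
    have "h i \<in> simplices (pullback X Y p q) m" using h that nm unfolding horn_def by auto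
    then show ?thesis using simplicial_map_face[OF p, of x m i] x that m nm by (auto simp: simplices_pullback)
  qed
  ultimately obtain y where "y \<in> simplices Y n" "q n y = p n x" "\<forall>i\<le>n. i \<noteq> k \<longrightarrow> face Y n i y = snd (h i)"
    using l unfolding lifts_def by blast
  then show "\<exists>z\<in>simplices (pullback X Y p q) n. fst z = x \<and> (\<forall>i\<le>n. i \<noteq> k \<longrightarrow> face (pullback X Y p q) n i z = h i)"
    using x m by (intro bexI[of _ "(x, y)"]) (auto simp: simplices_pullback)
qed

lemma left_fibration_pullback:
  assumes "left_fibration Y Z q" "simplicial_set X" "simplicial_map X Z p"
  shows "left_fibration (pullback X Y p q) X (\<lambda>_. fst)"
  using assms by (auto simp: left_fibration_iff simplicial_map_pullback intro: simplicial_set_pullback intro!: lifts_pullback)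

section \<open>Triangles\<close>

abbreviation face2 :: "'a simplicial \<Rightarrow> nat \<Rightarrow> 'a \<Rightarrow> 'a" where "face2 X \<equiv> face X (Suc (Suc 0))"
abbreviation face3 :: "'a simplicial \<Rightarrow> nat \<Rightarrow> 'a \<Rightarrow> 'a" where "face3 X \<equiv> face X (Suc (Suc (Suc 0)))"

text \<open>
  The edges \<open>a\<close>, \<open>b\<close>, \<open>c\<close> are 01, 12 and 02, so \<open>c\<close> is a composite of \<open>a\<close> and \<open>b\<close>.
\<close>

definition tri :: "'a simplicial \<Rightarrow> 'a \<Rightarrow> 'a \<Rightarrow> 'a \<Rightarrow> bool" where
  "tri X a b c \<longleftrightarrow> (\<exists>t\<in>simplices X (Suc (Suc 0)). face2 X (Suc (Suc 0)) t = a \<and>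
     face2 X 0 t = b \<and> face2 X (Suc 0) t = c)"

abbreviation src :: "'a simplicial \<Rightarrow> 'a \<Rightarrow> 'a" where "src X \<equiv> face X (Suc 0) (Suc 0)"
abbreviation tgt :: "'a simplicial \<Rightarrow> 'a \<Rightarrow> 'a" where "tgt X \<equiv> face X (Suc 0) 0"
abbreviation unit_edge :: "'a simplicial \<Rightarrow> 'a \<Rightarrow> 'a" where "unit_edge X \<equiv> const_simplex X (Suc 0)"

lemma le_2: "i \<le> Suc (Suc 0) \<longleftrightarrow> i = 0 \<or> i = Suc 0 \<or> i = Suc (Suc 0)" by auto
lemma le_3: "i \<le> Suc (Suc (Suc 0)) \<longleftrightarrow> i = 0 \<or> i = Suc 0 \<or> i = Suc (Suc 0) \<or> i = Suc (Suc (Suc 0))" by auto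

lemma triE:
  assumes "simplicial_set X" "tri X a b c"
  shows "a \<in> edges X" "b \<in> edges X" "c \<in> edges X"
    "src X a = src X c" "tgt X a = src X b" "tgt X b = tgt X c"
proof -
  obtain t where t: "t \<in> simplices X (Suc (Suc 0))" "face2 X (Suc (Suc 0)) t = a"
     "face2 X 0 t = b" "face2 X (Suc 0) t = c"
    using assms(2) unfolding tri_def by blast
  show "a \<in> edges X" "b \<in> edges X" "c \<in> edges X"
    using t assms(1) by auto
  show "src X a = src X c" "tgt X a = src X b" "tgt X b = tgt X c"
    using face_face[OF assms(1) t(1), of "Suc 0" "Suc (Suc 0)"] face_face[OF assms(1) t(1), of 0 "Suc (Suc 0)"]
      face_face[OF assms(1) t(1), of 0 "Suc 0"] t by auto
qed

lemma edge_ends: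
  assumes "simplicial_set X" "e \<in> edges X"
  shows "src X e = act X (Suc 0) [0] e" "tgt X e = act X (Suc 0) [Suc 0] e"
  by (simp_all add: face_def)

lemma unit_edge_ends [simp]:
  assumes "simplicial_set X" "x \<in> simplices X 0"
  shows "src X (unit_edge X x) = x" "tgt X (unit_edge X x) = x"
  using face_const[OF assms, of _ 0] assms by auto

lemma list_0_1_in: "[0,Suc 0,Suc 0] \<in> mono_maps (Suc (Suc 0)) (Suc 0)" "[0,0,Suc 0] \<in> mono_maps (Suc (Suc 0)) (Suc 0)"
  by (auto simp: mono_maps_def)

lemma coface_2: "coface (Suc (Suc 0)) 0 = [Suc 0, Suc (Suc 0)]" "coface (Suc (Suc 0)) (Suc 0) = [0, Suc (Suc 0)]"
  "coface (Suc (Suc 0)) (Suc (Suc 0)) = [0, Suc 0]"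
  by (simp_all add: coface_def)

lemma act_unit_edge:
  assumes X: "simplicial_set X" and a: "a \<in> edges X"
  shows "act X (Suc 0) [Suc 0, Suc 0] a = unit_edge X (tgt X a)"
    "act X (Suc 0) [0, 0] a = unit_edge X (src X a)" "act X (Suc 0) [0, Suc 0] a = a"
  using sset_act_act[OF X a single_in[of "Suc 0" "Suc 0"], of "[0,0]" "Suc 0"]
    sset_act_act[OF X a single_in[of 0 "Suc 0"], of "[0,0]" "Suc 0"] sset_act_id[OF X a]
    replicate_in[of 0 0 "Suc 0"]
  by (auto simp: const_simplex_def edge_ends[OF X a] mono_comp_def mono_id_def)

lemma tri_unit:
  assumes X: "simplicial_set X" and a: "a \<in> edges X"
  shows "tri X a (unit_edge X (tgt X a)) a" "tri X (unit_edge X (src X a)) a a"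
proof -
  let ?s = "act X (Suc 0) [0,Suc 0,Suc 0] a" and ?t = "act X (Suc 0) [0,0,Suc 0] a"
  have "?s \<in> simplices X (Suc (Suc 0))" "?t \<in> simplices X (Suc (Suc 0))"
    using X a list_0_1_in by blast+
  moreover have "face2 X (Suc (Suc 0)) ?s = a" "face2 X 0 ?s = unit_edge X (tgt X a)"
     "face2 X (Suc 0) ?s = a"
    by (simp_all add: face_act[OF X a list_0_1_in(1)] coface_2 mono_comp_def act_unit_edge X a)
  moreover have "face2 X (Suc (Suc 0)) ?t = unit_edge X (src X a)" "face2 X 0 ?t = a"
     "face2 X (Suc 0) ?t = a"
    by (simp_all add: face_act[OF X a list_0_1_in(2)] coface_2 mono_comp_def act_unit_edge X a)
  ultimately show "tri X a (unit_edge X (tgt X a)) a" "tri X (unit_edge X (src X a)) a a"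
    unfolding tri_def by blast+
qed

lemma horn_2:
  "horn X (Suc (Suc 0)) 0 (case_nat z (case_nat c (case_nat a w))) \<longleftrightarrow>
     a \<in> edges X \<and> c \<in> edges X \<and> src X a = src X c"
  "horn X (Suc (Suc 0)) (Suc 0) (case_nat b (case_nat z (case_nat a w))) \<longleftrightarrow>
     a \<in> edges X \<and> b \<in> edges X \<and> tgt X a = src X b"
  "horn X (Suc (Suc 0)) (Suc (Suc 0)) (case_nat b (case_nat c (case_nat z w))) \<longleftrightarrow>
     b \<in> edges X \<and> c \<in> edges X \<and> tgt X c = tgt X b"
  unfolding horn_def le_2 by (auto split: nat.splits simp: less_Suc_eq)

lemma fill_2:
  shows "fills X (Suc (Suc 0)) 0 \<Longrightarrow> a \<in> edges X \<Longrightarrow> c \<in> edges X \<Longrightarrow> src X a = src X c \<Longrightarrow> \<exists>b. tri X a b c"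
   "fills X (Suc (Suc 0)) (Suc 0) \<Longrightarrow> a \<in> edges X \<Longrightarrow> b \<in> edges X \<Longrightarrow> tgt X a = src X b \<Longrightarrow> \<exists>c. tri X a b c"
   "fills X (Suc (Suc 0)) (Suc (Suc 0)) \<Longrightarrow> b \<in> edges X \<Longrightarrow> c \<in> edges X \<Longrightarrow> tgt X b = tgt X c \<Longrightarrow> \<exists>a. tri X a b c"
proof -
  have *: thesis
    if "fills X (Suc (Suc 0)) k" "horn X (Suc (Suc 0)) k h"
      "\<And>t. t \<in> simplices X (Suc (Suc 0)) \<Longrightarrow> (0 \<noteq> k \<Longrightarrow> face2 X 0 t = h 0) \<Longrightarrow>
        (Suc 0 \<noteq> k \<Longrightarrow> face2 X (Suc 0) t = h (Suc 0)) \<Longrightarrow>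
        (Suc (Suc 0) \<noteq> k \<Longrightarrow> face2 X (Suc (Suc 0)) t = h (Suc (Suc 0))) \<Longrightarrow> thesis"
    for k h thesis
    by (rule fills_ext[OF that(1,2)], rule that(3)) auto
  show "\<exists>b. tri X a b c"
    if "fills X (Suc (Suc 0)) 0" "a \<in> edges X" "c \<in> edges X" "src X a = src X c"
    by (rule *[OF that(1), of "case_nat undefined (case_nat c (case_nat a undefined))"])
      (use that in \<open>auto simp: horn_2 tri_def\<close>)
  show "\<exists>c. tri X a b c"
    if "fills X (Suc (Suc 0)) (Suc 0)" "a \<in> edges X" "b \<in> edges X" "tgt X a = src X b"
    by (rule *[OF that(1), of "case_nat b (case_nat undefined (case_nat a undefined))"])
      (use that in \<open>auto simp: horn_2 tri_def\<close>)
  show "\<exists>a. tri X a b c"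
    if "fills X (Suc (Suc 0)) (Suc (Suc 0))" "b \<in> edges X" "c \<in> edges X" "tgt X b = tgt X c"
    by (rule *[OF that(1), of "case_nat b (case_nat c (case_nat undefined undefined))"])
      (use that in \<open>auto simp: horn_2 tri_def\<close>)
qed

text \<open>
  The edge that the faces \<open>a < b\<close> of a tetrahedron have in common, that is, the edge between the other
  two vertices.
\<close>

definition tetra_edges :: "'a \<Rightarrow> 'a \<Rightarrow> 'a \<Rightarrow> 'a \<Rightarrow> 'a \<Rightarrow> 'a \<Rightarrow> nat \<Rightarrow> nat \<Rightarrow> 'a" where
  "tetra_edges e01 e02 e03 e12 e13 e23 a b = (if b = Suc 0 then e23 else if b = Suc (Suc 0)
     then (if a = 0 then e13 else e03) else if a = 0 then e12 else if a = Suc 0 then e02 else e01)"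

lemma tri_fits:
  fixes X :: "'a simplicial"
  defines "fit \<equiv> \<lambda>e01 e02 e03 e12 e13 e23 r. \<exists>\<omega>. fits X (Suc 0) (tetra_edges e01 e02 e03 e12 e13 e23) r \<omega>"
  shows "tri X e12 e23 e13 \<longleftrightarrow> fit e01 e02 e03 e12 e13 e23 0" (is ?a)
    "tri X e02 e23 e03 \<longleftrightarrow> fit e01 e02 e03 e12 e13 e23 (Suc 0)" (is ?b)
    "tri X e01 e13 e03 \<longleftrightarrow> fit e01 e02 e03 e12 e13 e23 (Suc (Suc 0))" (is ?c)
    "tri X e01 e12 e02 \<longleftrightarrow> fit e01 e02 e03 e12 e13 e23 (Suc (Suc (Suc 0)))" (is ?d)
proof -
  have 1: "(\<forall>a. Suc b < a \<and> a \<le> Suc n \<longrightarrow> P a) \<longleftrightarrow> (\<forall>a. b < a \<and> a \<le> n \<longrightarrow> P (Suc a))" for b n and P :: "nat \<Rightarrow> bool"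
    by (metis Suc_le_mono Suc_less_eq Suc_lessE)
  have 2: "(\<forall>a. 0 < a \<and> a \<le> Suc n \<longrightarrow> P a) \<longleftrightarrow> (\<forall>a\<le>n. P (Suc a))" for n and P :: "nat \<Rightarrow> bool"
    by (metis Suc_le_mono gr0_conv_Suc)
  show ?a ?b ?c ?d
    unfolding fit_def fits_def tri_def 1 2 all_le_Suc all_less_Suc0 by (auto simp: tetra_edges_def)
qed

text \<open>
  All computations in fundamental groups below are instances: up to homotopy, three faces of a
  tetrahedron express that its fourth face commutes.
\<close>

lemma tetrahedron:
  assumes X: "simplicial_set X"
  shows "fills X (Suc (Suc (Suc 0))) 0 \<Longrightarrow> tri X e01 e12 e02 \<Longrightarrow> tri X e01 e13 e03 \<Longrightarrow> tri X e02 e23 e03 \<Longrightarrow> tri X e12 e23 e13"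
   "fills X (Suc (Suc (Suc 0))) (Suc 0) \<Longrightarrow> tri X e01 e12 e02 \<Longrightarrow> tri X e01 e13 e03 \<Longrightarrow> tri X e12 e23 e13 \<Longrightarrow> tri X e02 e23 e03"
   "fills X (Suc (Suc (Suc 0))) (Suc (Suc 0)) \<Longrightarrow> tri X e01 e12 e02 \<Longrightarrow> tri X e02 e23 e03 \<Longrightarrow> tri X e12 e23 e13 \<Longrightarrow> tri X e01 e13 e03"
proof -
  note fit = tri_fits(1)[of X e12 e23 e13 e01 e02 e03] tri_fits(2)[of X e02 e23 e03 e01 e12 e13]
    tri_fits(3)[of X e01 e13 e03 e02 e12 e23] tri_fits(4)[of X e01 e12 e02 e03 e13 e23]
  note missing = fits_missing[OF X, of "Suc 0"]
  show "fills X (Suc (Suc (Suc 0))) 0 \<Longrightarrow> tri X e01 e12 e02 \<Longrightarrow> tri X e01 e13 e03 \<Longrightarrow> tri X e02 e23 e03 \<Longrightarrow> tri X e12 e23 e13"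
   "fills X (Suc (Suc (Suc 0))) (Suc 0) \<Longrightarrow> tri X e01 e12 e02 \<Longrightarrow> tri X e01 e13 e03 \<Longrightarrow> tri X e12 e23 e13 \<Longrightarrow> tri X e02 e23 e03"
   "fills X (Suc (Suc (Suc 0))) (Suc (Suc 0)) \<Longrightarrow> tri X e01 e12 e02 \<Longrightarrow> tri X e02 e23 e03 \<Longrightarrow> tri X e12 e23 e13 \<Longrightarrow> tri X e01 e13 e03"
    unfolding fit by (rule missing; (simp add: le_3; elim disjE; simp)?)+
qed

lemma left_fillable_sset: "left_fillable X \<Longrightarrow> simplicial_set X" by (simp add: left_fillable_def)

lemma left_fillable_fills: "left_fillable X \<Longrightarrow> k \<le> n \<Longrightarrow> fills X (Suc n) k" by (simp add: left_fillable_def)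

text \<open>
  Left horns yield triangles with composites \<open>f g \<sim> 1\<close> and then \<open>g h \<sim> 1\<close> (composites are written in
  path order). Hence \<open>h \<sim> f g h \<sim> f\<close>, and \<open>g f \<sim> g h \<sim> 1\<close>. This is the one special outer
  horn from which all other right horns are obtained.
\<close>

lemma right_inverse_triangle:
  assumes X: "left_fillable X" and f: "f \<in> edges X"
  shows "\<exists>g. tri X g f (unit_edge X (tgt X f))"
proof -
  note S = left_fillable_sset[OF X]
  have v: "src X f \<in> simplices X 0" "tgt X f \<in> simplices X 0" using S f by auto
  have u: "unit_edge X (src X f) \<in> edges X" "unit_edge X (tgt X f) \<in> edges X"
    using S v by blast+
  obtain g where g: "tri X f g (unit_edge X (src X f))"
    using fill_2(1)[OF left_fillable_fills[OF X] f u(1)] unit_edge_ends[OF S v(1)] by auto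
  note G = triE[OF S g]
  obtain h where h: "tri X g h (unit_edge X (tgt X f))"
    using fill_2(1)[OF left_fillable_fills[OF X] G(2) u(2)] unit_edge_ends[OF S v(2)] G by auto
  have "tri X (unit_edge X (src X f)) h f"
    using tetrahedron(2)[OF S left_fillable_fills[OF X] g tri_unit(1)[OF S f] h] by simp
  moreover have "tri X g (unit_edge X (src X f)) g"
    using tri_unit(1)[OF S G(2)] G S v by simp
  ultimately show ?thesis
    using tetrahedron(3)[OF S left_fillable_fills[OF X] _ h] by auto
qed

lemma lift_edge:
  assumes q: "left_fibration E B q" and e: "e \<in> simplices E 0" and g: "\<gamma> \<in> edges B" "src B \<gamma> = q 0 e"
  obtains \<epsilon> where "\<epsilon> \<in> edges E" "src E \<epsilon> = e" "q (Suc 0) \<epsilon> = \<gamma>"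
proof -
  have "horn E (Suc 0) 0 (\<lambda>_. e)" using e by (auto simp: horn_def)
  moreover have "lifts E B q (Suc 0) 0" using q by (simp add: left_fibration_iff)
  ultimately show thesis using that g unfolding lifts_def by (fastforce simp: le_Suc_eq)
qed

lemma lift_triangle:
  assumes q: "left_fibration E B q" and t: "tri B (q (Suc 0) a) \<beta> (q (Suc 0) c)"
    and a: "a \<in> edges E" and c: "c \<in> edges E" and s: "src E a = src E c"
  obtains b where "tri E a b c" "q (Suc 0) b = \<beta>"
proof -
  have qs: "simplicial_map E B q" using q by (simp add: left_fibration_iff)
  obtain t where t: "t \<in> simplices B (Suc (Suc 0))" "face2 B (Suc (Suc 0)) t = q (Suc 0) a"
     "face2 B 0 t = \<beta>" "face2 B (Suc 0) t = q (Suc 0) c"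
    using t unfolding tri_def by blast
  let ?h = "case_nat undefined (case_nat c (case_nat a undefined))"
  have "horn E (Suc (Suc 0)) 0 ?h" unfolding horn_2 using a c s by simp
  moreover have "\<forall>i\<le>Suc (Suc 0). i \<noteq> 0 \<longrightarrow> face2 B i t = q (Suc (Suc 0) - 1) (?h i)"
    unfolding le_2 using t by auto
  moreover have "lifts E B q (Suc (Suc 0)) 0" using q by (simp add: left_fibration_iff)
  ultimately obtain s where s: "s \<in> simplices E (Suc (Suc 0))" "q (Suc (Suc 0)) s = t"
     "\<forall>i\<le>Suc (Suc 0). i \<noteq> 0 \<longrightarrow> face2 E i s = ?h i"
    using t(1) unfolding lifts_def by blast
  have "tri E a (face2 E 0 s) c" unfolding tri_def using s(1,3) by (intro bexI[of _ s]) auto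
  moreover have "q (Suc 0) (face2 E 0 s) = \<beta>" using simplicial_map_face[OF qs s(1), of 0] s(2) t(3) by simp
  ultimately show thesis using that by blast
qed

section \<open>Left fibrations over Kan complexes are Kan\<close>

text \<open>
  For a map \<open>q: E \<rightarrow> B\<close> and a vertex \<open>e\<close>, the slice of \<open>E\<close> under \<open>e\<close> maps to the fibre product of
  \<open>E\<close> and the slice of \<open>B\<close> under \<open>q e\<close>. A simplex \<open>(\<tau>, \<sigma>)\<close> of this fibre product is encoded as the
  list \<open>\<tau> # \<sigma>\<close>, so that the base stays in the type \<open>'a list\<close> when the construction is iterated in
  an induction.
\<close>

definition matching :: "'a simplicial \<Rightarrow> 'a list simplicial \<Rightarrow> (nat \<Rightarrow> 'a \<Rightarrow> 'a list) \<Rightarrow> 'a \<Rightarrow> 'a list simplicial" where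
  "matching E B q e = relabel (\<lambda>(\<tau>, \<sigma>). \<tau> # \<sigma>) (pullback E (slice B (q 0 e)) q (slice_proj B))"

lemma inj_Cons_pair: "inj (\<lambda>(\<tau>, \<sigma>). \<tau> # \<sigma>)" by (auto simp: inj_def)

lemma matching_iso:
  assumes "left_fibration E B q" "left_fillable B"
  shows "simplicial_iso (pullback E (slice B (q 0 e)) q (slice_proj B)) (matching E B q e) (\<lambda>_ (\<tau>, \<sigma>). \<tau> # \<sigma>)"
  unfolding matching_def using assms left_fibration_slice_proj[OF assms(2), of "q 0 e"]
  by (intro simplicial_iso_relabel inj_Cons_pair simplicial_set_pullback) (auto simp: left_fibration_iff)

lemma left_fillable_pullback_slice:
  assumes "left_fibration E B q" "left_fillable B"
  shows "left_fillable (pullback E (slice B b) q (slice_proj B))"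
  by (rule left_fibration_left_fillable[OF left_fibration_pullback[OF left_fibration_slice_proj[OF assms(2)]]])
    (use assms left_fibration_left_fillable[OF assms] in \<open>auto simp: left_fibration_iff\<close>)

lemma left_fillable_matching:
  "left_fibration E B q \<Longrightarrow> left_fillable B \<Longrightarrow> left_fillable (matching E B q e)"
  by (rule simplicial_iso_left_fillable[OF matching_iso left_fillable_pullback_slice])

definition to_matching :: "'a simplicial \<Rightarrow> (nat \<Rightarrow> 'a \<Rightarrow> 'a list) \<Rightarrow> nat \<Rightarrow> 'a \<Rightarrow> 'a list" where
  "to_matching E q n \<sigma> = face E (Suc n) 0 \<sigma> # q (Suc n) \<sigma>"

lemma simplices_matching:
  "simplices (matching E B q e) n = {\<tau> # \<sigma> | \<tau> \<sigma>. \<tau> \<in> simplices E n \<and> \<sigma> \<in> simplices B (Suc n) \<and>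
      act B (Suc n) [0] \<sigma> = q 0 e \<and> q n \<tau> = face B (Suc n) 0 \<sigma>}"
  unfolding matching_def relabel_def by (auto simp: simplices_pullback simplices_slice slice_proj_def image_iff)

lemma inv_Cons_pair: "inv_into UNIV (\<lambda>(\<tau>, \<sigma>). \<tau> # \<sigma>) (\<tau> # \<sigma>) = (\<tau>, \<sigma>)"
  using inv_f_f[OF inj_Cons_pair, of "(\<tau>, \<sigma>)"] by simp

lemma act_matching: "act (matching E B q e) n \<phi> (\<tau> # \<sigma>) = act E n \<phi> \<tau> # act B (Suc n) (0 # map Suc \<phi>) \<sigma>"
  by (simp add: matching_def relabel_def inv_Cons_pair act_slice)

lemma face_matching: "i \<le> n \<Longrightarrow> face (matching E B q e) n i (\<tau> # \<sigma>) = face E n i \<tau> # face B (Suc n) (Suc i) \<sigma>"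
  by (simp add: face_def act_matching slice_op_coface)

lemma simplicial_map_to_matching:
  assumes q: "left_fibration E B q"
  shows "simplicial_map (slice E e) (matching E B q e) (to_matching E q)"
proof -
  have E: "simplicial_set E" and qs: "simplicial_map E B q" and e0: "simplicial_map (slice E e) E (slice_proj E)"
    using q simplicial_map_slice_proj by (auto simp: left_fibration_iff)
  show ?thesis unfolding simplicial_map_def
  proof (intro conjI allI impI)
    fix n \<sigma> assume s: "\<sigma> \<in> simplices (slice E e) n"
    then have "act B (Suc n) [0] (q (Suc n) \<sigma>) = q 0 e"
      using simplicial_map_act[OF qs _ single_in[of 0 "Suc n"], of \<sigma>] by (auto simp: simplices_slice)
    then show "to_matching E q n \<sigma> \<in> simplices (matching E B q e) n"
      using s E qs simplicial_map_face[OF qs] by (auto simp: simplices_matching to_matching_def simplices_slice)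
  next
    fix n m \<phi> \<sigma> assume "\<phi> \<in> mono_maps m n \<and> \<sigma> \<in> simplices (slice E e) n"
    then show "to_matching E q m (act (slice E e) n \<phi> \<sigma>) = act (matching E B q e) n \<phi> (to_matching E q n \<sigma>)"
      using simplicial_map_act[OF e0] simplicial_map_act[OF qs, of \<sigma> "Suc n" _ "Suc m"] slice_op_in[of \<phi> m n]
      by (auto simp: to_matching_def act_matching slice_proj_def simplices_slice act_slice)
  qed
qed

text \<open>
  A lifting problem against \<open>\<Lambda>\<^sup>k[n]\<close> for \<open>to_matching\<close> is one against \<open>\<Lambda>\<^sup>k\<^sup>+\<^sup>1[n+1]\<close> for
  \<open>q\<close>: a simplex of the base prescribes face \<open>0\<close> in \<open>E\<close> and the image in \<open>B\<close>.
\<close>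

lemma left_fibration_to_matching:
  assumes q: "left_fibration E B q" and B: "left_fillable B"
  shows "left_fibration (slice E e) (matching E B q e) (to_matching E q)"
  unfolding left_fibration_iff
proof (intro conjI allI impI)
  have E: "simplicial_set E" using q by (simp add: left_fibration_iff)
  show "simplicial_set (slice E e)" using E by (rule simplicial_set_slice)
  show "simplicial_set (matching E B q e)" using left_fillable_matching[OF q B] by (rule left_fillable_sset)
  show "simplicial_map (slice E e) (matching E B q e) (to_matching E q)" by (rule simplicial_map_to_matching[OF q])
  fix n k :: nat assume nk: "1 \<le> n \<and> k < n"
  then obtain m where m: "n = Suc m" by (cases n) auto
  show "lifts (slice E e) (matching E B q e) (to_matching E q) n k"
    unfolding lifts_def
  proof (intro allI impI, elim conjE)
    fix h y assume h: "horn (slice E e) n k h" and y: "y \<in> simplices (matching E B q e) n"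
      and f: "\<forall>i\<le>n. i \<noteq> k \<longrightarrow> face (matching E B q e) n i y = to_matching E q (n - 1) (h i)"
    obtain \<tau> \<sigma> where ts: "y = \<tau> # \<sigma>" "\<tau> \<in> simplices E n" "\<sigma> \<in> simplices B (Suc n)" "q n \<tau> = face B (Suc n) 0 \<sigma>"
      using y by (auto simp: simplices_matching)
    have f': "face E n i \<tau> = face E n 0 (h i)" "face B (Suc n) (Suc i) \<sigma> = q n (h i)" if "i \<le> n" "i \<noteq> k" for i
      using f that m ts(1) by (auto simp: face_matching to_matching_def)
    let ?h = "\<lambda>i. case i of 0 \<Rightarrow> \<tau> | Suc j \<Rightarrow> h j"
    have h': "horn E (Suc n) (Suc k) ?h"
      by (rule slice_horn[OF E _ h ts(2)]) (use nk f' m in \<open>auto simp: slice_proj_def\<close>)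
    have l: "lifts E B q (Suc n) (Suc k)" using q nk by (simp add: left_fibration_iff)
    have "\<forall>i\<le>Suc n. i \<noteq> Suc k \<longrightarrow> face B (Suc n) i \<sigma> = q (Suc n - 1) (?h i)"
      using f' ts(4) by (auto split: nat.splits)
    then obtain w where w: "w \<in> simplices E (Suc n)" "q (Suc n) w = \<sigma>"
        "\<forall>i\<le>Suc n. i \<noteq> Suc k \<longrightarrow> face E (Suc n) i w = ?h i"
      using l h' ts(3) unfolding lifts_def by blast
    have w': "\<And>i. i \<le> n \<Longrightarrow> i \<noteq> k \<Longrightarrow> face E (Suc n) (Suc i) w = h i" using w(3) by auto
    have "to_matching E q n w = y" using w ts(1) by (simp add: to_matching_def)
    then show "\<exists>x\<in>simplices (slice E e) n. to_matching E q n x = y \<and> (\<forall>i\<le>n. i \<noteq> k \<longrightarrow> face (slice E e) n i x = h i)"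
      using slice_filler[OF E _ h _ w(1) w'] nk by auto
  qed
qed

text \<open>
  To lift an edge with given end \<open>e\<close>, first lift a left inverse \<open>g\<close> of it from \<open>e\<close>, and then lift the
  triangle that exhibits \<open>g\<close> as inverse, with the degenerate edge at \<open>e\<close> over its third side.
\<close>

lemma lift_edge_to:
  assumes q: "left_fibration E B q" and B: "left_fillable B"
  shows "lifts E B q (Suc 0) (Suc 0)"
  unfolding lifts_def
proof (intro allI impI, elim conjE)
  fix h y assume h: "horn E (Suc 0) (Suc 0) h" and y: "y \<in> edges B"
    and f: "\<forall>i\<le>Suc 0. i \<noteq> Suc 0 \<longrightarrow> face B (Suc 0) i y = q (Suc 0 - 1) (h i)"
  note SB = left_fillable_sset[OF B]
  have SE: "simplicial_set E" and qs: "simplicial_map E B q" using q by (auto simp: left_fibration_iff)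
  let ?e = "h 0"
  have e: "?e \<in> simplices E 0" using h by (simp add: horn_def)
  have qe: "q 0 ?e \<in> simplices B 0" using qs e by blast
  have ty: "tgt B y = q 0 ?e" using f by simp
  obtain g where g: "tri B g y (unit_edge B (tgt B y))" using right_inverse_triangle[OF B y] by blast
  note G = triE[OF SB g]
  have sg: "src B g = q 0 ?e" using G ty unit_edge_ends[OF SB qe] by simp
  obtain g' where g': "g' \<in> edges E" "src E g' = ?e" "q (Suc 0) g' = g" by (rule lift_edge[OF q e G(1) sg])
  have "tri B (q (Suc 0) g') y (q (Suc 0) (unit_edge E ?e))" using g g' ty simplicial_map_const[OF qs e] by simp
  then obtain x where x: "tri E g' x (unit_edge E ?e)" "q (Suc 0) x = y"
    by (rule lift_triangle[OF q _ g'(1)]) (use SE e g' in auto)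
  then show "\<exists>x\<in>edges E. q (Suc 0) x = y \<and> (\<forall>i\<le>Suc 0. i \<noteq> Suc 0 \<longrightarrow> face E (Suc 0) i x = h i)"
    using triE[OF SE x(1)] unit_edge_ends[OF SE e] by (intro bexI[of _ x]) (auto simp: le_Suc_eq)
qed

text \<open>
  Joyal's argument, by induction on the dimension. With respect to its vertex \<open>0\<close>, a lifting problem for
  \<open>\<Lambda>\<^sup>m\<^sup>+\<^sup>1[m+1]\<close> is a lifting problem for \<open>\<Lambda>\<^sup>m[m]\<close> against \<open>to_matching\<close>, which is again a
  left fibration with left fillable base.
\<close>

lemma lifts_last_horn:
  fixes E :: "'a simplicial" and B :: "'a list simplicial"
  assumes "left_fibration E B q" and "left_fillable B"
  shows "lifts E B q (Suc m) (Suc m)"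
  using assms
proof (induction m arbitrary: E B q)
  case 0
  then show ?case by (rule lift_edge_to)
next
  case (Suc m E B q)
  note q = Suc.prems(1) and B = Suc.prems(2)
  have SE: "simplicial_set E" and qs: "simplicial_map E B q" using q by (auto simp: left_fibration_iff)
  show ?case unfolding lifts_def
  proof (intro allI impI, elim conjE)
    let ?n = "Suc m" and ?N = "Suc (Suc m)"
    fix h y assume h: "horn E ?N ?N h" and y: "y \<in> simplices B ?N"
      and f: "\<forall>i\<le>?N. i \<noteq> ?N \<longrightarrow> face B ?N i y = q (?N - 1) (h i)"
    have hin: "h i \<in> simplices E ?n" if "i \<le> ?n" for i using h that unfolding horn_def by auto
    have hc: "face E ?n i (h j) = face E ?n (j - 1) (h i)" if "i < j" "j \<le> ?n" for i j
      using h that unfolding horn_def by auto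
    define e where "e = act E ?n [0] (h (Suc 0))"
    have e: "act E ?n [0] (h i) = e" if "1 \<le> i" "i \<le> ?n" for i
    proof (cases "i = 1")
      case False
      then have i: "1 < i" using that by simp
      have "act E m [0] (face E ?n 1 (h i)) = act E m [0] (face E ?n (i - 1) (h 1))" using hc[OF i that(2)] by simp
      then show ?thesis using vertex_face[OF SE hin[OF that(2)], of 1 0] vertex_face[OF SE hin[of 1], of "i - 1" 0] i that
        by (simp add: e_def)
    qed (simp add: e_def)
    have ein: "e \<in> simplices E 0" unfolding e_def using SE hin[of "Suc 0"] by (intro sset_act_in) auto
    \<comment> \<open>Vertex \<open>0\<close> is missing from face \<open>0\<close>, so it is read off from face \<open>1\<close>.\<close>
    have vy: "act B ?N [0] y = q 0 e"
    proof -
      have "act B ?N [0] y = act B ?n [0] (face B ?N (Suc 0) y)"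
        using vertex_face[OF left_fillable_sset[OF B] y, of "Suc 0" 0] by simp
      also have "\<dots> = act B ?n [0] (q ?n (h (Suc 0)))" using f by simp
      also have "\<dots> = q 0 e" using simplicial_map_act[OF qs hin[of "Suc 0"], of "[0]" 0] by (simp add: e_def single_in)
      finally show ?thesis .
    qed
    let ?h = "\<lambda>i. h (Suc i)" and ?y = "h 0 # y"
    have "horn (slice E e) ?n ?n ?h"
      unfolding horn_def
    proof (intro conjI allI impI)
      fix i assume "i \<le> ?n" "i \<noteq> ?n"
      then show "h (Suc i) \<in> simplices (slice E e) (?n - 1)" using hin[of "Suc i"] e by (auto simp: simplices_slice)
    next
      fix i j assume a: "i < j \<and> j \<le> ?n \<and> i \<noteq> ?n \<and> j \<noteq> ?n"
      then have "i \<le> m" "j - 1 \<le> m" "Suc (j - 1) = j" by auto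
      then show "face (slice E e) (?n - 1) i (h (Suc j)) = face (slice E e) (?n - 1) (j - 1) (h (Suc i))"
        using hc[of "Suc i" "Suc j"] a by (simp add: face_slice)
    qed
    moreover have "?y \<in> simplices (matching E B q e) ?n"
      using hin[of 0] y vy f by (auto simp: simplices_matching)
    moreover have "\<forall>i\<le>?n. i \<noteq> ?n \<longrightarrow> face (matching E B q e) ?n i ?y = to_matching E q (?n - 1) (?h i)"
      using f hc[of 0 "Suc _"] by (auto simp: face_matching to_matching_def)
    ultimately obtain w where w: "w \<in> simplices (slice E e) ?n" "to_matching E q ?n w = ?y"
      "\<forall>i\<le>?n. i \<noteq> ?n \<longrightarrow> face (slice E e) ?n i w = ?h i"
      using Suc.IH[OF left_fibration_to_matching[OF q B, of e] left_fillable_matching[OF q B, of e]]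
      unfolding lifts_def by blast
    have "face E ?N i w = h i" if "i \<le> ?N" "i \<noteq> ?N" for i
      using that w(2,3) by (cases i) (auto simp: to_matching_def face_slice)
    then show "\<exists>x\<in>simplices E ?N. q ?N x = y \<and> (\<forall>i\<le>?N. i \<noteq> ?N \<longrightarrow> face E ?N i x = h i)"
      using w(1,2) by (auto simp: simplices_slice to_matching_def)
  qed
qed

definition point :: "'a list simplicial" where
  "point = \<lparr>simplices = (\<lambda>_. {[]}), act = (\<lambda>_ _ _. [])\<rparr>"

text \<open>
  Right horns are lifts along the map to the one-point simplicial set.
\<close>

theorem left_fillable_kan:
  assumes X: "left_fillable X" shows "kan_complex X"
proof -
  have P: "simplicial_set point" "left_fillable point"
    by (auto simp: simplicial_set_def point_def left_fillable_def fills_def horn_def face_def)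
  have "left_fibration X (point :: 'a list simplicial) (\<lambda>_ _. [])"
    unfolding left_fibration_iff
  proof (intro conjI allI impI)
    fix n k :: nat assume "1 \<le> n \<and> k < n"
    then have "fills X n k" using X by (simp add: left_fillable_def)
    then show "lifts X (point :: 'a list simplicial) (\<lambda>_ _. []) n k"
      unfolding fills_def lifts_def point_def by auto
  qed (use X P in \<open>auto simp: left_fillable_def simplicial_map_def point_def\<close>)
  then have l: "lifts X (point :: 'a list simplicial) (\<lambda>_ _. []) (Suc m) (Suc m)" for m
    by (rule lifts_last_horn[OF _ P(2)])
  have "fills X (Suc m) (Suc m)" for m
    using l[of m] unfolding fills_def lifts_def point_def face_def by simp
  then have "fills X n k" if "1 \<le> n" "k \<le> n" for n k
    using X that unfolding left_fillable_def by (metis Suc_le_D One_nat_def le_neq_implies_less)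
  then show ?thesis using X by (auto simp: kan_complex_iff left_fillable_def)
qed

lemma left_fibration_kan: "left_fibration E B q \<Longrightarrow> kan_complex B \<Longrightarrow> kan_complex E"
  by (rule left_fillable_kan[OF left_fibration_left_fillable[OF _ kan_left_fillable]])

section \<open>Homotopy relative to the boundary\<close>

text \<open>
  The \<open>n\<close>-simplices \<open>\<sigma>\<close> and \<open>\<tau>\<close> are the faces \<open>i\<close> and \<open>j\<close> of an \<open>(n + 1)\<close>-simplex whose other faces
  are those of \<open>D\<close>. For \<open>D = s\<^sub>l a\<close>, \<open>i = l\<close> and \<open>j = l + 1\<close> this is homotopy relative to the boundary of \<open>a\<close>; in general it compares
  simplices with the boundary of face \<open>i\<close> of \<open>D\<close> and simplices with the boundary of face \<open>j\<close>.
\<close>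

definition linked :: "'a simplicial \<Rightarrow> nat \<Rightarrow> nat \<Rightarrow> nat \<Rightarrow> 'a \<Rightarrow> ('a \<times> 'a) set" where
  "linked X n i j D = {(\<sigma>, \<tau>). \<exists>\<omega>\<in>simplices X (Suc n). face X (Suc n) i \<omega> = \<sigma> \<and> face X (Suc n) j \<omega> = \<tau> \<and>
     (\<forall>l\<le>Suc n. l \<noteq> i \<and> l \<noteq> j \<longrightarrow> face X (Suc n) l \<omega> = face X (Suc n) l D)}"

text \<open>
  The faces of codimension two of \<open>D\<close>, except that the three common faces of the faces \<open>i\<close>, \<open>j\<close> and
  \<open>k\<close> are replaced by \<open>A\<close>, \<open>B\<close> and \<open>C\<close>.
\<close>

definition triple_faces :: "'a simplicial \<Rightarrow> nat \<Rightarrow> nat \<Rightarrow> nat \<Rightarrow> nat \<Rightarrow> 'a \<Rightarrow> 'a \<Rightarrow> 'a \<Rightarrow> 'a \<Rightarrow> nat \<Rightarrow> nat \<Rightarrow> 'a" where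
  "triple_faces X n i j k D A B C a b = (if a = i \<and> b = j then A else if a = i \<and> b = k then B
     else if a = j \<and> b = k then C else face X (Suc n) a (face X (Suc (Suc n)) b D))"

lemma linked_fits:
  assumes X: "simplicial_set X" and D: "D \<in> simplices X (Suc (Suc n))" and ijk: "i < j" "j < k" "k \<le> Suc (Suc n)"
  shows
   "(A, B) \<in> linked X n (j - 1) (k - 1) (face X (Suc (Suc n)) i D) \<longleftrightarrow> (\<exists>\<omega>. fits X n (triple_faces X n i j k D A B C) i \<omega>)" (is ?i)
   "(A, C) \<in> linked X n i (k - 1) (face X (Suc (Suc n)) j D) \<longleftrightarrow> (\<exists>\<omega>. fits X n (triple_faces X n i j k D A B C) j \<omega>)" (is ?j)
   "(B, C) \<in> linked X n i j (face X (Suc (Suc n)) k D) \<longleftrightarrow> (\<exists>\<omega>. fits X n (triple_faces X n i j k D A B C) k \<omega>)" (is ?k)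
proof -
  let ?F = "triple_faces X n i j k D A B C"
  note ff = face_face[OF X D]
  have split: "(\<forall>l\<le>Suc n. P l) \<longleftrightarrow> (\<forall>a<b. P a) \<and> (\<forall>a. b < a \<and> a \<le> Suc (Suc n) \<longrightarrow> P (a - 1))"
    if "b \<le> Suc (Suc n)" for P :: "nat \<Rightarrow> bool" and b
  proof (intro iffI conjI allI impI)
    fix l assume a: "(\<forall>a<b. P a) \<and> (\<forall>a. b < a \<and> a \<le> Suc (Suc n) \<longrightarrow> P (a - 1))" "l \<le> Suc n"
    show "P l"
    proof (cases "l < b")
      case False
      then have "b < Suc l" "Suc l \<le> Suc (Suc n)" using a by auto
      then have "P (Suc l - 1)" using a(1) by blast
      then show ?thesis by simp
    qed (use a in auto)
  qed (use that in auto)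
  have main: "(\<sigma>, \<tau>) \<in> linked X n p q D' \<longleftrightarrow> (\<exists>\<omega>. fits X n ?F b \<omega>)"
    if pq: "p < q" "q \<le> Suc n" and b: "b \<le> Suc (Suc n)"
      and G: "\<And>a. a < b \<Longrightarrow> (if a = p then \<sigma> else if a = q then \<tau> else face X (Suc n) a D') = ?F a b"
      and H: "\<And>a. b < a \<Longrightarrow> a \<le> Suc (Suc n) \<Longrightarrow>
         (if a - 1 = p then \<sigma> else if a - 1 = q then \<tau> else face X (Suc n) (a - 1) D') = ?F b a"
    for \<sigma> \<tau> p q D' b
  proof -
    have "(\<sigma>, \<tau>) \<in> linked X n p q D' \<longleftrightarrow> (\<exists>\<omega>\<in>simplices X (Suc n). \<forall>l\<le>Suc n. face X (Suc n) l \<omega> =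
       (if l = p then \<sigma> else if l = q then \<tau> else face X (Suc n) l D'))"
      using pq unfolding linked_def by (auto intro!: bex_cong)
    also have "\<dots> \<longleftrightarrow> (\<exists>\<omega>. fits X n ?F b \<omega>)"
      unfolding fits_def Bex_def split[OF b]
      by (intro ex_cong1 conj_cong all_cong1 imp_cong refl) (simp_all only: G H)
    finally show ?thesis .
  qed
  show ?i
  proof (rule main)
    fix a assume "i < a" "a \<le> Suc (Suc n)"
    then show "(if a - 1 = j - 1 then A else if a - 1 = k - 1 then B
        else face X (Suc n) (a - 1) (face X (Suc (Suc n)) i D)) = ?F i a"
      using ijk ff[of i a] by (auto simp: triple_faces_def)
  qed (use ijk in \<open>auto simp: triple_faces_def\<close>)
  show ?j
  proof (rule main)
    fix a assume "j < a" "a \<le> Suc (Suc n)"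
    then show "(if a - 1 = i then A else if a - 1 = k - 1 then C
        else face X (Suc n) (a - 1) (face X (Suc (Suc n)) j D)) = ?F j a"
      using ijk ff[of j a] by (auto simp: triple_faces_def)
  qed (use ijk in \<open>auto simp: triple_faces_def\<close>)
  show ?k
  proof (rule main)
    fix a assume "k < a" "a \<le> Suc (Suc n)"
    then show "(if a - 1 = i then B else if a - 1 = j then C
        else face X (Suc n) (a - 1) (face X (Suc (Suc n)) k D)) = ?F k a"
      using ijk ff[of k a] by (auto simp: triple_faces_def)
  qed (use ijk in \<open>auto simp: triple_faces_def\<close>)
qed

text \<open>
  Change the faces \<open>i\<close>, \<open>j\<close>, \<open>k\<close> of \<open>D\<close> in such a way that their pairwise intersections become
  \<open>A\<close>, \<open>B\<close>, \<open>C\<close>. Given two of the changed faces, the third is obtained by filling a horn. Taking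
  degenerate simplices for \<open>D\<close>, this one statement gives all properties of homotopy relative to the
  boundary that are needed.
\<close>

lemma linked_two_of_three:
  fixes X :: "'a simplicial" and A B C :: 'a
  assumes X: "kan_complex X" and D: "D \<in> simplices X (Suc (Suc n))" and ijk: "i < j" "j < k" "k \<le> Suc (Suc n)"
  defines "RI \<equiv> (A, B) \<in> linked X n (j - 1) (k - 1) (face X (Suc (Suc n)) i D)"
    and "RJ \<equiv> (A, C) \<in> linked X n i (k - 1) (face X (Suc (Suc n)) j D)"
    and "RK \<equiv> (B, C) \<in> linked X n i j (face X (Suc (Suc n)) k D)"
  shows "RJ \<Longrightarrow> RK \<Longrightarrow> RI" "RI \<Longrightarrow> RK \<Longrightarrow> RJ" "RI \<Longrightarrow> RJ \<Longrightarrow> RK"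
proof -
  note S = kan_sset[OF X]
  let ?F = "triple_faces X n i j k D A B C"
  have fit: "\<exists>\<omega>. fits X n ?F r \<omega>"
    if r: "r \<in> {i, j, k}" and o: "\<And>b. b \<in> {i, j, k} \<Longrightarrow> b \<noteq> r \<Longrightarrow> \<exists>\<omega>. fits X n ?F b \<omega>" for r
  proof (rule fits_missing[OF S])
    show "fills X (Suc (Suc n)) r" "r \<le> Suc (Suc n)" using X r ijk by (auto simp: kan_complex_iff)
    fix b assume b: "b \<le> Suc (Suc n)" "b \<noteq> r"
    show "\<exists>\<omega>. fits X n ?F b \<omega>"
    proof (cases "b \<in> {i, j, k}")
      case False
      then have "fits X n ?F b (face X (Suc (Suc n)) b D)"
        using b(1) face_face[OF S D, of b] S D by (auto simp: triple_faces_def fits_def)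
      then show ?thesis by blast
    qed (use o b in blast)
  qed
  have P: "RI \<longleftrightarrow> (\<exists>\<omega>. fits X n ?F i \<omega>)" "RJ \<longleftrightarrow> (\<exists>\<omega>. fits X n ?F j \<omega>)" "RK \<longleftrightarrow> (\<exists>\<omega>. fits X n ?F k \<omega>)"
    unfolding RI_def RJ_def RK_def linked_fits(1)[OF S D ijk, of A B C] linked_fits(2)[OF S D ijk, of A C B]
      linked_fits(3)[OF S D ijk, of B C A] by blast+
  show "RJ \<Longrightarrow> RK \<Longrightarrow> RI" "RI \<Longrightarrow> RK \<Longrightarrow> RJ" "RI \<Longrightarrow> RJ \<Longrightarrow> RK"
    unfolding P by (rule fit; auto)+
qed

definition same_boundary :: "'a simplicial \<Rightarrow> nat \<Rightarrow> 'a \<Rightarrow> 'a set" where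
  "same_boundary X n a = {\<sigma> \<in> simplices X n. \<forall>i\<le>n. face X n i \<sigma> = face X n i a}"

text \<open>
  Replacing a face of \<open>D\<close> by a simplex with the same boundary, and leaving out another face, gives a horn.
\<close>

lemma linked_total:
  assumes X: "kan_complex X" and D: "D \<in> simplices X (Suc (Suc m))" and ij: "i < j" "j \<le> Suc (Suc m)"
  shows "\<sigma> \<in> same_boundary X (Suc m) (face X (Suc (Suc m)) i D) \<Longrightarrow>
      \<exists>\<tau>\<in>same_boundary X (Suc m) (face X (Suc (Suc m)) j D). (\<sigma>, \<tau>) \<in> linked X (Suc m) i j D"
    and "\<tau> \<in> same_boundary X (Suc m) (face X (Suc (Suc m)) j D) \<Longrightarrow>
      \<exists>\<sigma>\<in>same_boundary X (Suc m) (face X (Suc (Suc m)) i D). (\<sigma>, \<tau>) \<in> linked X (Suc m) i j D"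
proof -
  note S = kan_sset[OF X] and ff = face_face[OF kan_sset[OF X]]
  have *: "\<exists>w\<in>simplices X (Suc (Suc m)). face X (Suc (Suc m)) p w = \<rho> \<and>
     face X (Suc (Suc m)) r w \<in> same_boundary X (Suc m) (face X (Suc (Suc m)) r D) \<and>
     (\<forall>l\<le>Suc (Suc m). l \<noteq> p \<and> l \<noteq> r \<longrightarrow> face X (Suc (Suc m)) l w = face X (Suc (Suc m)) l D)"
    if \<rho>: "\<rho> \<in> same_boundary X (Suc m) (face X (Suc (Suc m)) p D)" and pr: "p \<noteq> r" "p \<le> Suc (Suc m)" "r \<le> Suc (Suc m)"
    for p r \<rho>
  proof -
    let ?h = "\<lambda>l. if l = p then \<rho> else face X (Suc (Suc m)) l D"
    have h: "?h l \<in> same_boundary X (Suc m) (face X (Suc (Suc m)) l D)" if "l \<le> Suc (Suc m)" for l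
      using that \<rho> S D by (auto simp: same_boundary_def)
    have hf: "face X (Suc m) a (?h l) = face X (Suc m) a (face X (Suc (Suc m)) l D)" if "a \<le> Suc m" "l \<le> Suc (Suc m)" for a l
      using h that by (auto simp: same_boundary_def)
    have hh: "horn X (Suc (Suc m)) r ?h" unfolding horn_def
    proof (intro conjI allI impI)
      fix l assume "l \<le> Suc (Suc m)" "l \<noteq> r"
      then show "?h l \<in> simplices X (Suc (Suc m) - 1)" using h[of l] unfolding same_boundary_def by simp
    next
      fix l l' assume a: "l < l' \<and> l' \<le> Suc (Suc m) \<and> l \<noteq> r \<and> l' \<noteq> r"
      then have "l \<le> Suc m" "l' - 1 \<le> Suc m" "l \<le> Suc (Suc m)" "l' \<le> Suc (Suc m)" by auto
      then show "face X (Suc (Suc m) - 1) l (?h l') = face X (Suc (Suc m) - 1) (l' - 1) (?h l)"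
        using hf[of l l'] hf[of "l' - 1" l] ff[OF D, of l l'] a by simp
    qed
    have "fills X (Suc (Suc m)) r" using X pr by (simp add: kan_complex_iff)
    from fills_ext[OF this hh] obtain w where w: "w \<in> simplices X (Suc (Suc m))"
      "\<And>l. l \<le> Suc (Suc m) \<Longrightarrow> l \<noteq> r \<Longrightarrow> face X (Suc (Suc m)) l w = ?h l"
      by blast
    have "face X (Suc m) a (face X (Suc (Suc m)) r w) = face X (Suc m) a (face X (Suc (Suc m)) r D)" if "a \<le> Suc m" for a
    proof (cases "a < r")
      case True
      then show ?thesis using ff[OF w(1), of a r] ff[OF D, of a r] w(2)[of a] hf[of "r - 1" a] pr that by auto
    next
      case False
      then have "r < Suc a" "Suc a \<le> Suc (Suc m)" using that by auto
      then show ?thesis using ff[OF w(1), of r "Suc a"] ff[OF D, of r "Suc a"] w(2)[of "Suc a"] hf[of r "Suc a"] by auto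
    qed
    then have "face X (Suc (Suc m)) r w \<in> same_boundary X (Suc m) (face X (Suc (Suc m)) r D)"
      using face_in[OF S w(1) pr(3)] by (simp add: same_boundary_def)
    then show ?thesis using w pr by (intro bexI[of _ w]) simp_all
  qed
  show "\<exists>\<tau>\<in>same_boundary X (Suc m) (face X (Suc (Suc m)) j D). (\<sigma>, \<tau>) \<in> linked X (Suc m) i j D"
    if "\<sigma> \<in> same_boundary X (Suc m) (face X (Suc (Suc m)) i D)"
    using *[OF that, of j] ij by (auto simp: linked_def)
  show "\<exists>\<sigma>\<in>same_boundary X (Suc m) (face X (Suc (Suc m)) i D). (\<sigma>, \<tau>) \<in> linked X (Suc m) i j D"
    if "\<tau> \<in> same_boundary X (Suc m) (face X (Suc (Suc m)) j D)"
    using *[OF that, of i] ij by (auto simp: linked_def)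
qed

definition codegen :: "nat \<Rightarrow> nat \<Rightarrow> nat list" where
  "codegen n l = map (\<lambda>t. if t \<le> l then t else t - 1) [0..<Suc (Suc n)]"

definition degen :: "'a simplicial \<Rightarrow> nat \<Rightarrow> nat \<Rightarrow> 'a \<Rightarrow> 'a" where
  "degen X n l a = act X n (codegen n l) a"

lemma length_codegen [simp]: "length (codegen n l) = Suc (Suc n)" by (simp add: codegen_def)

lemma nth_codegen [simp]: "t \<le> Suc n \<Longrightarrow> codegen n l ! t = (if t \<le> l then t else t - 1)"
  by (simp add: codegen_def less_Suc_eq_le del: upt_Suc)

lemma codegen_in: "l \<le> n \<Longrightarrow> codegen n l \<in> mono_maps (Suc n) n"
  by (auto simp: mono_maps_iff)

lemma degen_in: "simplicial_set X \<Longrightarrow> a \<in> simplices X n \<Longrightarrow> l \<le> n \<Longrightarrow> degen X n l a \<in> simplices X (Suc n)"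
  unfolding degen_def by (rule sset_act_in[OF _ _ codegen_in])

lemma face_degen_eq:
  assumes X: "simplicial_set X" and a: "a \<in> simplices X n" and l: "l \<le> n" and i: "i = l \<or> i = Suc l"
  shows "face X (Suc n) i (degen X n l a) = a"
proof -
  have "mono_comp (codegen n l) (coface (Suc n) i) = mono_id n"
    using l i by (intro nth_equalityI) (auto simp: less_Suc_eq_le)
  then show ?thesis using face_act[OF X a codegen_in[OF l], of i] i l sset_act_id[OF X a] by (auto simp: degen_def)
qed

lemma face_degen_less:
  assumes X: "simplicial_set X" and a: "a \<in> simplices X (Suc n)" and l: "l \<le> Suc n" and i: "i < l"
  shows "face X (Suc (Suc n)) i (degen X (Suc n) l a) = degen X n (l - 1) (face X (Suc n) i a)"
proof -
  have "mono_comp (codegen (Suc n) l) (coface (Suc (Suc n)) i) = mono_comp (coface (Suc n) i) (codegen n (l - 1))"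
    using l i by (intro nth_equalityI) (auto simp: less_Suc_eq_le)
  then show ?thesis
    using face_act[OF X a codegen_in[OF l], of i] act_face[OF X a codegen_in[of "l - 1" n], of i] i l by (auto simp: degen_def)
qed

lemma face_degen_greater:
  assumes X: "simplicial_set X" and a: "a \<in> simplices X (Suc n)" and l: "Suc l < i" and i: "i \<le> Suc (Suc n)"
  shows "face X (Suc (Suc n)) i (degen X (Suc n) l a) = degen X n l (face X (Suc n) (i - 1) a)"
proof -
  have "mono_comp (codegen (Suc n) l) (coface (Suc (Suc n)) i) = mono_comp (coface (Suc n) (i - 1)) (codegen n l)"
    using l i by (intro nth_equalityI) (auto simp: less_Suc_eq_le)
  then show ?thesis
    using face_act[OF X a codegen_in[of l "Suc n"], of i] act_face[OF X a codegen_in[of l n], of "i - 1"] i l by (auto simp: degen_def)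
qed

text \<open>
  Homotopy relative to the boundary of \<open>a\<close>. Homotopy groups use the index \<open>l = n\<close>, whereas pushing
  simplices from face \<open>j\<close> to face \<open>j + 1\<close> of another simplex produces homotopies of index \<open>j\<close>.
\<close>

definition hom_rel :: "'a simplicial \<Rightarrow> nat \<Rightarrow> nat \<Rightarrow> 'a \<Rightarrow> ('a \<times> 'a) set" where
  "hom_rel X n l a = linked X n l (Suc l) (degen X n l a) \<inter> same_boundary X n a \<times> same_boundary X n a"

lemma same_boundary_refl: "a \<in> simplices X n \<Longrightarrow> a \<in> same_boundary X n a" by (simp add: same_boundary_def)

lemma degen_faces_same_boundary:
  assumes X: "simplicial_set X" and a: "a \<in> simplices X (Suc m)" and s: "\<sigma> \<in> same_boundary X (Suc m) a"
    and l: "l \<le> Suc m" and i: "i \<le> Suc (Suc m)" "i \<noteq> l" "i \<noteq> Suc l"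
  shows "face X (Suc (Suc m)) i (degen X (Suc m) l \<sigma>) = face X (Suc (Suc m)) i (degen X (Suc m) l a)"
proof (cases "i < l")
  case True
  then show ?thesis using face_degen_less[OF X _ l] a s i l by (simp add: same_boundary_def)
next
  case False
  then have "Suc l < i" using i by simp
  then show ?thesis using face_degen_greater[OF X _ _ i(1)] a s i l by (simp add: same_boundary_def)
qed

lemma linked_degen_same_boundary:
  assumes X: "simplicial_set X" and a: "a \<in> simplices X (Suc m)" and s: "\<sigma> \<in> same_boundary X (Suc m) a" and l: "l \<le> Suc m"
  shows "linked X (Suc m) l (Suc l) (degen X (Suc m) l \<sigma>) = linked X (Suc m) l (Suc l) (degen X (Suc m) l a)"
  unfolding linked_def using degen_faces_same_boundary[OF X a s l] by auto

lemma linked_refl: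
  assumes X: "simplicial_set X" and a: "a \<in> simplices X (Suc m)" and s: "\<sigma> \<in> same_boundary X (Suc m) a" and l: "l \<le> Suc m"
  shows "(\<sigma>, \<sigma>) \<in> linked X (Suc m) l (Suc l) (degen X (Suc m) l a)"
proof -
  have s': "\<sigma> \<in> simplices X (Suc m)" using s by (simp add: same_boundary_def)
  show ?thesis unfolding linked_def
    using degen_faces_same_boundary[OF X a s l] face_degen_eq[OF X s' l] degen_in[OF X s' l] by blast
qed

lemma degen_degen:
  assumes X: "simplicial_set X" and a: "a \<in> simplices X n" and l: "l \<le> n"
  shows "face X (Suc (Suc n)) l (degen X (Suc n) l (degen X n l a)) = degen X n l a"
    "face X (Suc (Suc n)) (Suc l) (degen X (Suc n) l (degen X n l a)) = degen X n l a"
    "face X (Suc (Suc n)) (Suc (Suc l)) (degen X (Suc n) l (degen X n l a)) = degen X n l a"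
  using face_degen_eq[OF X degen_in[OF X a l], of l] face_degen_eq[OF X a l]
    face_degen_greater[OF X degen_in[OF X a l], of l "Suc (Suc l)"] l by auto

text \<open>
  The faces \<open>l\<close>, \<open>l + 1\<close>, \<open>l + 2\<close> of the twice degenerate simplex \<open>s\<^sub>l s\<^sub>l a\<close> are all \<open>s\<^sub>l a\<close>.
\<close>

lemma hom_rel_euclid:
  assumes X: "kan_complex X" and a: "a \<in> simplices X n" and l: "l \<le> n"
    and r: "(A, B) \<in> linked X n l (Suc l) (degen X n l a)" "(A, C) \<in> linked X n l (Suc l) (degen X n l a)"
  shows "(B, C) \<in> linked X n l (Suc l) (degen X n l a)"
proof -
  note S = kan_sset[OF X]
  have D: "degen X (Suc n) l (degen X n l a) \<in> simplices X (Suc (Suc n))"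
    using degen_in[OF S degen_in[OF S a l]] l by simp
  show ?thesis
    using linked_two_of_three(3)[OF X D, of l "Suc l" "Suc (Suc l)" A B C] r l degen_degen[OF S a l] by simp
qed

lemma hom_rel_equiv:
  assumes X: "kan_complex X" and a: "a \<in> simplices X (Suc m)" and l: "l \<le> Suc m"
  shows "equiv (same_boundary X (Suc m) a) (hom_rel X (Suc m) l a)"
proof -
  note S = kan_sset[OF X]
  have r: "(A, A) \<in> linked X (Suc m) l (Suc l) (degen X (Suc m) l a)" if "A \<in> same_boundary X (Suc m) a" for A
    using linked_refl[OF S a that l] .
  have s: "(B, A) \<in> hom_rel X (Suc m) l a" if "(A, B) \<in> hom_rel X (Suc m) l a" for A B
    using that r hom_rel_euclid[OF X a l, of A B A] by (auto simp: hom_rel_def)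
  have t: "(A, C) \<in> hom_rel X (Suc m) l a" if "(A, B) \<in> hom_rel X (Suc m) l a" "(B, C) \<in> hom_rel X (Suc m) l a" for A B C
    using s[OF that(1)] that hom_rel_euclid[OF X a l, of B A C] by (auto simp: hom_rel_def)
  show ?thesis
  proof (rule equivI)
    show "sym (hom_rel X (Suc m) l a)" using s by (rule symI)
    show "trans (hom_rel X (Suc m) l a)" using t by (rule transI)
  qed (use r in \<open>auto simp: hom_rel_def refl_on_def\<close>)
qed

text \<open>
  The two indices meet in one simplex: \<open>s\<^sub>l s\<^sub>l\<^sub>+\<^sub>1 a\<close> has faces \<open>s\<^sub>l\<^sub>+\<^sub>1 a\<close>,
  \<open>s\<^sub>l\<^sub>+\<^sub>1 a\<close> and \<open>s\<^sub>l a\<close> at \<open>l\<close>, \<open>l + 1\<close> and \<open>l + 2\<close>.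
\<close>

lemma hom_rel_Suc:
  assumes X: "kan_complex X" and a: "a \<in> simplices X (Suc m)" and l: "l < Suc m"
  shows "hom_rel X (Suc m) l a = hom_rel X (Suc m) (Suc l) a"
proof -
  note S = kan_sset[OF X]
  have main: "(B, a) \<in> linked X (Suc m) l (Suc l) (degen X (Suc m) l a) \<longleftrightarrow>
       (B, a) \<in> linked X (Suc m) (Suc l) (Suc (Suc l)) (degen X (Suc m) (Suc l) a)"
    if a: "a \<in> simplices X (Suc m)" for a B
  proof -
    have l1: "Suc l \<le> Suc m" "l \<le> Suc (Suc m)" using l by auto
    let ?s = "degen X (Suc m) (Suc l) a"
    have s: "?s \<in> simplices X (Suc (Suc m))" by (rule degen_in[OF S a l1(1)])
    have D: "degen X (Suc (Suc m)) l ?s \<in> simplices X (Suc (Suc (Suc m)))" by (rule degen_in[OF S s l1(2)])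
    have d: "face X (Suc (Suc (Suc m))) l (degen X (Suc (Suc m)) l ?s) = ?s"
      "face X (Suc (Suc (Suc m))) (Suc l) (degen X (Suc (Suc m)) l ?s) = ?s"
      using face_degen_eq[OF S s l1(2)] by auto
    have d': "face X (Suc (Suc (Suc m))) (Suc (Suc l)) (degen X (Suc (Suc m)) l ?s) = degen X (Suc m) l a"
      using face_degen_greater[OF S s, of l "Suc (Suc l)"] face_degen_eq[OF S a l1(1), of "Suc l"] l by simp
    let ?A = "face X (Suc (Suc m)) l ?s"
    \<comment> \<open>Both sides say that a simplex has face \<open>B\<close> at \<open>l + 1\<close> and all other faces in common with \<open>?s\<close>.\<close>
    have *: "(?A, B) \<in> linked X (Suc m) l (Suc l) ?s \<longleftrightarrow> (B, a) \<in> linked X (Suc m) (Suc l) (Suc (Suc l)) ?s" for B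
    proof -
      have a': "face X (Suc (Suc m)) (Suc (Suc l)) ?s = a" using face_degen_eq[OF S a l1(1)] by simp
      have "(\<forall>k\<le>Suc (Suc m). k \<noteq> l \<and> k \<noteq> Suc l \<longrightarrow> face X (Suc (Suc m)) k \<omega> = face X (Suc (Suc m)) k ?s) \<and> face X (Suc (Suc m)) l \<omega> = ?A
        \<longleftrightarrow> (\<forall>k\<le>Suc (Suc m). k \<noteq> Suc l \<and> k \<noteq> Suc (Suc l) \<longrightarrow> face X (Suc (Suc m)) k \<omega> = face X (Suc (Suc m)) k ?s) \<and> face X (Suc (Suc m)) (Suc (Suc l)) \<omega> = a"
        (is "?L \<omega> \<longleftrightarrow> ?R \<omega>") for \<omega>
      proof -
        have "?L \<omega> \<longleftrightarrow> (\<forall>k\<le>Suc (Suc m). k \<noteq> Suc l \<longrightarrow> face X (Suc (Suc m)) k \<omega> = face X (Suc (Suc m)) k ?s)"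
          using l1(2) n_not_Suc_n[of l] by blast
        also have "\<dots> \<longleftrightarrow> ?R \<omega>"
        proof
          assume M: "\<forall>k\<le>Suc (Suc m). k \<noteq> Suc l \<longrightarrow> face X (Suc (Suc m)) k \<omega> = face X (Suc (Suc m)) k ?s"
          from M[rule_format, of "Suc (Suc l)"] have "face X (Suc (Suc m)) (Suc (Suc l)) \<omega> = a"
            using a' l1(1) by simp
          with M show "?R \<omega>" by blast
        next
          assume R: "?R \<omega>"
          show "\<forall>k\<le>Suc (Suc m). k \<noteq> Suc l \<longrightarrow> face X (Suc (Suc m)) k \<omega> = face X (Suc (Suc m)) k ?s"
          proof (intro allI impI)
            fix k assume "k \<le> Suc (Suc m)" "k \<noteq> Suc l"
            then show "face X (Suc (Suc m)) k \<omega> = face X (Suc (Suc m)) k ?s"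
              using R a' by (cases "k = Suc (Suc l)") simp_all
          qed
        qed
        finally show ?thesis .
      qed
      then show ?thesis unfolding linked_def by blast
    qed
    have "(a, a) \<in> linked X (Suc m) (Suc l) (Suc (Suc l)) ?s" using linked_refl[OF S a same_boundary_refl[OF a] l1(1)] .
    then have r: "(?A, a) \<in> linked X (Suc m) l (Suc l) ?s" using * by blast
    have "(?A, B) \<in> linked X (Suc m) l (Suc l) ?s \<longleftrightarrow> (B, a) \<in> linked X (Suc m) l (Suc l) (degen X (Suc m) l a)"
      using linked_two_of_three(1)[OF X D, where i = l and j = "Suc l" and k = "Suc (Suc l)" and A = ?A and B = B and C = a]
        linked_two_of_three(3)[OF X D, where i = l and j = "Suc l" and k = "Suc (Suc l)" and A = ?A and B = B and C = a]
        d d' r l by auto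
    then show ?thesis using * by simp
  qed
  have "(B, \<tau>) \<in> linked X (Suc m) l (Suc l) (degen X (Suc m) l a) \<longleftrightarrow>
       (B, \<tau>) \<in> linked X (Suc m) (Suc l) (Suc (Suc l)) (degen X (Suc m) (Suc l) a)" if t: "\<tau> \<in> same_boundary X (Suc m) a" for B \<tau>
    using main[of \<tau> B] t linked_degen_same_boundary[OF S a t, of l] linked_degen_same_boundary[OF S a t, of "Suc l"] l by (auto simp: same_boundary_def)
  then show ?thesis by (auto simp: hom_rel_def)
qed

lemma hom_rel_index:
  assumes X: "kan_complex X" and a: "a \<in> simplices X (Suc m)" and l: "l \<le> Suc m"
  shows "hom_rel X (Suc m) l a = hom_rel X (Suc m) (Suc m) a"
  using l by (induction l rule: inc_induct) (auto simp: hom_rel_Suc[OF X a])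

lemma quotient_bij:
  assumes r: "equiv P r" and s: "equiv Q s" and R: "R \<subseteq> P \<times> Q"
    and t: "\<And>p. p \<in> P \<Longrightarrow> \<exists>q. (p, q) \<in> R" "\<And>q. q \<in> Q \<Longrightarrow> \<exists>p. (p, q) \<in> R"
    and s': "\<And>p q q'. (p, q) \<in> R \<Longrightarrow> (p, q') \<in> R \<longleftrightarrow> (q, q') \<in> s"
    and r': "\<And>p p' q. (p, q) \<in> R \<Longrightarrow> (p', q) \<in> R \<longleftrightarrow> (p, p') \<in> r"
  shows "bij_betw (\<lambda>C. R `` C) (P // r) (Q // s)"
proof -
  have 1: "R `` (r `` {p}) = s `` {q}" if "(p, q) \<in> R" for p q
    using that s' r' by blast
  show ?thesis unfolding bij_betw_def
  proof
    show "inj_on (\<lambda>C. R `` C) (P // r)"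
    proof (rule inj_onI)
      fix C C' assume "C \<in> P // r" "C' \<in> P // r" and e: "R `` C = R `` C'"
      then obtain p p' where p: "C = r `` {p}" "p \<in> P" "C' = r `` {p'}" "p' \<in> P" by (auto elim!: quotientE)
      obtain q where "(p, q) \<in> R" using t(1) p(2) by blast
      moreover obtain q' where "(p', q') \<in> R" using t(1) p(4) by blast
      ultimately have q: "(p, q) \<in> R" "(p', q') \<in> R" by auto
      have "s `` {q} = s `` {q'}" using e 1[OF q(1)] 1[OF q(2)] p by simp
      moreover have "q \<in> Q" "q' \<in> Q" using q R by auto
      ultimately have "(q, q') \<in> s" using s by (simp add: eq_equiv_class_iff)
      then have "(p, q') \<in> R" using s' q by blast
      then have "(p, p') \<in> r" using r' q by blast
      then show "C = C'" using r p by (simp add: equiv_class_eq_iff)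
    qed
    show "(\<lambda>C. R `` C) ` (P // r) = Q // s"
    proof (intro equalityI subsetI)
      fix K assume "K \<in> (\<lambda>C. R `` C) ` (P // r)"
      then obtain p where p: "p \<in> P" "K = R `` (r `` {p})" by (auto elim!: quotientE)
      obtain q where q: "(p, q) \<in> R" using t p by blast
      then have "K = s `` {q}" "q \<in> Q" using 1 p R by auto
      then show "K \<in> Q // s" by (auto intro: quotientI)
    next
      fix K assume "K \<in> Q // s"
      then obtain q where q: "q \<in> Q" "K = s `` {q}" by (auto elim!: quotientE)
      obtain p where p: "(p, q) \<in> R" using t q by blast
      then have "K = R `` (r `` {p})" "p \<in> P" using 1 q R by auto
      then show "K \<in> (\<lambda>C. R `` C) ` (P // r)" by (auto intro: quotientI)
    qed
  qed
qed

text \<open>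
  A simplex on the boundary of one face of \<open>D\<close> can be pushed across \<open>D\<close> to the adjacent face. That this
  is well defined and injective on homotopy classes is \<open>linked_two_of_three\<close> for the degeneracies of \<open>D\<close>
  at \<open>j\<close> and \<open>j + 1\<close>; adjacency ensures that the homotopies that occur on both sides have the same
  index \<open>j\<close>.
\<close>

lemma adjacent_bij:
  assumes X: "kan_complex X" and D: "D \<in> simplices X (Suc (Suc m))" and j: "j \<le> Suc m"
  defines "a \<equiv> face X (Suc (Suc m)) j D" and "b \<equiv> face X (Suc (Suc m)) (Suc j) D"
  shows "\<exists>f. bij_betw f (same_boundary X (Suc m) a // hom_rel X (Suc m) (Suc m) a) (same_boundary X (Suc m) b // hom_rel X (Suc m) (Suc m) b)"
proof -
  note S = kan_sset[OF X]
  have ab: "a \<in> simplices X (Suc m)" "b \<in> simplices X (Suc m)"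
    unfolding a_def b_def using S D j by auto
  let ?R = "linked X (Suc m) j (Suc j) D \<inter> same_boundary X (Suc m) a \<times> same_boundary X (Suc m) b"
  have eq: "hom_rel X (Suc m) (Suc m) a = hom_rel X (Suc m) j a" "hom_rel X (Suc m) (Suc m) b = hom_rel X (Suc m) j b"
    using hom_rel_index[OF X ab(1) j] hom_rel_index[OF X ab(2) j] by auto
  have jl: "j \<le> Suc (Suc m)" "Suc j \<le> Suc (Suc m)" using j by auto
  have "bij_betw (\<lambda>C. ?R `` C) (same_boundary X (Suc m) a // hom_rel X (Suc m) j a) (same_boundary X (Suc m) b // hom_rel X (Suc m) j b)"
  proof (rule quotient_bij)
    show "equiv (same_boundary X (Suc m) a) (hom_rel X (Suc m) j a)" by (rule hom_rel_equiv[OF X ab(1) j])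
    show "equiv (same_boundary X (Suc m) b) (hom_rel X (Suc m) j b)" by (rule hom_rel_equiv[OF X ab(2) j])
    show "\<exists>q. (p, q) \<in> ?R" if "p \<in> same_boundary X (Suc m) a" for p
      using linked_total(1)[OF X D, of j "Suc j" p] that jl unfolding a_def b_def by auto
    show "\<exists>p. (p, q) \<in> ?R" if "q \<in> same_boundary X (Suc m) b" for q
      using linked_total(2)[OF X D, of j "Suc j" q] that jl unfolding a_def b_def by auto
    show "(p, q') \<in> ?R \<longleftrightarrow> (q, q') \<in> hom_rel X (Suc m) j b" if pq: "(p, q) \<in> ?R" for p q q'
    proof -
      have D': "degen X (Suc (Suc m)) j D \<in> simplices X (Suc (Suc (Suc m)))" by (rule degen_in[OF S D jl(1)])
      have f: "face X (Suc (Suc (Suc m))) j (degen X (Suc (Suc m)) j D) = D"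
        "face X (Suc (Suc (Suc m))) (Suc j) (degen X (Suc (Suc m)) j D) = D"
        "face X (Suc (Suc (Suc m))) (Suc (Suc j)) (degen X (Suc (Suc m)) j D) = degen X (Suc m) j b"
        using face_degen_eq[OF S D jl(1)] face_degen_greater[OF S D, of j "Suc (Suc j)"] j by (auto simp: b_def)
      show ?thesis
        using linked_two_of_three(2,3)[OF X D', of j "Suc j" "Suc (Suc j)" p q q'] f pq j
        by (auto simp: hom_rel_def)
    qed
    show "(p', q) \<in> ?R \<longleftrightarrow> (p, p') \<in> hom_rel X (Suc m) j a" if pq: "(p, q) \<in> ?R" for p p' q
    proof -
      have D': "degen X (Suc (Suc m)) (Suc j) D \<in> simplices X (Suc (Suc (Suc m)))" by (rule degen_in[OF S D jl(2)])
      have f: "face X (Suc (Suc (Suc m))) (Suc j) (degen X (Suc (Suc m)) (Suc j) D) = D"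
        "face X (Suc (Suc (Suc m))) (Suc (Suc j)) (degen X (Suc (Suc m)) (Suc j) D) = D"
        "face X (Suc (Suc (Suc m))) j (degen X (Suc (Suc m)) (Suc j) D) = degen X (Suc m) j a"
        using face_degen_eq[OF S D jl(2)] face_degen_less[OF S D jl(2), of j] j by (auto simp: a_def)
      show ?thesis
        using linked_two_of_three(1)[OF X D', where i = j and j = "Suc j" and k = "Suc (Suc j)" and A = p and B = p' and C = q]
          linked_two_of_three(3)[OF X D', where i = j and j = "Suc j" and k = "Suc (Suc j)" and A = p and B = p' and C = q] f pq j
        by (auto simp: hom_rel_def)
    qed
  qed blast
  then show ?thesis unfolding eq by blast
qed

lemma degen_const:
  assumes X: "simplicial_set X" "x \<in> simplices X 0" and l: "l \<le> n"
  shows "degen X n l (const_simplex X n x) = const_simplex X (Suc n) x"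
  unfolding degen_def by (rule act_const[OF X codegen_in[OF l]])

lemma spheres_same_boundary:
  assumes X: "simplicial_set X" "x \<in> simplices X 0"
  shows "spheres X (Suc m) x = same_boundary X (Suc m) (const_simplex X (Suc m) x)"
  using face_const[OF X] by (auto simp: spheres_def same_boundary_def)

lemma homotopy_rel_hom_rel:
  assumes X: "simplicial_set X" "x \<in> simplices X 0"
  shows "homotopy_rel X (Suc m) x = hom_rel X (Suc m) (Suc m) (const_simplex X (Suc m) x)"
proof -
  have *: "(\<forall>l\<le>Suc (Suc m). l \<noteq> Suc m \<and> l \<noteq> Suc (Suc m) \<longrightarrow> P l) \<longleftrightarrow> (\<forall>i<Suc m. P i)" for P :: "nat \<Rightarrow> bool"
    by (auto simp: le_Suc_eq less_Suc_eq_le)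
  show ?thesis
    unfolding homotopy_rel_def hom_rel_def linked_def degen_const[OF X order_refl] spheres_same_boundary[OF X] *
    using face_const[OF X] by auto
qed

lemma homotopy_rel_equiv:
  assumes X: "kan_complex X" and x: "x \<in> simplices X 0"
  shows "equiv (spheres X (Suc m) x) (homotopy_rel X (Suc m) x)"
  unfolding spheres_same_boundary[OF kan_sset[OF X] x] homotopy_rel_hom_rel[OF kan_sset[OF X] x]
  using hom_rel_equiv[OF X] kan_sset[OF X] x by blast

definition step_word :: "nat \<Rightarrow> nat \<Rightarrow> nat list" where
  "step_word j n = map (\<lambda>t. if t < j then 0 else Suc 0) [0..<Suc n]"

lemma step_word_in: "step_word j n \<in> mono_maps n (Suc 0)"
  by (auto simp: mono_maps_iff step_word_def less_Suc_eq_le simp del: upt_Suc)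

lemma step_word_ends: "step_word 0 n = replicate (Suc n) (Suc 0)" "step_word (Suc n) n = replicate (Suc n) 0"
  by (intro nth_equalityI; simp add: step_word_def del: upt_Suc replicate_Suc)+

lemma step_word_coface:
  assumes "j \<le> n" shows "mono_comp (step_word (Suc j) (Suc n)) (coface (Suc n) j) = step_word j n"
    "mono_comp (step_word (Suc j) (Suc n)) (coface (Suc n) (Suc j)) = step_word (Suc j) n"
  using assms by (intro nth_equalityI; simp add: step_word_def less_Suc_eq_le del: upt_Suc)+

text \<open>
  Slide the boundary of a sphere along the edge, one vertex at a time. Between the constant boundaries at
  the two ends it passes through the boundaries of the degenerate simplices \<open>W j\<close> on the edge, and
  \<open>W j\<close>, \<open>W (j + 1)\<close> are adjacent faces of another degenerate simplex on that edge.
\<close>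

theorem homotopy_group_edge:
  assumes X: "kan_complex X" and e: "e \<in> edges X"
  shows "\<exists>f. bij_betw f (homotopy_group X (Suc m) (src X e)) (homotopy_group X (Suc m) (tgt X e))"
proof -
  note S = kan_sset[OF X]
  let ?n = "Suc m"
  define W where "W j = act X (Suc 0) (step_word j ?n) e" for j
  let ?Q = "\<lambda>a. same_boundary X ?n a // hom_rel X ?n ?n a"
  have step: "\<exists>f. bij_betw f (?Q (W j)) (?Q (W (Suc j)))" if "j \<le> ?n" for j
  proof -
    let ?D = "act X (Suc 0) (step_word (Suc j) (Suc ?n)) e"
    have "?D \<in> simplices X (Suc ?n)" using S e step_word_in by blast
    moreover have "face X (Suc ?n) j ?D = W j" "face X (Suc ?n) (Suc j) ?D = W (Suc j)"
      using face_act[OF S e step_word_in] step_word_coface[OF that] that by (auto simp: W_def)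
    ultimately show ?thesis using adjacent_bij[OF X, of ?D m j] that by simp
  qed
  have chain: "j \<le> Suc ?n \<Longrightarrow> \<exists>f. bij_betw f (?Q (W j)) (?Q (W 0))" for j
  proof (induction j)
    case 0 show ?case by (rule exI[of _ id]) (rule bij_betw_id)
  next
    case (Suc j)
    then obtain f g where "bij_betw f (?Q (W j)) (?Q (W 0))" "bij_betw g (?Q (W j)) (?Q (W (Suc j)))"
      using step[of j] by auto
    then show ?case using bij_betw_trans bij_betw_inv_into by blast
  qed
  have ends: "src X e \<in> simplices X 0" "tgt X e \<in> simplices X 0" using S e by auto
  have "W (Suc ?n) = const_simplex X ?n (src X e)" "W 0 = const_simplex X ?n (tgt X e)"
    unfolding W_def step_word_ends const_simplex_def edge_ends[OF S e]
    using sset_act_act[OF S e single_in[of 0 "Suc 0"] replicate_in[of 0 0 ?n]]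
      sset_act_act[OF S e single_in[of "Suc 0" "Suc 0"] replicate_in[of 0 0 ?n]]
    by (simp_all add: mono_comp_replicate_right del: replicate_Suc)
  then show ?thesis using chain[of "Suc ?n"]
    by (simp add: homotopy_group_def spheres_same_boundary[OF S] homotopy_rel_hom_rel[OF S] ends)
qed

section \<open>Components and fundamental groups\<close>

lemma kan_fills: "kan_complex X \<Longrightarrow> k \<le> Suc n \<Longrightarrow> fills X (Suc n) k" by (simp add: kan_complex_iff)

lemma path_relI: "e \<in> edges X \<Longrightarrow> src X e = x \<Longrightarrow> tgt X e = y \<Longrightarrow> (x, y) \<in> path_rel X"
  by (auto simp: path_rel_def)

lemma path_relE:
  assumes "(x, y) \<in> path_rel X"
  obtains e where "e \<in> edges X" "src X e = x" "tgt X e = y"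
  using assms by (auto simp: path_rel_def)

lemma path_rel_equiv:
  assumes X: "kan_complex X" shows "equiv (simplices X 0) (path_rel X)"
proof -
  note S = kan_sset[OF X]
  have e: "(y, z) \<in> path_rel X" if xy: "(x, y) \<in> path_rel X" and xz: "(x, z) \<in> path_rel X" for x y z
  proof -
    obtain a where a: "a \<in> edges X" "src X a = x" "tgt X a = y" by (rule path_relE[OF xy])
    obtain c where c: "c \<in> edges X" "src X c = x" "tgt X c = z" by (rule path_relE[OF xz])
    obtain b where b: "tri X a b c" using fill_2(1)[OF kan_fills[OF X le0] a(1) c(1)] a c by auto
    show ?thesis using triE[OF S b] a c by (auto intro: path_relI[of b])
  qed
  have r: "(x, x) \<in> path_rel X" if "x \<in> simplices X 0" for x
    using that S by (auto intro!: path_relI[of "unit_edge X x"])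
  have sub: "path_rel X \<subseteq> simplices X 0 \<times> simplices X 0" using S by (auto elim!: path_relE)
  have s: "(y, x) \<in> path_rel X" if "(x, y) \<in> path_rel X" for x y using that e r sub by blast
  have t: "(x, z) \<in> path_rel X" if "(x, y) \<in> path_rel X" "(y, z) \<in> path_rel X" for x y z using that e s by blast
  show ?thesis
  proof (rule equivI)
    show "sym (path_rel X)" using s by (rule symI)
    show "trans (path_rel X)" using t by (rule transI)
  qed (use r sub in \<open>auto simp: refl_on_def\<close>)
qed

definition loops :: "'a simplicial \<Rightarrow> 'a \<Rightarrow> 'a set" where
  "loops X x = {a \<in> edges X. src X a = x \<and> tgt X a = x}"

lemma spheres_1: "simplicial_set X \<Longrightarrow> x \<in> simplices X 0 \<Longrightarrow> spheres X (Suc 0) x = loops X x"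
  by (auto simp: spheres_def loops_def le_Suc_eq)

lemma unit_loop: "simplicial_set X \<Longrightarrow> x \<in> simplices X 0 \<Longrightarrow> unit_edge X x \<in> loops X x"
  by (auto simp: loops_def)

lemma homotopy_rel_1_tri:
  assumes X: "simplicial_set X" "x \<in> simplices X 0"
  shows "(\<sigma>, \<tau>) \<in> homotopy_rel X (Suc 0) x \<longleftrightarrow> \<sigma> \<in> loops X x \<and> \<tau> \<in> loops X x \<and> tri X \<tau> (unit_edge X x) \<sigma>"
  unfolding homotopy_rel_def tri_def spheres_1[OF X] by auto

abbreviation loop_class :: "'a simplicial \<Rightarrow> 'a \<Rightarrow> 'a \<Rightarrow> 'a set" where
  "loop_class X x a \<equiv> homotopy_rel X (Suc 0) x `` {a}"

text \<open>
  The product of two classes is the set of all composites of their elements, which is again a class.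
\<close>

definition pi1 :: "'a simplicial \<Rightarrow> 'a \<Rightarrow> 'a set monoid" where
  "pi1 X x = \<lparr>carrier = homotopy_group X (Suc 0) x,
     mult = (\<lambda>C D. {c. \<exists>a\<in>C. \<exists>b\<in>D. tri X a b c}), one = loop_class X x (unit_edge X x)\<rparr>"

locale pointed_kan =
  fixes X :: "'a simplicial" and x :: 'a
  assumes X: "kan_complex X" and x: "x \<in> simplices X 0"
begin

lemmas S = kan_sset[OF X]

lemma fill: "k \<le> Suc n \<Longrightarrow> fills X (Suc n) k" by (rule kan_fills[OF X])

lemma equiv: "equiv (loops X x) (homotopy_rel X (Suc 0) x)"
  using homotopy_rel_equiv[OF X x, of 0] by (simp add: spheres_1[OF S x])

lemma rel_iff: "(a, b) \<in> homotopy_rel X (Suc 0) x \<longleftrightarrow> a \<in> loops X x \<and> b \<in> loops X x \<and> tri X a (unit_edge X x) b"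
  using homotopy_rel_1_tri[OF S x] equiv by (meson equiv_def symD)

lemma tri_unit_loop: "a \<in> edges X \<Longrightarrow> tgt X a = x \<Longrightarrow> tri X a (unit_edge X x) a"
  "a \<in> edges X \<Longrightarrow> src X a = x \<Longrightarrow> tri X (unit_edge X x) a a"
  using tri_unit[OF S, of a] by auto

lemma tri_loops: "tri X a b c \<Longrightarrow> a \<in> loops X x \<Longrightarrow> b \<in> loops X x \<Longrightarrow> c \<in> loops X x"
  "tri X a b c \<Longrightarrow> a \<in> loops X x \<Longrightarrow> c \<in> loops X x \<Longrightarrow> b \<in> loops X x"
  "tri X a b c \<Longrightarrow> b \<in> loops X x \<Longrightarrow> c \<in> loops X x \<Longrightarrow> a \<in> loops X x"
  using triE[OF S, of a b c] by (auto simp: loops_def)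

lemma tri_cong3:
  assumes "tri X a b c" "tri X c (unit_edge X x) c'" shows "tri X a b c'"
proof -
  have "tgt X c = x" using triE[OF S assms(2)] S x by simp
  then show ?thesis
    using tetrahedron(3)[OF S fill assms(1) assms(2) tri_unit_loop(1)[of b]] triE[OF S assms(1)] by simp
qed

lemma tri_unique3:
  assumes "tri X a b c" "tri X a b c'" "tgt X b = x" shows "tri X c (unit_edge X x) c'"
  using tetrahedron(2)[OF S fill assms(1) assms(2) tri_unit_loop(1)[of b]] assms(3) triE[OF S assms(1)] by simp

lemma tri_cong2:
  assumes "tri X a b c" "tri X b (unit_edge X x) b'" shows "tri X a b' c"
proof -
  have "tgt X b = x" using triE[OF S assms(2)] S x by simp
  then show ?thesis
    using tetrahedron(3)[OF S fill assms(1) tri_unit_loop(1)[of c] assms(2)] triE[OF S assms(1)] by simp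
qed

lemma tri_cong1:
  assumes "tri X a b c" "tri X a (unit_edge X x) a'" shows "tri X a' b c"
proof -
  have "src X b = x" using triE[OF S assms(2)] triE[OF S assms(1)] S x by simp
  then show ?thesis
    using tetrahedron(2)[OF S fill assms(2) assms(1) tri_unit_loop(2)[of b]] triE[OF S assms(1)] by simp
qed

lemma class_mult:
  assumes t: "tri X a b c" and ab: "a \<in> loops X x" "b \<in> loops X x"
  shows "loop_class X x a \<otimes>\<^bsub>pi1 X x\<^esub> loop_class X x b = loop_class X x c"
proof -
  have c: "c \<in> loops X x" using tri_loops[OF t] ab by blast
  have "c' \<in> loop_class X x c" if "(a, a') \<in> homotopy_rel X (Suc 0) x" "(b, b') \<in> homotopy_rel X (Suc 0) x" "tri X a' b' c'" for a' b' c'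
  proof -
    have "(a', a) \<in> homotopy_rel X (Suc 0) x" "(b', b) \<in> homotopy_rel X (Suc 0) x"
      using that equiv by (meson equiv_def symD)+
    then have l: "a' \<in> loops X x" "b' \<in> loops X x" and "tri X a' (unit_edge X x) a" "tri X b' (unit_edge X x) b"
      by (auto simp: rel_iff)
    then have "tri X a b c'" using tri_cong2[OF tri_cong1[OF that(3)]] by blast
    then have "tri X c (unit_edge X x) c'" "c' \<in> loops X x"
      using tri_unique3[OF t] ab tri_loops(1)[OF that(3) l] by (auto simp: loops_def)
    then show ?thesis using c by (auto simp: rel_iff)
  qed
  moreover have "tri X a b c'" if "c' \<in> loop_class X x c" for c'
    using that tri_cong3[OF t] by (auto simp: rel_iff)
  moreover have "a \<in> loop_class X x a" "b \<in> loop_class X x b" using ab equiv_class_self[OF equiv] by auto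
  ultimately have "{c. \<exists>a'\<in>loop_class X x a. \<exists>b'\<in>loop_class X x b. tri X a' b' c} = loop_class X x c"
    by (intro equalityI subsetI CollectI) (blast, meson)
  then show ?thesis by (simp add: pi1_def)
qed

lemma carrier_pi1: "carrier (pi1 X x) = homotopy_group X (Suc 0) x" by (simp add: pi1_def)

lemma carrier_iff: "C \<in> carrier (pi1 X x) \<longleftrightarrow> (\<exists>a\<in>loops X x. C = loop_class X x a)"
  by (auto simp: carrier_pi1 homotopy_group_def spheres_1[OF S x] quotient_def)

lemma class_in: "a \<in> loops X x \<Longrightarrow> loop_class X x a \<in> carrier (pi1 X x)" by (auto simp: carrier_iff)

lemma class_eq: "a \<in> loops X x \<Longrightarrow> b \<in> loops X x \<Longrightarrow> loop_class X x a = loop_class X x b \<longleftrightarrow> tri X a (unit_edge X x) b"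
  using eq_equiv_class_iff[OF equiv] by (simp add: rel_iff)

lemma class_mem: "C \<in> carrier (pi1 X x) \<Longrightarrow> a \<in> C \<Longrightarrow> a \<in> loops X x \<and> C = loop_class X x a"
  by (metis Image_singleton_iff carrier_iff equiv equiv_class_eq rel_iff)

lemma class_self: "a \<in> loops X x \<Longrightarrow> a \<in> loop_class X x a" using equiv_class_self[OF equiv] .

lemma group_pi1: "group (pi1 X x)"
proof (rule groupI)
  fix C D assume "C \<in> carrier (pi1 X x)" "D \<in> carrier (pi1 X x)"
  then obtain a b where ab: "a \<in> loops X x" "b \<in> loops X x" "C = loop_class X x a" "D = loop_class X x b" by (auto simp: carrier_iff)
  obtain c where c: "tri X a b c" using fill_2(2)[OF fill] ab by (fastforce simp: loops_def)
  then show "C \<otimes>\<^bsub>pi1 X x\<^esub> D \<in> carrier (pi1 X x)"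
    using class_mult[OF c] ab class_in tri_loops(1)[OF c] by simp
next
  show "\<one>\<^bsub>pi1 X x\<^esub> \<in> carrier (pi1 X x)" using class_in unit_loop[OF S x] by (simp add: pi1_def)
next
  fix C D K assume "C \<in> carrier (pi1 X x)" "D \<in> carrier (pi1 X x)" "K \<in> carrier (pi1 X x)"
  then obtain a b k where ab: "a \<in> loops X x" "b \<in> loops X x" "k \<in> loops X x"
    "C = loop_class X x a" "D = loop_class X x b" "K = loop_class X x k" by (auto simp: carrier_iff)
  obtain c where c: "tri X a b c" using fill_2(2)[OF fill] ab by (fastforce simp: loops_def)
  note cl = tri_loops(1)[OF c ab(1,2)]
  obtain d where d: "tri X c k d" using fill_2(2)[OF fill] ab cl by (fastforce simp: loops_def)
  obtain f where f: "tri X b k f" using fill_2(2)[OF fill] ab by (fastforce simp: loops_def)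
  note fl = tri_loops(1)[OF f ab(2,3)]
  have "tri X a f d" using tetrahedron(3)[OF S fill c d f] by simp
  then show "C \<otimes>\<^bsub>pi1 X x\<^esub> D \<otimes>\<^bsub>pi1 X x\<^esub> K = C \<otimes>\<^bsub>pi1 X x\<^esub> (D \<otimes>\<^bsub>pi1 X x\<^esub> K)"
    using class_mult[OF c] class_mult[OF d] class_mult[OF f] class_mult[of a f d] ab cl fl by simp
next
  fix C assume "C \<in> carrier (pi1 X x)"
  then obtain a where a: "a \<in> loops X x" "C = loop_class X x a" by (auto simp: carrier_iff)
  have "tri X (unit_edge X x) a a" using tri_unit_loop(2) a by (simp add: loops_def)
  then show "\<one>\<^bsub>pi1 X x\<^esub> \<otimes>\<^bsub>pi1 X x\<^esub> C = C"
    using class_mult[of "unit_edge X x" a a] a unit_loop[OF S x] by (simp add: pi1_def)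
  obtain b where b: "tri X b a (unit_edge X x)"
    using fill_2(3)[OF fill, of a "unit_edge X x"] a unit_loop[OF S x] by (auto simp: loops_def)
  have "b \<in> loops X x" using tri_loops(3)[OF b a(1) unit_loop[OF S x]] .
  then show "\<exists>y\<in>carrier (pi1 X x). y \<otimes>\<^bsub>pi1 X x\<^esub> C = \<one>\<^bsub>pi1 X x\<^esub>"
    using class_mult[OF b] class_in a by (intro bexI[of _ "loop_class X x b"]) (auto simp: pi1_def)
qed

end

lemma tri_map:
  assumes g: "simplicial_map X Y g" and t: "tri X a b c"
  shows "tri Y (g (Suc 0) a) (g (Suc 0) b) (g (Suc 0) c)"
proof -
  obtain s where s: "s \<in> simplices X (Suc (Suc 0))" "face2 X (Suc (Suc 0)) s = a"
     "face2 X 0 s = b" "face2 X (Suc 0) s = c"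
    using t unfolding tri_def by blast
  then show ?thesis unfolding tri_def using simplicial_map_face[OF g s(1)] simplicial_map_in[OF g s(1)]
    by (intro bexI[of _ "g (Suc (Suc 0)) s"]) auto
qed

lemma loops_map:
  assumes g: "simplicial_map X Y g" and a: "a \<in> loops X x"
  shows "g (Suc 0) a \<in> loops Y (g 0 x)"
  using a simplicial_map_face[OF g, of a 0 0] simplicial_map_face[OF g, of a 0 "Suc 0"] simplicial_map_in[OF g]
  by (auto simp: loops_def)

definition pi1_map :: "'b simplicial \<Rightarrow> 'b \<Rightarrow> (nat \<Rightarrow> 'a \<Rightarrow> 'b) \<Rightarrow> 'a set \<Rightarrow> 'b set" where
  "pi1_map Y y g C = homotopy_rel Y (Suc 0) y `` (g (Suc 0) ` C)"

lemma pi1_map_class: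
  assumes X: "kan_complex X" and Y: "kan_complex Y" and g: "simplicial_map X Y g" and x: "x \<in> simplices X 0"
    and a: "a \<in> loops X x"
  shows "pi1_map Y (g 0 x) g (loop_class X x a) = loop_class Y (g 0 x) (g (Suc 0) a)"
proof -
  interpret X: pointed_kan X x by standard (fact X x)+
  interpret Y: pointed_kan Y "g 0 x" by standard (use Y g x in auto)
  have "loop_class Y (g 0 x) (g (Suc 0) a') = loop_class Y (g 0 x) (g (Suc 0) a)" if "a' \<in> loop_class X x a" for a'
  proof -
    have "tri X a (unit_edge X x) a'" "a' \<in> loops X x" using that X.rel_iff by auto
    then show ?thesis using Y.class_eq[of "g (Suc 0) a" "g (Suc 0) a'"] tri_map[OF g] loops_map[OF g] a
        simplicial_map_const[OF g x] by metis
  qed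
  moreover have "a \<in> loop_class X x a" by (rule X.class_self[OF a])
  ultimately show ?thesis unfolding pi1_map_def by blast
qed

lemma pi1_map_hom:
  assumes X: "kan_complex X" and Y: "kan_complex Y" and g: "simplicial_map X Y g" and x: "x \<in> simplices X 0"
  shows "group_hom (pi1 X x) (pi1 Y (g 0 x)) (pi1_map Y (g 0 x) g)"
proof -
  interpret X: pointed_kan X x by standard (fact X x)+
  interpret Y: pointed_kan Y "g 0 x" by standard (use Y g x in auto)
  note c = pi1_map_class[OF X Y g x]
  have "pi1_map Y (g 0 x) g \<in> hom (pi1 X x) (pi1 Y (g 0 x))"
  proof (rule homI)
    fix C assume "C \<in> carrier (pi1 X x)"
    then obtain a where "a \<in> loops X x" "C = loop_class X x a" by (auto simp: X.carrier_iff)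
    then show "pi1_map Y (g 0 x) g C \<in> carrier (pi1 Y (g 0 x))" using c Y.class_in loops_map[OF g] by simp
  next
    fix C D assume "C \<in> carrier (pi1 X x)" "D \<in> carrier (pi1 X x)"
    then obtain a b where ab: "a \<in> loops X x" "b \<in> loops X x" "C = loop_class X x a" "D = loop_class X x b" by (auto simp: X.carrier_iff)
    obtain d where d: "tri X a b d" using fill_2(2)[OF X.fill] ab by (fastforce simp: loops_def)
    have "d \<in> loops X x" using X.tri_loops(1)[OF d] ab by simp
    then show "pi1_map Y (g 0 x) g (C \<otimes>\<^bsub>pi1 X x\<^esub> D) = pi1_map Y (g 0 x) g C \<otimes>\<^bsub>pi1 Y (g 0 x)\<^esub> pi1_map Y (g 0 x) g D"
      using X.class_mult[OF d] Y.class_mult[OF tri_map[OF g d]] ab c loops_map[OF g] by simp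
  qed
  then show ?thesis using X.group_pi1 Y.group_pi1 by (simp add: group_hom_def group_hom_axioms_def)
qed

text \<open>
  The fibres of \<open>f\<close> are the cosets of \<open>H\<close>, which yields a bijection of the group with a product. For
  infinite groups both sides are \<open>0\<close>, the value of \<open>card\<close> on infinite sets.
\<close>

lemma (in group) coset_count:
  assumes H: "subgroup H G" and f: "\<And>g g'. g \<in> carrier G \<Longrightarrow> g' \<in> carrier G \<Longrightarrow> f g = f g' \<longleftrightarrow> g \<otimes> inv g' \<in> H"
  shows "card (carrier G) = card (f ` carrier G) * card H"
proof -
  define s where "s y = (SOME g. g \<in> carrier G \<and> f g = y)" for y
  have s: "s (f g) \<in> carrier G \<and> f (s (f g)) = f g" if "g \<in> carrier G" for g
    unfolding s_def by (rule someI[of _ g]) (use that in simp)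
  have "bij_betw (\<lambda>g. (f g, g \<otimes> inv (s (f g)))) (carrier G) ((f ` carrier G) \<times> H)"
  proof (rule bij_betwI[where g = "\<lambda>(y, h). h \<otimes> s y"])
    show "(\<lambda>g. (f g, g \<otimes> inv (s (f g)))) \<in> carrier G \<rightarrow> (f ` carrier G) \<times> H"
      using s f by fastforce
    show "(\<lambda>(y, h). h \<otimes> s y) \<in> (f ` carrier G) \<times> H \<rightarrow> carrier G"
      using s subgroup.mem_carrier[OF H] by auto
    show "(case (f g, g \<otimes> inv (s (f g))) of (y, h) \<Rightarrow> h \<otimes> s y) = g" if "g \<in> carrier G" for g
      using that s[OF that] by (simp add: m_assoc)
    fix p assume "p \<in> (f ` carrier G) \<times> H"
    then obtain g h where p: "p = (f g, h)" "g \<in> carrier G" "h \<in> H" by auto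
    have sg: "s (f g) \<in> carrier G" "f (s (f g)) = f g" using s p by auto
    have h: "h \<in> carrier G" using p subgroup.mem_carrier[OF H] by blast
    have hs: "(h \<otimes> s (f g)) \<otimes> inv (s (f g)) = h" using h sg by (simp add: m_assoc)
    then have "f (h \<otimes> s (f g)) = f g" using f[of "h \<otimes> s (f g)" "s (f g)"] h sg p by simp
    then show "(\<lambda>g. (f g, g \<otimes> inv (s (f g)))) (case p of (y, h) \<Rightarrow> h \<otimes> s y) = p" using p hs by simp
  qed
  from bij_betw_same_card[OF this] show ?thesis by (simp add: card_cartesian_product)
qed

lemma (in group_hom) hom_count: "card (carrier G) = card (h ` carrier G) * card (kernel G H h)"
proof (rule G.coset_count[OF subgroup_kernel])
  fix g g' assume g: "g \<in> carrier G" "g' \<in> carrier G"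
  then have "h (g \<otimes> inv g') = h g \<otimes>\<^bsub>H\<^esub> inv\<^bsub>H\<^esub> (h g')" by simp
  moreover have hg: "h g \<in> carrier H" "h g' \<in> carrier H" using g by auto
  moreover have "h g = h g'" if "h g \<otimes>\<^bsub>H\<^esub> inv\<^bsub>H\<^esub> (h g') = \<one>\<^bsub>H\<^esub>"
    using H.inv_solve_right'[of "\<one>\<^bsub>H\<^esub>" "h g" "h g'"] that hg by simp
  ultimately show "h g = h g' \<longleftrightarrow> g \<otimes> inv g' \<in> kernel G H h"
    using g by (auto simp: kernel_def)
qed

section \<open>The exact sequence of a left fibration\<close>

text \<open>
  The components of the fibre through \<open>e\<close> that can be joined to \<open>e\<close> in the total space: the orbit of
  \<open>[e]\<close> under the action of the fundamental group of the base.
\<close>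

definition orbit :: "'a simplicial \<Rightarrow> 'b simplicial \<Rightarrow> (nat \<Rightarrow> 'a \<Rightarrow> 'b) \<Rightarrow> 'a \<Rightarrow> 'a set set" where
  "orbit E B q e = {K \<in> pi0 (strict_fibre E B q (q 0 e)). \<exists>y\<in>K. (e, y) \<in> path_rel E}"

lemma strict_fibre_kan:
  "left_fibration E B q \<Longrightarrow> kan_complex B \<Longrightarrow> b \<in> simplices B 0 \<Longrightarrow> kan_complex (strict_fibre E B q b)"
  by (rule left_fillable_kan[OF left_fillable_strict_fibre])

locale pointed_fibration =
  fixes E :: "'a simplicial" and B :: "'b simplicial" and q :: "nat \<Rightarrow> 'a \<Rightarrow> 'b" and e :: 'a
  assumes q: "left_fibration E B q" and B: "kan_complex B" and e: "e \<in> simplices E 0"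
begin

abbreviation F :: "'a simplicial" where "F \<equiv> strict_fibre E B q (q 0 e)"

lemma qs: "simplicial_map E B q" using q by (simp add: left_fibration_iff)

lemma b: "q 0 e \<in> simplices B 0" using qs e by blast

lemma E: "kan_complex E" by (rule left_fibration_kan[OF q B])

lemma F: "kan_complex F" by (rule strict_fibre_kan[OF q B b])

lemmas SB = kan_sset[OF B] and SE = kan_sset[OF E] and SF = kan_sset[OF F]

lemma eF: "e \<in> simplices F 0" using e SB b by (simp add: simplices_strict_fibre)

end

lemma strict_fibre_incl: "simplicial_map (strict_fibre E B q b) E (\<lambda>_ \<sigma>. \<sigma>)"
  by (auto simp: simplicial_map_def simplices_strict_fibre)

lemma loops_strict_fibre: "loops (strict_fibre E B q b) e = {a \<in> loops E e. q (Suc 0) a = unit_edge B b}"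
  by (auto simp: loops_def simplices_strict_fibre)

text \<open>
  The end of the long exact sequence, as a statement about orders. Let \<open>j\<close> and \<open>i\<close> be the maps induced on
  fundamental groups by \<open>q\<close> and by the inclusion of the fibre. Lifting loops from \<open>e\<close> sends the fundamental group
  of \<open>B\<close> onto the orbit of \<open>e\<close>, with the cosets of the image of \<open>j\<close> as fibres; the kernel of \<open>j\<close> is the
  image of \<open>i\<close>; and the last factor is the order of the kernel of \<open>i\<close>. So \<open>u\<close> and \<open>v\<close> are the orders
  of the images of \<open>j\<close> and \<open>i\<close>.
\<close>

theorem (in pointed_fibration) exact_base:
  "\<exists>u v. card (homotopy_group B (Suc 0) (q 0 e)) = card (orbit E B q e) * u \<and>
     card (homotopy_group E (Suc 0) e) = u * v \<and>
     card (homotopy_group F (Suc 0) e) =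
       v * card {K \<in> homotopy_group F (Suc 0) e. \<exists>y\<in>K. (unit_edge E e, y) \<in> homotopy_rel E (Suc 0) e}"
proof -
  let ?b = "q 0 e"
  interpret E: pointed_kan E e by standard (fact E e)+
  interpret B: pointed_kan B ?b by standard (fact B b)+
  interpret F: pointed_kan F e by standard (fact F eF)+
  have inc: "simplicial_map F E (\<lambda>_ \<sigma>. \<sigma>)" by (rule strict_fibre_incl)
  let ?j = "pi1_map B ?b q" and ?i = "pi1_map E e (\<lambda>_ \<sigma>. \<sigma>)"
  interpret j: group_hom "pi1 E e" "pi1 B ?b" ?j by (rule pi1_map_hom[OF E B qs e])
  interpret i: group_hom "pi1 F e" "pi1 E e" ?i using pi1_map_hom[OF F E inc eF] by simp
  have jc: "?j (loop_class E e a) = loop_class B ?b (q (Suc 0) a)" if "a \<in> loops E e" for a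
    by (rule pi1_map_class[OF E B qs e that])
  have ic: "?i (loop_class F e a) = loop_class E e a" if "a \<in> loops F e" for a
    using pi1_map_class[OF F E inc eF that] by simp
  have lF: "loops F e = {a \<in> loops E e. q (Suc 0) a = unit_edge B ?b}" by (rule loops_strict_fibre)
  note qu = simplicial_map_const[OF qs e, of "Suc 0"]
  \<comment> \<open>The ends of all lifts, starting at \<open>e\<close>, of the loops in the class \<open>C\<close>.\<close>
  let ?d = "\<lambda>C. {y. \<exists>\<epsilon>\<in>edges E. src E \<epsilon> = e \<and> tgt E \<epsilon> = y \<and> q (Suc 0) \<epsilon> \<in> C}"
  have pF: "equiv (simplices F 0) (path_rel F)" by (rule path_rel_equiv[OF F])
  have end_F: "tgt E \<epsilon> \<in> simplices F 0" if "\<epsilon> \<in> edges E" "q (Suc 0) \<epsilon> \<in> loops B ?b" for \<epsilon>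
    using that E.S B.S b simplicial_map_face[OF qs that(1), of 0]
    by (auto simp: simplices_strict_fibre loops_def)
  have d: "?d C = path_rel F `` {tgt E \<epsilon>}"
    if C: "C \<in> carrier (pi1 B ?b)" and ep: "\<epsilon> \<in> edges E" "src E \<epsilon> = e" "q (Suc 0) \<epsilon> \<in> C" for C \<epsilon>
  proof (intro equalityI subsetI)
    note ce = B.class_mem[OF C ep(3)]
    {
      fix y assume "y \<in> ?d C"
      then obtain \<epsilon>' where ep': "\<epsilon>' \<in> edges E" "src E \<epsilon>' = e" "tgt E \<epsilon>' = y" "q (Suc 0) \<epsilon>' \<in> C" by blast
      note ce' = B.class_mem[OF C ep'(4)]
      have "tri B (q (Suc 0) \<epsilon>) (unit_edge B ?b) (q (Suc 0) \<epsilon>')"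
        using ce ce' B.class_eq[of "q (Suc 0) \<epsilon>" "q (Suc 0) \<epsilon>'"] by blast
      then obtain p where p: "tri E \<epsilon> p \<epsilon>'" "q (Suc 0) p = unit_edge B ?b"
        using lift_triangle[OF q] ep ep' by metis
      note t = triE[OF E.S p(1)]
      have "p \<in> edges F" using p(2) t(2) by (simp add: simplices_strict_fibre)
      then have "(tgt E \<epsilon>, y) \<in> path_rel F" using t ep' by (intro path_relI[of p]) auto
      then show "y \<in> path_rel F `` {tgt E \<epsilon>}" by simp
    next
      fix y assume "y \<in> path_rel F `` {tgt E \<epsilon>}"
      then have "(tgt E \<epsilon>, y) \<in> path_rel F" by simp
      then obtain p where p: "p \<in> edges F" "src F p = tgt E \<epsilon>" "tgt F p = y" by (rule path_relE)
      then have p': "p \<in> edges E" "q (Suc 0) p = unit_edge B ?b" "src E p = tgt E \<epsilon>" "tgt E p = y"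
        by (auto simp: simplices_strict_fibre)
      then obtain \<epsilon>' where t: "tri E \<epsilon> p \<epsilon>'" using fill_2(2)[OF E.fill ep(1) p'(1)] by auto
      have "tri B (q (Suc 0) \<epsilon>) (unit_edge B ?b) (q (Suc 0) \<epsilon>')" using tri_map[OF qs t] p' by simp
      moreover have "q (Suc 0) \<epsilon>' \<in> loops B ?b"
        using B.tri_loops(1)[OF calculation] ce unit_loop[OF B.S b] by blast
      ultimately have "q (Suc 0) \<epsilon>' \<in> C" using ce B.rel_iff by auto
      then show "y \<in> ?d C" using triE[OF E.S t] ep p' by auto
    }
  qed
  have lift: "\<exists>\<epsilon>\<in>edges E. src E \<epsilon> = e \<and> q (Suc 0) \<epsilon> = a" if "a \<in> loops B ?b" for a
    using that lift_edge[OF q e, of a] by (metis (mono_tags, lifting) loops_def mem_Collect_eq)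
  have d_image: "?d ` carrier (pi1 B ?b) = orbit E B q e"
  proof (intro equalityI subsetI)
    fix K assume "K \<in> ?d ` carrier (pi1 B ?b)"
    then obtain C where C: "C \<in> carrier (pi1 B ?b)" "K = ?d C" by blast
    then obtain a where a: "a \<in> loops B ?b" "C = loop_class B ?b a" by (auto simp: B.carrier_iff)
    obtain \<epsilon> where ep: "\<epsilon> \<in> edges E" "src E \<epsilon> = e" "q (Suc 0) \<epsilon> = a" using lift[OF a(1)] by blast
    have K: "K = path_rel F `` {tgt E \<epsilon>}" using d[OF C(1) ep(1,2)] ep(3) a B.class_self C by simp
    have y: "tgt E \<epsilon> \<in> simplices F 0" using end_F ep a by simp
    then have "K \<in> pi0 F" using K by (auto simp: pi0_def intro: quotientI)
    moreover have "tgt E \<epsilon> \<in> K" using K equiv_class_self[OF pF y] by simp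
    moreover have "(e, tgt E \<epsilon>) \<in> path_rel E" using ep by (intro path_relI) auto
    ultimately show "K \<in> orbit E B q e" unfolding orbit_def by blast
  next
    fix K assume "K \<in> orbit E B q e"
    then obtain y where K: "K \<in> pi0 F" "y \<in> K" "(e, y) \<in> path_rel E" unfolding orbit_def by blast
    obtain \<epsilon> where ep: "\<epsilon> \<in> edges E" "src E \<epsilon> = e" "tgt E \<epsilon> = y" using K(3) by (rule path_relE)
    obtain z where z: "z \<in> simplices F 0" "K = path_rel F `` {z}" using K(1) by (auto simp: pi0_def elim: quotientE)
    then have zy: "(z, y) \<in> path_rel F" using K by simp
    then have Ky: "K = path_rel F `` {y}" "y \<in> simplices F 0" using z pF by (auto simp: equiv_class_eq_iff)
    have "q 0 y = ?b" using Ky(2) B.S b by (simp add: simplices_strict_fibre)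
    then have l: "q (Suc 0) \<epsilon> \<in> loops B ?b"
      using simplicial_map_face[OF qs ep(1), of 0] simplicial_map_face[OF qs ep(1), of "Suc 0"] simplicial_map_in[OF qs ep(1)] ep
      by (simp add: loops_def)
    then have "K = ?d (loop_class B ?b (q (Suc 0) \<epsilon>))" using d[OF B.class_in ep(1,2)] B.class_self Ky ep by simp
    then show "K \<in> ?d ` carrier (pi1 B ?b)" using B.class_in[OF l] by blast
  qed
  have 1: "card (carrier (pi1 B ?b)) = card (orbit E B q e) * card (?j ` carrier (pi1 E e))"
    unfolding d_image[symmetric]
  proof (rule group.coset_count[OF B.group_pi1 j.img_is_subgroup])
    fix C C' assume C: "C \<in> carrier (pi1 B ?b)" "C' \<in> carrier (pi1 B ?b)"
    show "?d C = ?d C' \<longleftrightarrow> C \<otimes>\<^bsub>pi1 B ?b\<^esub> inv\<^bsub>pi1 B ?b\<^esub> C' \<in> ?j ` carrier (pi1 E e)"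
    proof
      assume eq: "?d C = ?d C'"
      obtain a where a: "a \<in> loops B ?b" "C = loop_class B ?b a" using C(1) by (auto simp: B.carrier_iff)
      obtain \<epsilon> where ep: "\<epsilon> \<in> edges E" "src E \<epsilon> = e" "q (Suc 0) \<epsilon> \<in> C" using lift[OF a(1)] a B.class_self by blast
      then have "tgt E \<epsilon> \<in> ?d C'" using eq by blast
      then obtain \<epsilon>' where ep': "\<epsilon>' \<in> edges E" "src E \<epsilon>' = e" "tgt E \<epsilon>' = tgt E \<epsilon>" "q (Suc 0) \<epsilon>' \<in> C'" by blast
      obtain l where l: "tri E l \<epsilon>' \<epsilon>" using fill_2(3)[OF E.fill ep'(1) ep(1) ep'(3)] by auto
      have ll: "l \<in> loops E e" using triE[OF E.S l] ep ep' by (simp add: loops_def)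
      have "loop_class B ?b (q (Suc 0) l) \<otimes>\<^bsub>pi1 B ?b\<^esub> C' = C"
        using B.class_mult[OF tri_map[OF qs l]] B.class_mem[OF C(1) ep(3)] B.class_mem[OF C(2) ep'(4)] loops_map[OF qs ll] by simp
      then have "C \<otimes>\<^bsub>pi1 B ?b\<^esub> inv\<^bsub>pi1 B ?b\<^esub> C' = loop_class B ?b (q (Suc 0) l)"
        using j.H.inv_solve_right' C B.class_in[OF loops_map[OF qs ll]] by metis
      then show "C \<otimes>\<^bsub>pi1 B ?b\<^esub> inv\<^bsub>pi1 B ?b\<^esub> C' \<in> ?j ` carrier (pi1 E e)"
        using jc[OF ll] E.class_in[OF ll] by (metis imageI)
    next
      assume "C \<otimes>\<^bsub>pi1 B ?b\<^esub> inv\<^bsub>pi1 B ?b\<^esub> C' \<in> ?j ` carrier (pi1 E e)"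
      then obtain l where l: "l \<in> loops E e" "C \<otimes>\<^bsub>pi1 B ?b\<^esub> inv\<^bsub>pi1 B ?b\<^esub> C' = loop_class B ?b (q (Suc 0) l)"
        using jc by (auto simp: E.carrier_iff)
      have Cl: "C = loop_class B ?b (q (Suc 0) l) \<otimes>\<^bsub>pi1 B ?b\<^esub> C'"
        using l(2) C j.H.inv_solve_right' B.class_in[OF loops_map[OF qs l(1)]] by metis
      obtain a where a: "a \<in> loops B ?b" "C' = loop_class B ?b a" using C(2) by (auto simp: B.carrier_iff)
      obtain \<epsilon>' where ep': "\<epsilon>' \<in> edges E" "src E \<epsilon>' = e" "q (Suc 0) \<epsilon>' \<in> C'" using lift[OF a(1)] a B.class_self by blast
      obtain \<epsilon> where t: "tri E l \<epsilon>' \<epsilon>" using fill_2(2)[OF E.fill, of l \<epsilon>'] l(1) ep' by (fastforce simp: loops_def)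
      note te = triE[OF E.S t]
      have "C = loop_class B ?b (q (Suc 0) \<epsilon>)"
        using Cl B.class_mult[OF tri_map[OF qs t] loops_map[OF qs l(1)]] B.class_mem[OF C(2) ep'(3)] by simp
      moreover have "q (Suc 0) \<epsilon> \<in> loops B ?b"
        using B.tri_loops(1)[OF tri_map[OF qs t] loops_map[OF qs l(1)]] B.class_mem[OF C(2) ep'(3)] by simp
      ultimately have "q (Suc 0) \<epsilon> \<in> C" using B.class_self by simp
      moreover have "src E \<epsilon> = e" using te l by (simp add: loops_def)
      ultimately have "?d C = path_rel F `` {tgt E \<epsilon>}" using d[OF C(1) te(3)] by blast
      also have "\<dots> = ?d C'" using d[OF C(2) ep'] te by simp
      finally show "?d C = ?d C'" .
    qed
  qed
  have ker_j: "kernel (pi1 E e) (pi1 B ?b) ?j = ?i ` carrier (pi1 F e)"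
  proof (intro equalityI subsetI)
    fix C assume "C \<in> kernel (pi1 E e) (pi1 B ?b) ?j"
    then obtain l where l: "l \<in> loops E e" "C = loop_class E e l" "loop_class B ?b (q (Suc 0) l) = loop_class B ?b (unit_edge B ?b)"
    proof -
      have "C \<in> carrier (pi1 E e)" "?j C = \<one>\<^bsub>pi1 B ?b\<^esub>" using \<open>C \<in> kernel (pi1 E e) (pi1 B ?b) ?j\<close> by (auto simp: kernel_def)
      then show thesis using that jc by (auto simp: E.carrier_iff) (simp add: pi1_def)
    qed
    then have "tri B (unit_edge B ?b) (unit_edge B ?b) (q (Suc 0) l)"
      using B.class_eq[OF unit_loop[OF B.S b] loops_map[OF qs l(1)]] by simp
    then have "tri B (q (Suc 0) (unit_edge E e)) (unit_edge B ?b) (q (Suc 0) l)" using qu by simp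
    then obtain m where m: "tri E (unit_edge E e) m l" "q (Suc 0) m = unit_edge B ?b"
      using lift_triangle[OF q, of "unit_edge E e" _ l] unit_loop[OF E.S e] l(1) by (auto simp: loops_def)
    have mE: "m \<in> loops E e" using E.tri_loops(2)[OF m(1) unit_loop[OF E.S e] l(1)] .
    then have mF: "m \<in> loops F e" using m by (simp add: lF)
    have "tri E (unit_edge E e) m m" using E.tri_unit_loop(2)[of m] mE by (simp add: loops_def)
    then have "tri E m (unit_edge E e) l" using E.tri_unique3[OF _ m(1)] mE by (simp add: loops_def)
    then have "C = ?i (loop_class F e m)" using ic[OF mF] E.class_eq[OF mE l(1)] l(2) by simp
    then show "C \<in> ?i ` carrier (pi1 F e)" using F.class_in[OF mF] by blast
  next
    fix C assume "C \<in> ?i ` carrier (pi1 F e)"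
    then obtain m where m: "m \<in> loops F e" "C = loop_class E e m" using ic by (auto simp: F.carrier_iff)
    then have "m \<in> loops E e" "q (Suc 0) m = unit_edge B ?b" by (auto simp: lF)
    then show "C \<in> kernel (pi1 E e) (pi1 B ?b) ?j"
      using m jc E.class_in by (simp add: kernel_def) (simp add: pi1_def)
  qed
  have ker_i: "kernel (pi1 F e) (pi1 E e) ?i =
      {K \<in> homotopy_group F (Suc 0) e. \<exists>y\<in>K. (unit_edge E e, y) \<in> homotopy_rel E (Suc 0) e}"
  proof -
    have "?i C = \<one>\<^bsub>pi1 E e\<^esub> \<longleftrightarrow> (\<exists>y\<in>C. (unit_edge E e, y) \<in> homotopy_rel E (Suc 0) e)"
      if C: "C \<in> carrier (pi1 F e)" for C
    proof -
      have *: "?i C = \<one>\<^bsub>pi1 E e\<^esub> \<longleftrightarrow> (unit_edge E e, y) \<in> homotopy_rel E (Suc 0) e" if "y \<in> C" for y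
      proof -
        note y = F.class_mem[OF C that]
        then have yE: "y \<in> loops E e" by (simp add: lF)
        have "?i C = loop_class E e y" using ic[of y] y by simp
        then show ?thesis using E.class_eq[OF unit_loop[OF E.S e] yE] unit_loop[OF E.S e] yE E.rel_iff
          by (auto simp: pi1_def)
      qed
      moreover have "\<exists>y. y \<in> C" using C F.class_self by (auto simp: F.carrier_iff)
      ultimately show ?thesis by blast
    qed
    then show ?thesis unfolding kernel_def F.carrier_pi1 by blast
  qed
  show ?thesis
    using 1 j.hom_count i.hom_count unfolding ker_j ker_i F.carrier_pi1 E.carrier_pi1 B.carrier_pi1 by blast
qed

section \<open>Loop spaces\<close>

text \<open>
  With this model, passing to loop spaces shifts homotopy groups by one index and maps fibres to fibres as
  equalities of sets, so that the long exact sequence follows from its end by induction.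
\<close>

definition loop_space :: "'a simplicial \<Rightarrow> 'a \<Rightarrow> 'a simplicial" where
  "loop_space X x = strict_fibre (slice X x) X (slice_proj X) x"

lemma simplices_loop_space:
  "simplices (loop_space X x) n =
    {\<sigma> \<in> simplices X (Suc n). act X (Suc n) [0] \<sigma> = x \<and> face X (Suc n) 0 \<sigma> = const_simplex X n x}"
  by (auto simp: loop_space_def simplices_strict_fibre simplices_slice slice_proj_def)

lemma act_loop_space: "act (loop_space X x) n \<phi> = act X (Suc n) (0 # map Suc \<phi>)"
  by (simp add: loop_space_def act_slice)

lemma face_loop_space: "i \<le> n \<Longrightarrow> face (loop_space X x) n i \<sigma> = face X (Suc n) (Suc i) \<sigma>"
  by (simp add: loop_space_def face_slice)

lemma const_loop_space:
  assumes X: "simplicial_set X" "x \<in> simplices X 0"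
  shows "const_simplex (loop_space X x) n (unit_edge X x) = const_simplex X (Suc n) x"
proof -
  have "0 # map Suc (replicate (Suc n) 0) \<in> mono_maps (Suc n) (Suc 0)"
    by (rule slice_op_in) (rule replicate_in, simp)
  then show ?thesis using act_const[OF X] by (simp add: const_simplex_def[of "loop_space X x"] act_loop_space)
qed

lemma kan_loop_space:
  assumes X: "kan_complex X" and x: "x \<in> simplices X 0" shows "kan_complex (loop_space X x)"
  unfolding kan_complex_iff
proof (intro conjI allI impI)
  note S = kan_sset[OF X]
  show "simplicial_set (loop_space X x)" unfolding loop_space_def
    by (rule simplicial_set_strict_fibre[OF simplicial_set_slice[OF S] S simplicial_map_slice_proj[OF S] x])
  fix n k :: nat assume nk: "1 \<le> n \<and> k \<le> n"
  then have "fills X (Suc n) (Suc k)" using X by (simp add: kan_complex_iff)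
  then show "fills (loop_space X x) n k" unfolding loop_space_def
    using nk by (intro fills_strict_fibre[OF S x] lifts_slice_proj[OF S]) auto
qed

lemma unit_in_loop_space: "simplicial_set X \<Longrightarrow> x \<in> simplices X 0 \<Longrightarrow> unit_edge X x \<in> simplices (loop_space X x) 0"
  using const_simplex_in[of X x "Suc 0"] edge_ends(1)[of X "unit_edge X x"] by (auto simp: simplices_loop_space)

lemma vertex_of_sphere:
  assumes X: "simplicial_set X" "x \<in> simplices X 0" and s: "\<sigma> \<in> simplices X (Suc m)"
    and i: "i \<le> Suc m" "0 < i" and f: "face X (Suc m) i \<sigma> = const_simplex X m x"
  shows "act X (Suc m) [0] \<sigma> = x"
  using vertex_face[OF X(1) s i(1), of 0] i f act_const[OF X single_in[of 0 m]] X by simp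

lemma spheres_loop_space:
  assumes X: "simplicial_set X" "x \<in> simplices X 0"
  shows "spheres (loop_space X x) (Suc m) (unit_edge X x) = spheres X (Suc (Suc m)) x"
proof -
  have "act X (Suc (Suc m)) [0] \<sigma> = x"
    if "\<sigma> \<in> simplices X (Suc (Suc m))" "\<forall>i\<le>Suc m. face X (Suc (Suc m)) (Suc i) \<sigma> = const_simplex X (Suc m) x" for \<sigma>
    using vertex_of_sphere[OF X that(1), of "Suc 0"] that(2) by auto
  then show ?thesis
    unfolding spheres_def simplices_loop_space all_le_Suc[of "Suc m"]
    by (auto simp: face_loop_space const_loop_space[OF X])
qed

lemma homotopy_rel_loop_space:
  assumes X: "simplicial_set X" "x \<in> simplices X 0"
  shows "homotopy_rel (loop_space X x) (Suc m) (unit_edge X x) = homotopy_rel X (Suc (Suc m)) x"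
proof -
  have v: "act X (Suc (Suc (Suc m))) [0] \<omega> = x"
    if "\<omega> \<in> simplices X (Suc (Suc (Suc m)))" "face X (Suc (Suc (Suc m))) (Suc (Suc m)) \<omega> \<in> spheres X (Suc (Suc m)) x" for \<omega>
  proof -
    let ?s = "face X (Suc (Suc (Suc m))) (Suc (Suc m)) \<omega>"
    have "?s \<in> simplices X (Suc (Suc m))" "face X (Suc (Suc m)) (Suc 0) ?s = const_simplex X (Suc m) x"
      using that(2) by (auto simp: spheres_def)
    then have "act X (Suc (Suc m)) [0] ?s = x" using vertex_of_sphere[OF X, of ?s "Suc m" "Suc 0"] by simp
    then show ?thesis using vertex_face[OF X(1) that(1), of "Suc (Suc m)" 0] by simp
  qed
  show ?thesis
    unfolding homotopy_rel_def simplices_loop_space spheres_loop_space[OF X] all_less_Suc0[of "Suc m"]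
    using v by (auto simp: face_loop_space const_loop_space[OF X])
qed

lemma homotopy_group_loop_space:
  assumes X: "simplicial_set X" "x \<in> simplices X 0"
  shows "homotopy_group (loop_space X x) (Suc m) (unit_edge X x) = homotopy_group X (Suc (Suc m)) x"
  by (simp add: homotopy_group_def spheres_loop_space[OF X] homotopy_rel_loop_space[OF X])

lemma loop_space_0:
  assumes X: "simplicial_set X" "x \<in> simplices X 0"
  shows "simplices (loop_space X x) 0 = loops X x"
  using X by (auto simp: simplices_loop_space loops_def edge_ends[OF X(1)])

text \<open>
  An edge of the loop space from \<open>a\<close> to \<open>c\<close> is a triangle with edges \<open>a\<close>, \<open>1\<close>, \<open>c\<close>.
\<close>

lemma path_rel_loop_space:
  assumes X: "kan_complex X" and x: "x \<in> simplices X 0"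
  shows "path_rel (loop_space X x) = homotopy_rel X (Suc 0) x"
proof -
  interpret pointed_kan X x by standard (fact X x)+
  have v: "act X (Suc (Suc 0)) [0] \<omega> = x" if "\<omega> \<in> simplices X (Suc (Suc 0))" "face2 X (Suc 0) \<omega> \<in> loops X x" for \<omega>
    using that vertex_face[OF S that(1), of "Suc 0" 0] by (auto simp: loops_def edge_ends[OF S])
  have sub: "path_rel (loop_space X x) \<subseteq> loops X x \<times> loops X x"
    using equiv_type[OF path_rel_equiv[OF kan_loop_space[OF X x]]] loop_space_0[OF S x] by simp
  have "(a, c) \<in> path_rel (loop_space X x) \<longleftrightarrow> tri X a (unit_edge X x) c" if "a \<in> loops X x" "c \<in> loops X x" for a c
    unfolding path_rel_def tri_def using v that by (auto simp: simplices_loop_space face_loop_space)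
  then show ?thesis using sub by (auto simp: rel_iff)
qed

lemma pi0_loop_space:
  assumes X: "kan_complex X" and x: "x \<in> simplices X 0"
  shows "pi0 (loop_space X x) = homotopy_group X (Suc 0) x"
  by (simp add: pi0_def homotopy_group_def path_rel_loop_space[OF X x] loop_space_0 spheres_1 kan_sset[OF X] x)

lemma left_fibration_loop_space:
  assumes q: "left_fibration E B q" and B: "kan_complex B" and e: "e \<in> simplices E 0"
  shows "left_fibration (loop_space E e) (loop_space B (q 0 e)) (\<lambda>n. q (Suc n))"
  unfolding left_fibration_iff
proof (intro conjI allI impI)
  have SE: "simplicial_set E" and qs: "simplicial_map E B q" using q by (auto simp: left_fibration_iff)
  have b: "q 0 e \<in> simplices B 0" using qs e by blast
  note E = left_fibration_kan[OF q B] and SB = kan_sset[OF B]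
  show "simplicial_set (loop_space E e)" "simplicial_set (loop_space B (q 0 e))"
    using kan_loop_space[OF E e] kan_loop_space[OF B b] by (auto intro: kan_sset)
  show "simplicial_map (loop_space E e) (loop_space B (q 0 e)) (\<lambda>n. q (Suc n))"
    unfolding simplicial_map_def
  proof (intro conjI allI impI)
    fix n \<sigma> assume "\<sigma> \<in> simplices (loop_space E e) n"
    then show "q (Suc n) \<sigma> \<in> simplices (loop_space B (q 0 e)) n"
      using simplicial_map_act[OF qs, of \<sigma> "Suc n" "[0]" 0] simplicial_map_face[OF qs, of \<sigma> n 0] simplicial_map_const[OF qs e, of n] qs
      by (auto simp: simplices_loop_space single_in)
  next
    fix n m \<phi> \<sigma> assume "\<phi> \<in> mono_maps m n \<and> \<sigma> \<in> simplices (loop_space E e) n"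
    then show "q (Suc m) (act (loop_space E e) n \<phi> \<sigma>) = act (loop_space B (q 0 e)) n \<phi> (q (Suc n) \<sigma>)"
      using simplicial_map_act[OF qs, of \<sigma> "Suc n"] slice_op_in[of \<phi> m n] by (auto simp: simplices_loop_space act_loop_space)
  qed
  fix n k :: nat assume nk: "1 \<le> n \<and> k < n"
  then obtain m where m: "n = Suc m" by (cases n) auto
  show "lifts (loop_space E e) (loop_space B (q 0 e)) (\<lambda>n. q (Suc n)) n k"
    unfolding lifts_def
  proof (intro allI impI, elim conjE)
    fix h y assume h: "horn (loop_space E e) n k h" and y: "y \<in> simplices (loop_space B (q 0 e)) n"
      and f: "\<forall>i\<le>n. i \<noteq> k \<longrightarrow> face (loop_space B (q 0 e)) n i y = q (Suc (n - 1)) (h i)"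
    have hs: "horn (slice E e) n k h" "\<And>i. i \<le> n \<Longrightarrow> i \<noteq> k \<Longrightarrow> slice_proj E (n - 1) (h i) = const_simplex E (n - 1) e"
      using h by (auto simp: loop_space_def horn_strict_fibre)
    let ?h = "\<lambda>i. case i of 0 \<Rightarrow> const_simplex E n e | Suc j \<Rightarrow> h j"
    have cE: "const_simplex E n e \<in> simplices E n" using SE e by blast
    have h': "horn E (Suc n) (Suc k) ?h"
      by (rule slice_horn[OF SE _ hs(1) cE]) (use nk hs(2) face_const[OF SE e] m in auto)
    have "\<forall>i\<le>Suc n. i \<noteq> Suc k \<longrightarrow> face B (Suc n) i y = q (Suc n - 1) (?h i)"
      using f y simplicial_map_const[OF qs e, of n] m
      by (auto simp: face_loop_space simplices_loop_space split: nat.splits)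
    moreover have "y \<in> simplices B (Suc n)" using y by (simp add: simplices_loop_space)
    moreover have "lifts E B q (Suc n) (Suc k)" using q nk by (simp add: left_fibration_iff)
    ultimately obtain w where w: "w \<in> simplices E (Suc n)" "q (Suc n) w = y"
        "\<forall>i\<le>Suc n. i \<noteq> Suc k \<longrightarrow> face E (Suc n) i w = ?h i"
      using h' unfolding lifts_def by blast
    have w': "\<And>i. i \<le> n \<Longrightarrow> i \<noteq> k \<Longrightarrow> face E (Suc n) (Suc i) w = h i" using w(3) by auto
    have "w \<in> simplices (slice E e) n" using slice_filler(1)[OF SE _ hs(1) _ w(1) w'] nk by simp
    moreover have "face E (Suc n) 0 w = const_simplex E n e" using w(3) by auto
    ultimately show "\<exists>x\<in>simplices (loop_space E e) n. q (Suc n) x = y \<and>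
        (\<forall>i\<le>n. i \<noteq> k \<longrightarrow> face (loop_space E e) n i x = h i)"
      using w(2) w' by (intro bexI[of _ w]) (auto simp: simplices_loop_space simplices_slice face_loop_space)
  qed
qed

lemma strict_fibre_loop_space:
  assumes B: "simplicial_set B" "q 0 e \<in> simplices B 0"
  shows "strict_fibre (loop_space E e) (loop_space B (q 0 e)) (\<lambda>n. q (Suc n)) (unit_edge B (q 0 e)) =
    loop_space (strict_fibre E B q (q 0 e)) e" (is "?L = ?R")
proof -
  have "simplices ?L n = simplices ?R n" for n
    by (auto simp: simplices_strict_fibre simplices_loop_space const_loop_space[OF B])
  moreover have "act ?L n = act ?R n" for n by (simp add: fun_eq_iff act_loop_space)
  ultimately show ?thesis by (simp add: fun_eq_iff)
qed

text \<open>
  The order of the image of the connecting map \<open>\<pi>\<^sub>n\<^sub>+\<^sub>1(B) \<rightarrow> \<pi>\<^sub>n(F)\<close>, as the size of an orbit for the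
  \<open>n\<close>-fold loop spaces.
\<close>

fun orbit_count :: "nat \<Rightarrow> 'a simplicial \<Rightarrow> 'b simplicial \<Rightarrow> (nat \<Rightarrow> 'a \<Rightarrow> 'b) \<Rightarrow> 'a \<Rightarrow> nat" where
  "orbit_count 0 E B q e = card (orbit E B q e)"
| "orbit_count (Suc n) E B q e =
    orbit_count n (loop_space E e) (loop_space B (q 0 e)) (\<lambda>n. q (Suc n)) (unit_edge E e)"

text \<open>
  The orbit of the trivial loop in the loop space of the fibre consists of the classes that become trivial in
  the total space. It is therefore the kernel of \<open>\<pi>\<^sub>1(F) \<rightarrow> \<pi>\<^sub>1(E)\<close> that appears in \<open>exact_base\<close>, which is
  the case \<open>n = 0\<close>. The induction step replaces everything by loop spaces.
\<close>

theorem exact_sequence: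
  assumes "left_fibration E B q" and "kan_complex B" and "e \<in> simplices E 0"
  shows "\<exists>u v. card (homotopy_group B (Suc n) (q 0 e)) = orbit_count n E B q e * u \<and>
     card (homotopy_group E (Suc n) e) = u * v \<and>
     card (homotopy_group (strict_fibre E B q (q 0 e)) (Suc n) e) = v * orbit_count (Suc n) E B q e"
  using assms
proof (induction n arbitrary: E B q e)
  case (0 E B q e)
  interpret pointed_fibration E B q e by standard (fact 0)+
  have "orbit (loop_space E e) (loop_space B (q 0 e)) (\<lambda>n. q (Suc n)) (unit_edge E e) =
    {K \<in> homotopy_group (strict_fibre E B q (q 0 e)) (Suc 0) e. \<exists>y\<in>K. (unit_edge E e, y) \<in> homotopy_rel E (Suc 0) e}"
    by (simp add: orbit_def simplicial_map_const[OF qs e] strict_fibre_loop_space[where E = E and B = B and q = q and e = e, OF SB b] pi0_loop_space[OF F eF]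
        path_rel_loop_space[OF E e])
  then show ?case using exact_base by simp
next
  case (Suc n E B q e)
  interpret pointed_fibration E B q e by standard (fact Suc(2-4))+
  have "\<exists>u v. card (homotopy_group (loop_space B (q 0 e)) (Suc n) (unit_edge B (q 0 e))) =
        orbit_count n (loop_space E e) (loop_space B (q 0 e)) (\<lambda>n. q (Suc n)) (unit_edge E e) * u \<and>
     card (homotopy_group (loop_space E e) (Suc n) (unit_edge E e)) = u * v \<and>
     card (homotopy_group (loop_space (strict_fibre E B q (q 0 e)) e) (Suc n) (unit_edge E e)) =
        v * orbit_count (Suc n) (loop_space E e) (loop_space B (q 0 e)) (\<lambda>n. q (Suc n)) (unit_edge E e)"
    using Suc.IH[OF left_fibration_loop_space[OF q B e] kan_loop_space[OF B b] unit_in_loop_space[OF kan_sset[OF E] e]]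
    by (simp only: simplicial_map_const[OF qs e] strict_fibre_loop_space[where E = E and B = B and q = q and e = e, OF SB b])
  moreover have "homotopy_group (loop_space (strict_fibre E B q (q 0 e)) e) (Suc n) (unit_edge E e) =
     homotopy_group (strict_fibre E B q (q 0 e)) (Suc (Suc n)) e"
    using homotopy_group_loop_space[OF kan_sset[OF F] eF] by simp
  ultimately show ?case
    by (simp add: homotopy_group_loop_space[OF kan_sset[OF E] e] homotopy_group_loop_space[OF SB b])
qed

section \<open>The weight of a point\<close>

definition pi_finite :: "'a simplicial \<Rightarrow> 'a \<Rightarrow> bool" where
  "pi_finite X x \<longleftrightarrow> (\<forall>i\<ge>1. finite (homotopy_group X i x)) \<and> (\<exists>N. \<forall>i>N. card (homotopy_group X i x) = 1)"

definition alternating_product :: "(nat \<Rightarrow> nat) \<Rightarrow> rat" where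
  "alternating_product g = (\<Prod>i | 0 < i \<and> g i \<noteq> 1. of_nat (g i) powi ((-1) ^ i))"

text \<open>
  The contribution of the component of \<open>x\<close> to the cardinality of \<open>X\<close>.
\<close>

definition weight :: "'a simplicial \<Rightarrow> 'a \<Rightarrow> rat" where
  "weight X x = alternating_product (\<lambda>i. card (homotopy_group X i x))"

lemma locally_finite_iff:
  "locally_finite_groupoid X \<longleftrightarrow> kan_complex X \<and> (\<forall>x\<in>simplices X 0. pi_finite X x)"
  by (auto simp: locally_finite_groupoid_def pi_finite_def)

lemma cardinality_weight: "cardinality X = (\<Sum>c\<in>pi0 X. weight X (rep c))"
  by (simp add: cardinality_def weight_def alternating_product_def)

lemma homotopy_group_nonempty:
  assumes X: "simplicial_set X" "x \<in> simplices X 0" shows "homotopy_group X (Suc m) x \<noteq> {}"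
proof -
  have "const_simplex X (Suc m) x \<in> spheres X (Suc m) x"
    using X const_simplex_in[OF X, of "Suc m"] face_const[OF X] by (auto simp: spheres_def)
  then show ?thesis by (auto simp: homotopy_group_def quotient_def)
qed

lemma pi_finite_card:
  assumes X: "simplicial_set X" "x \<in> simplices X 0"
  shows "pi_finite X x \<longleftrightarrow> (\<forall>i. card (homotopy_group X (Suc i) x) \<noteq> 0) \<and> (\<exists>N. \<forall>i>N. card (homotopy_group X i x) = 1)"
proof -
  have fin: "finite (homotopy_group X (Suc i) x) \<longleftrightarrow> card (homotopy_group X (Suc i) x) \<noteq> 0" for i
    using homotopy_group_nonempty[OF X] by (simp add: card_eq_0_iff)
  have shift: "(\<forall>i\<ge>1. P i) \<longleftrightarrow> (\<forall>i. P (Suc i))" for P :: "nat \<Rightarrow> bool"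
  proof (intro iffI allI impI)
    fix i :: nat assume "\<forall>i. P (Suc i)" "1 \<le> i"
    then show "P i" by (cases i) auto
  qed simp
  show ?thesis unfolding pi_finite_def shift fin by (rule refl)
qed

lemma alternating_product_bounded:
  assumes "\<And>i. i > N \<Longrightarrow> g i = 1"
  shows "alternating_product g = (\<Prod>i=1..N. of_nat (g i) powi ((-1) ^ i))"
  unfolding alternating_product_def
proof (rule prod.mono_neutral_left)
  show "{i. 0 < i \<and> g i \<noteq> 1} \<subseteq> {1..N}" using assms by (force simp: not_less[symmetric])
qed auto

lemma powi_sign: "(x :: rat) powi ((-1) ^ i) = (if even i then x else inverse x)"
  by (cases "even i") (simp_all add: power_int_minus)

text \<open>
  Here \<open>b\<close>, \<open>e\<close>, \<open>f\<close> are the orders of the homotopy groups of base, total space and fibre, and \<open>c n\<close> is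
  the order of the image of the connecting map in degree \<open>n\<close>. As \<open>b n * f n = e n * c (n - 1) * c n\<close>, the alternating
  product telescopes to the boundary terms \<open>c 0\<close> and \<open>c N = 1\<close>.
\<close>

lemma alternating_product_exact:
  fixes b e f c :: "nat \<Rightarrow> nat"
  assumes les: "\<And>n. \<exists>u v. b (Suc n) = c n * u \<and> e (Suc n) = u * v \<and> f (Suc n) = v * c (Suc n)"
    and nz: "\<And>n. b (Suc n) \<noteq> 0" "\<And>n. e (Suc n) \<noteq> 0" "\<And>n. f (Suc n) \<noteq> 0"
    and one: "\<And>i. i > N \<Longrightarrow> b i = 1" "\<And>i. i > N \<Longrightarrow> e i = 1" "\<And>i. i > N \<Longrightarrow> f i = 1"
  shows "alternating_product f * alternating_product b * of_nat (c 0) = alternating_product e"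
proof -
  let ?s = "\<lambda>g i. of_nat (g i) powi ((-1) ^ i) :: rat"
  have c0: "c n \<noteq> 0" for n using les[of n] nz(1)[of n] by auto
  have cN: "c N = 1" using les[of N] one(1)[of "Suc N"] by auto
  have step: "?s f (Suc n) * ?s b (Suc n) = ?s e (Suc n) * (of_nat (c n * c (Suc n)) powi ((-1) ^ Suc n))" for n
  proof -
    obtain u v where uv: "b (Suc n) = c n * u" "e (Suc n) = u * v" "f (Suc n) = v * c (Suc n)" using les by blast
    show ?thesis unfolding powi_sign uv by (auto simp: inverse_mult_distrib)
  qed
  have "(\<Prod>i=1..n. ?s f i) * (\<Prod>i=1..n. ?s b i) * of_nat (c 0) = (\<Prod>i=1..n. ?s e i) * ?s c n" for n
  proof (induction n)
    case (Suc n)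
    have "(\<Prod>i=1..Suc n. ?s f i) * (\<Prod>i=1..Suc n. ?s b i) * of_nat (c 0) =
       ((\<Prod>i=1..n. ?s f i) * (\<Prod>i=1..n. ?s b i) * of_nat (c 0)) * (?s f (Suc n) * ?s b (Suc n))"
      by (simp add: mult_ac)
    also have "\<dots> = (\<Prod>i=1..Suc n. ?s e i) * (?s c n * (of_nat (c n * c (Suc n)) powi ((-1) ^ Suc n)))"
      unfolding Suc step by (simp add: mult_ac)
    also have "?s c n * (of_nat (c n * c (Suc n)) powi ((-1) ^ Suc n)) = ?s c (Suc n)"
      using c0[of n] c0[of "Suc n"] unfolding powi_sign by (auto simp: field_simps)
    finally show ?case .
  qed simp
  from this[of N] show ?thesis
    using alternating_product_bounded[of N f] alternating_product_bounded[of N b] alternating_product_bounded[of N e] one cN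
    by simp
qed

text \<open>
  For orders, being nonzero means that the group is finite: \<open>card\<close> is \<open>0\<close> on infinite sets, and homotopy
  groups are not empty.
\<close>

lemma exact_finite:
  fixes b e f c :: "nat \<Rightarrow> nat"
  assumes les: "\<And>n. \<exists>u v. b (Suc n) = c n * u \<and> e (Suc n) = u * v \<and> f (Suc n) = v * c (Suc n)"
    and b: "\<And>n. b (Suc n) \<noteq> 0"
  shows "(\<And>n. f (Suc n) \<noteq> 0) \<Longrightarrow> e (Suc n) \<noteq> 0" "(\<And>n. e (Suc n) \<noteq> 0) \<Longrightarrow> f (Suc n) \<noteq> 0"
    "b (Suc n) = 1 \<Longrightarrow> f (Suc n) = 1 \<Longrightarrow> e (Suc n) = 1"
    "b (Suc n) = 1 \<Longrightarrow> b (Suc (Suc n)) = 1 \<Longrightarrow> e (Suc n) = 1 \<Longrightarrow> f (Suc n) = 1"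
proof -
  have c: "c n \<noteq> 0" for n using les[of n] b[of n] by auto
  show "(\<And>n. f (Suc n) \<noteq> 0) \<Longrightarrow> e (Suc n) \<noteq> 0" using les[of n] b[of n] by (metis mult_is_0)
  show "(\<And>n. e (Suc n) \<noteq> 0) \<Longrightarrow> f (Suc n) \<noteq> 0" using les[of n] c[of "Suc n"] by (metis mult_is_0)
  show "b (Suc n) = 1 \<Longrightarrow> f (Suc n) = 1 \<Longrightarrow> e (Suc n) = 1" using les[of n] by auto
  show "b (Suc n) = 1 \<Longrightarrow> b (Suc (Suc n)) = 1 \<Longrightarrow> e (Suc n) = 1 \<Longrightarrow> f (Suc n) = 1"
    using les[of n] les[of "Suc n"] by auto
qed

context pointed_fibration
begin

abbreviation nb :: "nat \<Rightarrow> nat" where "nb i \<equiv> card (homotopy_group B i (q 0 e))"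
abbreviation ne :: "nat \<Rightarrow> nat" where "ne i \<equiv> card (homotopy_group E i e)"
abbreviation nf :: "nat \<Rightarrow> nat" where "nf i \<equiv> card (homotopy_group F i e)"
abbreviation nc :: "nat \<Rightarrow> nat" where "nc n \<equiv> orbit_count n E B q e"

lemma les: "\<exists>u v. nb (Suc n) = nc n * u \<and> ne (Suc n) = u * v \<and> nf (Suc n) = v * nc (Suc n)"
  by (rule exact_sequence[OF q B e])

lemma pi_finite_total:
  assumes fb: "pi_finite B (q 0 e)" and ff: "pi_finite F e"
  shows "pi_finite E e"
proof -
  obtain M where M: "\<And>i. nb (Suc i) \<noteq> 0" "\<And>i. i > M \<Longrightarrow> nb i = 1" using fb unfolding pi_finite_card[OF SB b] by auto
  obtain N where N: "\<And>i. nf (Suc i) \<noteq> 0" "\<And>i. i > N \<Longrightarrow> nf i = 1" using ff unfolding pi_finite_card[OF SF eF] by auto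
  have "ne i = 1" if i: "i > max M N" for i
  proof -
    obtain n where n: "i = Suc n" using i by (cases i) auto
    show ?thesis using exact_finite(3)[of nb nc ne nf, OF les M(1), of n] M(2)[of i] N(2)[of i] i n by simp
  qed
  then show ?thesis unfolding pi_finite_card[OF SE e]
    using exact_finite(1)[of nb nc ne nf, OF les M(1) N(1)] by blast
qed

lemma pi_finite_fibre:
  assumes fb: "pi_finite B (q 0 e)" and fe: "pi_finite E e"
  shows "pi_finite F e"
proof -
  obtain M where M: "\<And>i. nb (Suc i) \<noteq> 0" "\<And>i. i > M \<Longrightarrow> nb i = 1" using fb unfolding pi_finite_card[OF SB b] by auto
  obtain N where N: "\<And>i. ne (Suc i) \<noteq> 0" "\<And>i. i > N \<Longrightarrow> ne i = 1" using fe unfolding pi_finite_card[OF SE e] by auto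
  have "nf i = 1" if i: "i > max M N" for i
  proof -
    obtain n where n: "i = Suc n" using i by (cases i) auto
    show ?thesis using exact_finite(4)[of nb nc ne nf, OF les M(1), of n] M(2)[of i] M(2)[of "Suc i"] N(2)[of i] i n by simp
  qed
  then show ?thesis unfolding pi_finite_card[OF SF eF]
    using exact_finite(2)[of nb nc ne nf, OF les M(1) N(1)] by blast
qed

text \<open>
  Multiplicativity holds only up to the number of components of the fibre that become one component of the
  total space; this number is the boundary term \<open>c 0\<close> of \<open>alternating_product_exact\<close>.
\<close>

theorem weight_fibration:
  assumes fb: "pi_finite B (q 0 e)" and ff: "pi_finite F e"
  shows "weight F e * weight B (q 0 e) * of_nat (card (orbit E B q e)) = weight E e"
    and "card (orbit E B q e) \<noteq> 0"
proof -
  have fe: "pi_finite E e" using pi_finite_total[OF fb ff] .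
  obtain M where M: "\<And>i. nb (Suc i) \<noteq> 0" "\<And>i. i > M \<Longrightarrow> nb i = 1" using fb unfolding pi_finite_card[OF SB b] by auto
  obtain N where N: "\<And>i. nf (Suc i) \<noteq> 0" "\<And>i. i > N \<Longrightarrow> nf i = 1" using ff unfolding pi_finite_card[OF SF eF] by auto
  obtain K where K: "\<And>i. ne (Suc i) \<noteq> 0" "\<And>i. i > K \<Longrightarrow> ne i = 1" using fe unfolding pi_finite_card[OF SE e] by auto
  have "alternating_product nf * alternating_product nb * of_nat (nc 0) = alternating_product ne"
    by (rule alternating_product_exact[of nb nc ne nf "max (max M N) K", OF les M(1) K(1) N(1)])
      (use M(2) N(2) K(2) in auto)
  then show "weight F e * weight B (q 0 e) * of_nat (card (orbit E B q e)) = weight E e"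
    unfolding weight_def by simp
  show "card (orbit E B q e) \<noteq> 0" using les[of 0] M(1)[of 0] by fastforce
qed

end

lemma homotopy_group_path:
  assumes X: "kan_complex X" and xy: "(x, y) \<in> path_rel X"
  shows "\<exists>f. bij_betw f (homotopy_group X (Suc m) x) (homotopy_group X (Suc m) y)"
  using homotopy_group_edge[OF X] xy by (metis path_relE)

lemma weight_cong:
  assumes "\<And>m. \<exists>f. bij_betw f (homotopy_group X (Suc m) x) (homotopy_group Y (Suc m) y)"
  shows "weight X x = weight Y y" "pi_finite X x \<longleftrightarrow> pi_finite Y y"
proof -
  have "card (homotopy_group X (Suc i) x) = card (homotopy_group Y (Suc i) y)"
    "finite (homotopy_group X (Suc i) x) \<longleftrightarrow> finite (homotopy_group Y (Suc i) y)" for i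
    using assms[of i] by (auto simp: bij_betw_same_card bij_betw_finite)
  then have c: "card (homotopy_group X i x) = card (homotopy_group Y i y)"
    "finite (homotopy_group X i x) \<longleftrightarrow> finite (homotopy_group Y i y)" if "0 < i" for i
    using that by (cases i; simp)+
  show "weight X x = weight Y y" unfolding weight_def alternating_product_def
    by (rule prod.cong) (use c in auto)
  have "(\<exists>N. \<forall>i>N. card (homotopy_group X i x) = 1) \<longleftrightarrow> (\<exists>N. \<forall>i>N. card (homotopy_group Y i y) = 1)"
    by (intro ex_cong1 all_cong1 imp_cong refl) (simp add: c(1))
  then show "pi_finite X x \<longleftrightarrow> pi_finite Y y" unfolding pi_finite_def using c(2) by (simp add: Suc_le_eq)
qed

lemma weight_path:
  assumes "kan_complex X" and "(x, y) \<in> path_rel X"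
  shows "weight X x = weight X y" "pi_finite X x \<longleftrightarrow> pi_finite X y"
  using weight_cong[OF homotopy_group_path[OF assms]] by auto

section \<open>Summing over components\<close>

lemma rep_in: "c \<noteq> {} \<Longrightarrow> rep c \<in> c" unfolding rep_def by (rule someI_ex) blast

lemma pi0_rep:
  assumes X: "kan_complex X" and c: "c \<in> pi0 X"
  shows "rep c \<in> c" "rep c \<in> simplices X 0" "c = path_rel X `` {rep c}"
    "\<And>y. y \<in> c \<Longrightarrow> (rep c, y) \<in> path_rel X"
proof -
  note eq = path_rel_equiv[OF X]
  have "c \<noteq> {}" using in_quotient_imp_non_empty[OF eq] c by (simp add: pi0_def)
  then show r: "rep c \<in> c" by (rule rep_in)
  show "rep c \<in> simplices X 0" using r c in_quotient_imp_subset[OF eq] unfolding pi0_def by blast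
  show "\<And>y. y \<in> c \<Longrightarrow> (rep c, y) \<in> path_rel X" using r c in_quotient_imp_in_rel[OF eq] unfolding pi0_def by blast
  then show "c = path_rel X `` {rep c}"
    using c eq r unfolding pi0_def by (metis Image_singleton_iff equiv_class_eq quotientE)
qed

lemma pi0_classI: "x \<in> simplices X 0 \<Longrightarrow> path_rel X `` {x} \<in> pi0 X"
  by (simp add: pi0_def quotientI)

lemma path_rel_map: "simplicial_map X Y g \<Longrightarrow> (x, y) \<in> path_rel X \<Longrightarrow> (g 0 x, g 0 y) \<in> path_rel Y"
  by (elim path_relE, rule path_relI) (auto simp: simplicial_map_face[symmetric])

definition components_over :: "'a simplicial \<Rightarrow> 'b simplicial \<Rightarrow> (nat \<Rightarrow> 'a \<Rightarrow> 'b) \<Rightarrow> 'b \<Rightarrow> 'a set set" where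
  "components_over E B q b = {c \<in> pi0 E. (q 0 (rep c), b) \<in> path_rel B}"

lemma transport_to_fibre:
  assumes q: "left_fibration E B q" and y: "y \<in> simplices E 0" and yb: "(q 0 y, b) \<in> path_rel B"
  obtains e where "e \<in> simplices E 0" "q 0 e = b" "(y, e) \<in> path_rel E"
proof -
  have qs: "simplicial_map E B q" and SE: "simplicial_set E" using q by (auto simp: left_fibration_iff)
  obtain g where g: "g \<in> edges B" "src B g = q 0 y" "tgt B g = b" using yb by (rule path_relE)
  obtain h where h: "h \<in> edges E" "src E h = y" "q (Suc 0) h = g" by (rule lift_edge[OF q y g(1,2)])
  show thesis
    by (rule that[of "tgt E h"]) (use h g simplicial_map_face[OF qs h(1), of 0] SE in \<open>auto intro: path_relI\<close>)
qed

text \<open>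
  Every component of \<open>E\<close> over the component of \<open>b\<close> meets the fibre \<open>F\<close> at \<open>b\<close>, since paths in the base
  lift. The components of \<open>F\<close> inside a component \<open>c\<close> of \<open>E\<close> form one orbit, and each of them contributes to
  \<open>cardinality F * weight B b\<close> the weight of \<open>c\<close> divided by the size of that orbit, by \<open>weight_fibration\<close>.
  So together they contribute the weight of \<open>c\<close>.
\<close>

theorem fibration_over_component:
  assumes q: "left_fibration E B q" and B: "kan_complex B" and b: "b \<in> simplices B 0"
    and fb: "pi_finite B b" and F: "finite_groupoid (strict_fibre E B q b)"
  shows "finite (components_over E B q b)"
    and "(\<Sum>c\<in>components_over E B q b. weight E (rep c)) = cardinality (strict_fibre E B q b) * weight B b"
    and "\<And>y. y \<in> simplices E 0 \<Longrightarrow> (q 0 y, b) \<in> path_rel B \<Longrightarrow> pi_finite E y"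
proof -
  let ?F = "strict_fibre E B q b"
  have qs: "simplicial_map E B q" using q by (simp add: left_fibration_iff)
  note E = left_fibration_kan[OF q B] and eqB = path_rel_equiv[OF B] and KF = strict_fibre_kan[OF q B b]
  note eqE = path_rel_equiv[OF E] and eqF = path_rel_equiv[OF KF]
  have inc: "simplicial_map ?F E (\<lambda>_ \<sigma>. \<sigma>)" by (rule strict_fibre_incl)
  have finF: "finite (pi0 ?F)" and pF: "\<And>e. e \<in> simplices ?F 0 \<Longrightarrow> pi_finite ?F e"
    using F by (auto simp: finite_groupoid_def locally_finite_iff)
  have F0: "e \<in> simplices ?F 0 \<longleftrightarrow> e \<in> simplices E 0 \<and> q 0 e = b" for e
    using kan_sset[OF B] b by (auto simp: simplices_strict_fibre)
  have pE: "pi_finite E e" if "e \<in> simplices ?F 0" for e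
    using pointed_fibration.pi_finite_total[OF pointed_fibration.intro, OF q B, of e] pF[OF that] that fb F0 by auto
  show "pi_finite E y" if y: "y \<in> simplices E 0" "(q 0 y, b) \<in> path_rel B" for y
  proof -
    obtain e where "e \<in> simplices E 0" "q 0 e = b" "(y, e) \<in> path_rel E" by (rule transport_to_fibre[OF q y])
    then show ?thesis using pE F0 weight_path(2)[OF E] by blast
  qed
  let ?g = "\<lambda>K. path_rel E `` {rep K}"
  note repF = pi0_rep[OF KF] and repE = pi0_rep[OF E]
  have image: "?g ` pi0 ?F = components_over E B q b"
  proof (intro equalityI subsetI)
    fix c assume "c \<in> ?g ` pi0 ?F"
    then obtain K where K: "K \<in> pi0 ?F" "c = ?g K" by blast
    have r: "rep K \<in> simplices E 0" "q 0 (rep K) = b" using repF(2)[OF K(1)] F0 by auto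
    have c: "c \<in> pi0 E" using K(2) r(1) by (simp add: pi0_classI)
    have "rep K \<in> c" using K(2) equiv_class_self[OF eqE r(1)] by simp
    then have "(q 0 (rep c), b) \<in> path_rel B" using path_rel_map[OF qs repE(4)[OF c]] r(2) by metis
    then show "c \<in> components_over E B q b" using c by (simp add: components_over_def)
  next
    fix c assume "c \<in> components_over E B q b"
    then have c: "c \<in> pi0 E" "(q 0 (rep c), b) \<in> path_rel B" by (auto simp: components_over_def)
    obtain e where e: "e \<in> simplices E 0" "q 0 e = b" "(rep c, e) \<in> path_rel E"
      by (rule transport_to_fibre[OF q repE(2)[OF c(1)] c(2)])
    let ?K = "path_rel ?F `` {e}"
    have eF: "e \<in> simplices ?F 0" using e F0 by simp
    then have K: "?K \<in> pi0 ?F" by (rule pi0_classI)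
    have "(rep ?K, e) \<in> path_rel E"
      using path_rel_map[OF inc repF(4)[OF K]] equiv_class_self[OF eqF eF] by blast
    then have "?g ?K = c" using e(3) repE(3)[OF c(1)] eqE by (metis equiv_class_eq)
    then show "c \<in> ?g ` pi0 ?F" using K by blast
  qed
  then show "finite (components_over E B q b)" using finF by (metis finite_imageI)
  have fibre_sum: "(\<Sum>K\<in>{K\<in>pi0 ?F. ?g K = c}. weight ?F (rep K)) * weight B b = weight E (rep c)"
    if c: "c \<in> ?g ` pi0 ?F" for c
  proof -
    obtain K0 where K0: "K0 \<in> pi0 ?F" "?g K0 = c" using c by blast
    have cE: "c \<in> pi0 E" using c image by (auto simp: components_over_def)
    have orb: "orbit E B q (rep K) = {K\<in>pi0 ?F. ?g K = c}" if K: "K \<in> pi0 ?F" "?g K = c" for K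
    proof -
      have r: "rep K \<in> simplices E 0" "q 0 (rep K) = b" using repF(2)[OF K(1)] F0 by auto
      have "(\<exists>y\<in>L. (rep K, y) \<in> path_rel E) \<longleftrightarrow> ?g L = c" if L: "L \<in> pi0 ?F" for L
      proof
        assume "\<exists>y\<in>L. (rep K, y) \<in> path_rel E"
        then obtain y where y: "y \<in> L" "(rep K, y) \<in> path_rel E" by blast
        then have "(rep L, y) \<in> path_rel E" using path_rel_map[OF inc repF(4)[OF L]] by blast
        then show "?g L = c" using y K(2) eqE by (metis equiv_class_eq)
      next
        assume "?g L = c"
        moreover have "rep L \<in> ?g L" using repF(2)[OF L] F0 equiv_class_self[OF eqE] by blast
        ultimately have "(rep K, rep L) \<in> path_rel E" using K(2) by blast
        then show "\<exists>y\<in>L. (rep K, y) \<in> path_rel E" using repF(1)[OF L] by blast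
      qed
      then show ?thesis unfolding orbit_def r(2) by blast
    qed
    let ?N = "of_nat (card {K\<in>pi0 ?F. ?g K = c}) :: rat"
    have w: "weight ?F (rep K) * weight B b * ?N = weight E (rep c)" and N: "?N \<noteq> 0"
      if K: "K \<in> pi0 ?F" "?g K = c" for K
    proof -
      have r: "rep K \<in> simplices E 0" "q 0 (rep K) = b" using repF(2)[OF K(1)] F0 by auto
      have "(rep K, rep c) \<in> path_rel E" using K(2) repE(1)[OF cE] by blast
      then show "weight ?F (rep K) * weight B b * ?N = weight E (rep c)" "?N \<noteq> 0"
        using pointed_fibration.weight_fibration[OF pointed_fibration.intro, OF q B r(1)] pF[OF repF(2)[OF K(1)]] fb orb[OF K] weight_path(1)[OF E]
        unfolding r(2) by auto
    qed
    have "(\<Sum>K\<in>{K\<in>pi0 ?F. ?g K = c}. weight ?F (rep K)) * weight B b = (\<Sum>K\<in>{K\<in>pi0 ?F. ?g K = c}. weight ?F (rep K) * weight B b)"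
      by (simp add: sum_distrib_right)
    also have "\<dots> = (\<Sum>K\<in>{K\<in>pi0 ?F. ?g K = c}. weight E (rep c) / ?N)"
      by (rule sum.cong) (use w N in \<open>auto simp: field_simps\<close>)
    also have "\<dots> = weight E (rep c)" using N[OF K0] by simp
    finally show ?thesis .
  qed
  have "cardinality ?F * weight B b = (\<Sum>c\<in>?g ` pi0 ?F. \<Sum>K\<in>{K\<in>pi0 ?F. ?g K = c}. weight ?F (rep K)) * weight B b"
    unfolding cardinality_weight by (subst sum.image_gen[OF finF, of _ ?g]) simp
  also have "\<dots> = (\<Sum>c\<in>?g ` pi0 ?F. weight E (rep c))"
    unfolding sum_distrib_right[of _ "?g ` pi0 ?F"] by (rule sum.cong[OF refl fibre_sum])
  finally show "(\<Sum>c\<in>components_over E B q b. weight E (rep c)) = cardinality ?F * weight B b"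
    unfolding image by simp
qed

text \<open>
  Each component of \<open>E\<close> lies over exactly one component of \<open>B\<close>, so it suffices to add up
  \<open>fibration_over_component\<close>.
\<close>

theorem fibration_finite:
  assumes q: "left_fibration E B q" and B: "finite_groupoid B"
    and F: "\<And>b. b \<in> simplices B 0 \<Longrightarrow> finite_groupoid (strict_fibre E B q b)"
  shows "finite_groupoid E"
    and "cardinality E = (\<Sum>d\<in>pi0 B. cardinality (strict_fibre E B q (rep d)) * weight B (rep d))"
proof -
  have KB: "kan_complex B" and finB: "finite (pi0 B)" and pB: "\<And>b. b \<in> simplices B 0 \<Longrightarrow> pi_finite B b"
    using B by (auto simp: finite_groupoid_def locally_finite_iff)
  have qs: "simplicial_map E B q" using q by (simp add: left_fibration_iff)
  note E = left_fibration_kan[OF q KB] and eqB = path_rel_equiv[OF KB]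
  note repE = pi0_rep[OF E] and repB = pi0_rep[OF KB]
  have U: "pi0 E = (\<Union>d\<in>pi0 B. components_over E B q (rep d))"
  proof (intro equalityI subsetI)
    fix c assume c: "c \<in> pi0 E"
    have r: "q 0 (rep c) \<in> simplices B 0" using repE(2)[OF c] qs by blast
    let ?d = "path_rel B `` {q 0 (rep c)}"
    have d: "?d \<in> pi0 B" using r by (rule pi0_classI)
    have "(q 0 (rep c), rep ?d) \<in> path_rel B" using repB(1)[OF d] by simp
    then show "c \<in> (\<Union>d\<in>pi0 B. components_over E B q (rep d))" using c d by (auto simp: components_over_def)
  qed (auto simp: components_over_def)
  have fin: "finite (components_over E B q (rep d))" if "d \<in> pi0 B" for d
    using fibration_over_component(1)[OF q KB repB(2)[OF that] pB F] repB(2)[OF that] by blast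
  have disj: "components_over E B q (rep d) \<inter> components_over E B q (rep d') = {}"
    if d: "d \<in> pi0 B" "d' \<in> pi0 B" "d \<noteq> d'" for d d'
  proof (rule ccontr)
    assume "\<not> ?thesis"
    then obtain c where "(q 0 (rep c), rep d) \<in> path_rel B" "(q 0 (rep c), rep d') \<in> path_rel B"
      by (auto simp: components_over_def)
    then have "path_rel B `` {rep d} = path_rel B `` {rep d'}" using eqB by (metis equiv_class_eq)
    then show False using repB(3) d by metis
  qed
  have "pi_finite E y" if y: "y \<in> simplices E 0" for y
  proof -
    have "q 0 y \<in> simplices B 0" using qs y by blast
    then show ?thesis using fibration_over_component(3)[OF q KB _ pB F y] equiv_class_self[OF eqB] by blast
  qed
  then show "finite_groupoid E" using E U fin finB by (auto simp: finite_groupoid_def locally_finite_iff)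
  have "cardinality E = (\<Sum>d\<in>pi0 B. \<Sum>c\<in>components_over E B q (rep d). weight E (rep c))"
    unfolding cardinality_weight U by (rule sum.UNION_disjoint) (use finB fin disj in auto)
  also have "\<dots> = (\<Sum>d\<in>pi0 B. cardinality (strict_fibre E B q (rep d)) * weight B (rep d))"
    by (rule sum.cong[OF refl]) (use fibration_over_component(2)[OF q KB repB(2) pB F] repB(2) in blast)
  finally show "cardinality E = (\<Sum>d\<in>pi0 B. cardinality (strict_fibre E B q (rep d)) * weight B (rep d))" .
qed

section \<open>Invariance under isomorphism\<close>

lemma quotient_iso:
  assumes b: "bij_betw f A A'" and r: "r \<subseteq> A \<times> A" and r': "r' \<subseteq> A' \<times> A'"
    and rr: "\<And>x y. x \<in> A \<Longrightarrow> y \<in> A \<Longrightarrow> (f x, f y) \<in> r' \<longleftrightarrow> (x, y) \<in> r"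
  shows "bij_betw (image f) (A // r) (A' // r')"
proof -
  have inj: "inj_on f A" and im: "f ` A = A'" using b by (auto simp: bij_betw_def)
  have c: "f ` (r `` {x}) = r' `` {f x}" if "x \<in> A" for x
  proof (intro equalityI subsetI)
    fix z assume "z \<in> r' `` {f x}"
    then have z: "(f x, z) \<in> r'" by simp
    then obtain y where "y \<in> A" "z = f y" using r' im by blast
    then show "z \<in> f ` (r `` {x})" using z rr that by blast
  qed (use rr r that in blast)
  show ?thesis unfolding bij_betw_def
  proof
    show "inj_on (image f) (A // r)"
    proof (rule inj_on_subset[OF inj_on_image_Pow[OF inj]])
      show "A // r \<subseteq> Pow A" using r by (auto simp: quotient_def)
    qed
    show "image f ` (A // r) = A' // r'"
      using c im unfolding quotient_def by (auto 4 3 simp: image_iff)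
  qed
qed

lemma simplicial_iso_spheres:
  assumes i: "simplicial_iso X Y g" and x: "x \<in> simplices X 0" and s: "\<sigma> \<in> simplices X (Suc m)"
  shows "g (Suc m) \<sigma> \<in> spheres Y (Suc m) (g 0 x) \<longleftrightarrow> \<sigma> \<in> spheres X (Suc m) x"
proof -
  have g: "simplicial_map X Y g" and inj: "inj_on (g n) (simplices X n)" and SX: "simplicial_set X" for n
    using i by (auto simp: simplicial_iso_def bij_betw_def)
  have "g m (face X (Suc m) k \<sigma>) = g m (const_simplex X m x) \<longleftrightarrow> face X (Suc m) k \<sigma> = const_simplex X m x" if "k \<le> Suc m" for k
    using inj_on_eq_iff[OF inj[of m], of "face X (Suc m) k \<sigma>" "const_simplex X m x"] SX s x that by blast
  then show ?thesis
    using s simplicial_map_in[OF g s] simplicial_map_face[OF g s] simplicial_map_const[OF g x, of m] unfolding spheres_def by auto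
qed

lemma simplicial_iso_homotopy:
  assumes i: "simplicial_iso X Y g" and x: "x \<in> simplices X 0"
    and st: "\<sigma> \<in> spheres X (Suc m) x" "\<tau> \<in> spheres X (Suc m) x" "(\<sigma>, \<tau>) \<in> homotopy_rel X (Suc m) x"
  shows "(g (Suc m) \<sigma>, g (Suc m) \<tau>) \<in> homotopy_rel Y (Suc m) (g 0 x)"
proof -
  have g: "simplicial_map X Y g" using i by (auto simp: simplicial_iso_def bij_betw_def)
  obtain w where w: "w \<in> simplices X (Suc (Suc m))" "face X (Suc (Suc m)) (Suc m) w = \<sigma>" "face X (Suc (Suc m)) (Suc (Suc m)) w = \<tau>"
    "\<forall>i<Suc m. face X (Suc (Suc m)) i w = const_simplex X (Suc m) x"
    using st(3) unfolding homotopy_rel_def by blast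
  have "\<sigma> \<in> simplices X (Suc m)" "\<tau> \<in> simplices X (Suc m)" using st by (auto simp: spheres_def)
  then have "g (Suc m) \<sigma> \<in> spheres Y (Suc m) (g 0 x)" "g (Suc m) \<tau> \<in> spheres Y (Suc m) (g 0 x)"
    using simplicial_iso_spheres[OF i x] st by auto
  moreover have "face Y (Suc (Suc m)) i (g (Suc (Suc m)) w) = const_simplex Y (Suc m) (g 0 x)" if "i < Suc m" for i
    using w(4) that simplicial_map_face[OF g w(1), of i] simplicial_map_const[OF g x, of "Suc m"] by simp
  ultimately show ?thesis unfolding homotopy_rel_def
    using w simplicial_map_in[OF g w(1)] simplicial_map_face[OF g w(1)]
    by (auto intro!: bexI[of _ "g (Suc (Suc m)) w"])
qed

lemma simplicial_iso_homotopy_group: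
  assumes i: "simplicial_iso X Y g" and x: "x \<in> simplices X 0"
  shows "\<exists>f. bij_betw f (homotopy_group X (Suc m) x) (homotopy_group Y (Suc m) (g 0 x))"
proof -
  obtain g' where i': "simplicial_iso Y X g'" and gg: "\<And>n x. x \<in> simplices X n \<Longrightarrow> g' n (g n x) = x"
    "\<And>n y. y \<in> simplices Y n \<Longrightarrow> g n (g' n y) = y" using simplicial_iso_inverse[OF i] by metis
  have g: "simplicial_map X Y g" and g': "simplicial_map Y X g'" using i i' by (auto simp: simplicial_iso_def)
  have y: "g 0 x \<in> simplices Y 0" using g x by blast
  have sub: "spheres X (Suc m) x \<subseteq> simplices X (Suc m)" "spheres Y (Suc m) (g 0 x) \<subseteq> simplices Y (Suc m)"
    by (auto simp: spheres_def)
  have s': "g' (Suc m) \<tau> \<in> spheres X (Suc m) x" if "\<tau> \<in> spheres Y (Suc m) (g 0 x)" for \<tau>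
    using simplicial_iso_spheres[OF i x, of "g' (Suc m) \<tau>" m] that gg(2) sub simplicial_map_in[OF g'] by auto
  have "bij_betw (g (Suc m)) (spheres X (Suc m) x) (spheres Y (Suc m) (g 0 x))"
    by (rule bij_betwI[of _ _ _ "g' (Suc m)"]) (use simplicial_iso_spheres[OF i x] s' gg sub in auto)
  moreover have "(g (Suc m) \<sigma>, g (Suc m) \<tau>) \<in> homotopy_rel Y (Suc m) (g 0 x) \<longleftrightarrow> (\<sigma>, \<tau>) \<in> homotopy_rel X (Suc m) x"
    if st: "\<sigma> \<in> spheres X (Suc m) x" "\<tau> \<in> spheres X (Suc m) x" for \<sigma> \<tau>
  proof
    assume a: "(g (Suc m) \<sigma>, g (Suc m) \<tau>) \<in> homotopy_rel Y (Suc m) (g 0 x)"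
    then have "g (Suc m) \<sigma> \<in> spheres Y (Suc m) (g 0 x)" "g (Suc m) \<tau> \<in> spheres Y (Suc m) (g 0 x)" by (auto simp: homotopy_rel_def)
    then show "(\<sigma>, \<tau>) \<in> homotopy_rel X (Suc m) x"
      using simplicial_iso_homotopy[OF i' y _ _ a] gg(1) st sub(1) x by (metis subsetD)
  qed (rule simplicial_iso_homotopy[OF i x st])
  moreover have "homotopy_rel X (Suc m) x \<subseteq> spheres X (Suc m) x \<times> spheres X (Suc m) x"
    "homotopy_rel Y (Suc m) (g 0 x) \<subseteq> spheres Y (Suc m) (g 0 x) \<times> spheres Y (Suc m) (g 0 x)"
    unfolding homotopy_rel_def by blast+
  ultimately have "bij_betw (image (g (Suc m))) (homotopy_group X (Suc m) x) (homotopy_group Y (Suc m) (g 0 x))"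
    unfolding homotopy_group_def by (intro quotient_iso)
  then show ?thesis by blast
qed

lemma simplicial_iso_pi_finite:
  assumes "simplicial_iso X Y g" and "x \<in> simplices X 0"
  shows "weight X x = weight Y (g 0 x)" "pi_finite X x \<longleftrightarrow> pi_finite Y (g 0 x)"
  using weight_cong[OF simplicial_iso_homotopy_group[OF assms]] by auto

lemma simplicial_iso_finite_groupoid:
  assumes i: "simplicial_iso X Y g" and X: "finite_groupoid X"
  shows "finite_groupoid Y" "cardinality Y = cardinality X"
proof -
  have KX: "kan_complex X" and pX: "\<And>x. x \<in> simplices X 0 \<Longrightarrow> pi_finite X x" and fX: "finite (pi0 X)"
    using X by (auto simp: finite_groupoid_def locally_finite_iff)
  note KY = simplicial_iso_kan[OF i KX]
  obtain g' where i': "simplicial_iso Y X g'" and gg: "\<And>n x. x \<in> simplices X n \<Longrightarrow> g' n (g n x) = x"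
    "\<And>n y. y \<in> simplices Y n \<Longrightarrow> g n (g' n y) = y" using simplicial_iso_inverse[OF i] by metis
  have g: "simplicial_map X Y g" and g': "simplicial_map Y X g'" and b: "bij_betw (g 0) (simplices X 0) (simplices Y 0)"
    using i i' by (auto simp: simplicial_iso_def)
  have bij: "bij_betw (image (g 0)) (pi0 X) (pi0 Y)" unfolding pi0_def
  proof (rule quotient_iso[OF b equiv_type[OF path_rel_equiv[OF KX]] equiv_type[OF path_rel_equiv[OF KY]]])
    fix x y assume "x \<in> simplices X 0" "y \<in> simplices X 0"
    then show "(g 0 x, g 0 y) \<in> path_rel Y \<longleftrightarrow> (x, y) \<in> path_rel X"
      using path_rel_map[OF g] path_rel_map[OF g', of "g 0 x" "g 0 y"] gg(1) by metis
  qed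
  have "pi_finite Y y" if "y \<in> simplices Y 0" for y
    using simplicial_iso_pi_finite(2)[OF i, of "g' 0 y"] gg(2)[OF that] pX simplicial_map_in[OF g' that] by simp
  then show "finite_groupoid Y"
    using KY fX bij_betw_finite[OF bij] by (simp add: finite_groupoid_def locally_finite_iff)
  have "weight Y (rep (g 0 ` c)) = weight X (rep c)" if c: "c \<in> pi0 X" for c
  proof -
    have gc: "g 0 ` c \<in> pi0 Y" using bij c by (auto simp: bij_betw_def)
    have "g 0 (rep c) \<in> g 0 ` c" using pi0_rep(1)[OF KX c] by blast
    then have "(rep (g 0 ` c), g 0 (rep c)) \<in> path_rel Y" by (rule pi0_rep(4)[OF KY gc])
    then show ?thesis using weight_path(1)[OF KY] simplicial_iso_pi_finite(1)[OF i pi0_rep(2)[OF KX c]] by metis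
  qed
  then show "cardinality Y = cardinality X"
    unfolding cardinality_weight using sum.reindex_bij_betw[OF bij, of "\<lambda>c. weight Y (rep c)"] by simp
qed

section \<open>Contractibility of the slice\<close>

text \<open>
  In \<open>X\<close>, the prescribed boundary of a homotopy in the slice is only a horn: nothing is prescribed on the
  face \<open>0\<close>, opposite to the cone point.
\<close>

lemma slice_spheres_homotopic:
  assumes X: "kan_complex X" and s: "\<sigma> \<in> spheres (slice X x) (Suc m) y" "\<tau> \<in> spheres (slice X x) (Suc m) y"
    and y: "y \<in> simplices (slice X x) 0"
  shows "(\<sigma>, \<tau>) \<in> homotopy_rel (slice X x) (Suc m) y"
proof -
  note S = kan_sset[OF X] note SS = simplicial_set_slice[OF S, of x]
  let ?P = "slice X x"
  let ?c = "const_simplex ?P (Suc m) y"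
  define h where "h j = (if j = Suc (Suc m) then \<sigma> else if j = Suc (Suc (Suc m)) then \<tau> else ?c)" for j
  have "?c \<in> spheres ?P (Suc m) y" using face_const[OF SS y] const_simplex_in[OF SS y] by (auto simp: spheres_def)
  then have h: "h j \<in> spheres ?P (Suc m) y" for j using s by (simp add: h_def)
  have hX: "h j \<in> simplices X (Suc (Suc m))" and hv: "act X (Suc (Suc m)) [0] (h j) = x"
    and hf: "\<And>i. i \<le> Suc m \<Longrightarrow> face X (Suc (Suc m)) (Suc i) (h j) = const_simplex ?P m y" for j
    using h[of j] by (auto simp: spheres_def simplices_slice face_slice)
  have "horn X (Suc (Suc (Suc m))) 0 h"
    unfolding horn_def
  proof (intro conjI allI impI)
    fix i j assume a: "i < j \<and> j \<le> Suc (Suc (Suc m)) \<and> i \<noteq> 0 \<and> j \<noteq> 0"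
    then obtain i' j' where "i = Suc i'" "j = Suc (Suc j')" by (metis not0_implies_Suc less_Suc_eq_0_disj less_imp_Suc_add)
    then show "face X (Suc (Suc (Suc m)) - 1) i (h j) = face X (Suc (Suc (Suc m)) - 1) (j - 1) (h i)"
      using a hf by auto
  qed (use hX in simp)
  moreover have "fills X (Suc (Suc (Suc m))) 0" using X by (simp add: kan_complex_iff)
  ultimately obtain w where w: "w \<in> simplices X (Suc (Suc (Suc m)))"
    "\<forall>i\<le>Suc (Suc (Suc m)). i \<noteq> 0 \<longrightarrow> face X (Suc (Suc (Suc m))) i w = h i" unfolding fills_def by blast
  have "act X (Suc (Suc (Suc m))) [0] w = x"
    using vertex_face[OF S w(1), of "Suc 0" 0] w(2) hv by simp
  then have "w \<in> simplices ?P (Suc (Suc m))" using w(1) by (simp add: simplices_slice)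
  then show ?thesis unfolding homotopy_rel_def using s w(2)
    by (auto simp: face_slice h_def intro!: bexI[of _ w])
qed

lemma slice_connected:
  assumes X: "kan_complex X" and y: "y \<in> simplices (slice X x) 0" "z \<in> simplices (slice X x) 0"
  shows "(y, z) \<in> path_rel (slice X x)"
proof -
  note S = kan_sset[OF X]
  have yz: "y \<in> edges X" "z \<in> edges X" "src X y = src X z"
    using y by (auto simp: simplices_slice edge_ends[OF S])
  obtain b where "tri X y b z" using fill_2(1)[OF kan_fills[OF X le0] yz] by blast
  then obtain t where t: "t \<in> simplices X (Suc (Suc 0))" "face2 X (Suc (Suc 0)) t = y"
     "face2 X (Suc 0) t = z" unfolding tri_def by blast
  have "act X (Suc (Suc 0)) [0] t = x" using vertex_face[OF S t(1), of "Suc 0" 0] t(3) y by (simp add: simplices_slice)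
  then show ?thesis using t by (intro path_relI[of t]) (auto simp: simplices_slice face_slice)
qed

lemma unit_in_slice:
  assumes "simplicial_set X" "x \<in> simplices X 0" shows "unit_edge X x \<in> simplices (slice X x) 0"
  using unit_in_loop_space[OF assms] by (simp add: simplices_loop_space simplices_slice)

lemma slice_kan: "kan_complex X \<Longrightarrow> kan_complex (slice X x)"
  using left_fibration_kan[OF left_fibration_slice_proj[OF kan_left_fillable]] .

lemma slice_contractible:
  assumes X: "kan_complex X" and y: "y \<in> simplices (slice X x) 0"
  shows "pi_finite (slice X x) y" "weight (slice X x) y = 1" "pi0 (slice X x) = {simplices (slice X x) 0}"
proof -
  note K = slice_kan[OF X, of x]
  have c: "card (homotopy_group (slice X x) (Suc m) y) = 1" for m
  proof -
    let ?A = "spheres (slice X x) (Suc m) y" and ?r = "homotopy_rel (slice X x) (Suc m) y"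
    have "?r = ?A \<times> ?A" using slice_spheres_homotopic[OF X _ _ y] by (auto simp: homotopy_rel_def)
    moreover have "?A \<noteq> {}" using homotopy_group_nonempty[OF kan_sset[OF K] y] by (auto simp: homotopy_group_def)
    ultimately have "?A // ?r = {?A}" by (auto simp: quotient_def)
    then show ?thesis by (simp add: homotopy_group_def)
  qed
  then have c': "card (homotopy_group (slice X x) i y) = 1" if "0 < i" for i using that gr0_implies_Suc by blast
  show "pi_finite (slice X x) y" unfolding pi_finite_card[OF kan_sset[OF K] y] using c c' by auto
  have e: "{i. 0 < i \<and> card (homotopy_group (slice X x) i y) \<noteq> 1} = {}" using c' by blast
  show "weight (slice X x) y = 1" unfolding weight_def alternating_product_def e by simp
  have "path_rel (slice X x) = simplices (slice X x) 0 \<times> simplices (slice X x) 0"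
    using slice_connected[OF X] equiv_type[OF path_rel_equiv[OF K]] by blast
  then show "pi0 (slice X x) = {simplices (slice X x) 0}" using y by (auto simp: pi0_def quotient_def)
qed

lemma weight_nonzero:
  assumes X: "simplicial_set X" "x \<in> simplices X 0" and f: "pi_finite X x"
  shows "weight X x \<noteq> 0"
proof -
  have "card (homotopy_group X i x) \<noteq> 0" if "0 < i" for i
    using f that gr0_implies_Suc unfolding pi_finite_card[OF X] by blast
  then show ?thesis unfolding weight_def alternating_product_def
    by (cases "finite {i. 0 < i \<and> card (homotopy_group X i x) \<noteq> 1}") (auto, metis less_numeral_extra(3))
qed

definition path_space :: "'a simplicial \<Rightarrow> 'a \<Rightarrow> 'a \<Rightarrow> 'a simplicial" where
  "path_space X x t = strict_fibre (slice X x) X (slice_proj X) t"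

text \<open>
  The slice under \<open>x\<close> is contractible and fibred over \<open>X\<close>, with the path space as fibre at \<open>t\<close>. For \<open>t\<close> in
  the component of \<open>x\<close> this gives \<open>1 = cardinality (path_space X x t) * weight X t\<close>; for other \<open>t\<close> the
  fibre is empty.
\<close>

lemma path_space_cardinality:
  assumes X: "locally_finite_groupoid X" and x: "x \<in> simplices X 0" and t: "t \<in> simplices X 0"
  shows "finite_groupoid (path_space X x t)"
    and "cardinality (path_space X x t) = (if (x, t) \<in> path_rel X then inverse (weight X t) else 0)"
proof -
  have K: "kan_complex X" and pX: "\<And>x. x \<in> simplices X 0 \<Longrightarrow> pi_finite X x" using X by (auto simp: locally_finite_iff)
  note S = kan_sset[OF K]
  let ?P = "slice X x" and ?F = "path_space X x t"
  note q = left_fibration_slice_proj[OF kan_left_fillable[OF K], of x]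
  note KP = slice_kan[OF K, of x]
  have KF: "kan_complex ?F" unfolding path_space_def by (rule strict_fibre_kan[OF q K t])
  have F0: "g \<in> simplices ?F 0 \<longleftrightarrow> g \<in> simplices ?P 0 \<and> slice_proj X 0 g = t" for g
    using S t by (auto simp: path_space_def simplices_strict_fibre)
  have tgt: "(x, slice_proj X 0 g) \<in> path_rel X" if "g \<in> simplices ?P 0" for g
    using that by (intro path_relI[of g]) (auto simp: simplices_slice slice_proj_def edge_ends[OF S])
  have pF: "pi_finite ?F g" if "g \<in> simplices ?F 0" for g
    using pointed_fibration.pi_finite_fibre[OF pointed_fibration.intro, OF q K, of g] that slice_contractible(1)[OF K] pX[OF t] unfolding path_space_def[symmetric] F0 by auto
  have "finite (pi0 ?F)"
  proof (cases "simplices ?F 0 = {}")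
    case False
    then obtain g where g: "g \<in> simplices ?F 0" by blast
    then have g': "g \<in> simplices ?P 0" "slice_proj X 0 g = t" by (auto simp: F0)
    have "\<exists>y\<in>L. (g, y) \<in> path_rel ?P" if "L \<in> pi0 ?F" for L
      using pi0_rep(1,2)[OF KF that] slice_connected[OF K g'(1)] F0 by blast
    then have "orbit ?P X (slice_proj X) g = pi0 ?F" unfolding orbit_def g'(2) path_space_def[symmetric] by blast
    moreover have "card (orbit ?P X (slice_proj X) g) \<noteq> 0"
      by (rule pointed_fibration.weight_fibration(2)[OF pointed_fibration.intro, OF q K g'(1)]) (use g' pX t pF[OF g] in \<open>simp_all add: path_space_def\<close>)
    ultimately show ?thesis by (metis card.infinite)
  qed (simp add: pi0_def)
  then show fin: "finite_groupoid ?F" using KF pF by (simp add: finite_groupoid_def locally_finite_iff)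
  show "cardinality ?F = (if (x, t) \<in> path_rel X then inverse (weight X t) else 0)"
  proof (cases "(x, t) \<in> path_rel X")
    case True
    have u: "unit_edge X x \<in> simplices ?P 0" by (rule unit_in_slice[OF S x])
    note p0 = slice_contractible(3)[OF K u]
    have "(slice_proj X 0 (rep c), t) \<in> path_rel X" if "c \<in> pi0 ?P" for c
      using tgt[OF pi0_rep(2)[OF KP that]] True path_rel_equiv[OF K] by (meson equiv_def symD transD)
    then have c: "components_over ?P X (slice_proj X) t = {simplices ?P 0}" unfolding components_over_def using p0 by auto
    have r: "rep (simplices ?P 0) \<in> simplices ?P 0" using pi0_rep(2)[OF KP] p0 by blast
    have "(\<Sum>c\<in>{simplices ?P 0}. weight ?P (rep c)) = cardinality ?F * weight X t"
      unfolding c[symmetric] path_space_def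
      by (rule fibration_over_component(2)[OF q K t pX[OF t] fin[unfolded path_space_def]])
    moreover have s1: "(\<Sum>c\<in>{C}. w c) = w C" for C and w :: "'a set \<Rightarrow> rat" by simp
    ultimately have "weight ?P (rep (simplices ?P 0)) = cardinality ?F * weight X t" unfolding s1 by blast
    then have "1 = cardinality ?F * weight X t" unfolding slice_contractible(2)[OF K r] .
    then show ?thesis using True weight_nonzero[OF S t pX[OF t]] by (simp add: field_simps)
  next
    case False
    then have "g \<notin> simplices ?F 0" for g using tgt[of g] by (auto simp: F0)
    then have "simplices ?F 0 = {}" by blast
    then have "pi0 ?F = {}" by (simp add: pi0_def)
    then show ?thesis using False by (simp add: cardinality_weight)
  qed
qed

section \<open>Homotopy fibres\<close>

lemma pullback_fibre_iso:
  assumes X: "simplicial_set X" and Y: "left_fibration Y Z q" and p: "simplicial_map X Z p" and a: "a \<in> simplices X 0"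
  shows "simplicial_iso (strict_fibre Y Z q (p 0 a)) (strict_fibre (pullback X Y p q) X (\<lambda>_. fst) a)
    (\<lambda>n y. (const_simplex X n a, y))"
proof -
  have SY: "simplicial_set Y" "simplicial_set Z" "simplicial_map Y Z q" using Y by (auto simp: left_fibration_iff)
  have pa: "p 0 a \<in> simplices Z 0" using p a by blast
  note c = simplicial_map_const[OF p a]
  have "simplicial_set (strict_fibre Y Z q (p 0 a))" by (rule simplicial_set_strict_fibre[OF SY pa])
  moreover have "simplicial_set (strict_fibre (pullback X Y p q) X (\<lambda>_. fst) a)"
    by (rule simplicial_set_strict_fibre[OF simplicial_set_pullback[OF X SY(1) p SY(3)] X simplicial_map_pullback(1) a])
  moreover have "simplicial_map (strict_fibre Y Z q (p 0 a)) (strict_fibre (pullback X Y p q) X (\<lambda>_. fst) a)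
    (\<lambda>n y. (const_simplex X n a, y))"
    using c X a by (auto simp: simplicial_map_def simplices_strict_fibre simplices_pullback act_const)
  moreover have "bij_betw (\<lambda>y. (const_simplex X n a, y)) (simplices (strict_fibre Y Z q (p 0 a)) n)
      (simplices (strict_fibre (pullback X Y p q) X (\<lambda>_. fst) a) n)" for n
    by (rule bij_betwI[of _ _ _ snd]) (use c X a in \<open>auto simp: simplices_strict_fibre simplices_pullback\<close>)
  ultimately show ?thesis by (simp add: simplicial_iso_def)
qed

lemma pullback_cardinality:
  assumes X: "finite_groupoid X" and Y: "left_fibration Y Z q" and p: "simplicial_map X Z p"
    and F: "\<And>a. a \<in> simplices X 0 \<Longrightarrow> finite_groupoid (strict_fibre Y Z q (p 0 a))"
  shows "finite_groupoid (pullback X Y p q)"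
    and "cardinality (pullback X Y p q) = (\<Sum>d\<in>pi0 X. cardinality (strict_fibre Y Z q (p 0 (rep d))) * weight X (rep d))"
proof -
  have K: "kan_complex X" using X by (simp add: finite_groupoid_def locally_finite_iff)
  note S = kan_sset[OF K]
  note l = left_fibration_pullback[OF Y S p]
  have F': "finite_groupoid (strict_fibre (pullback X Y p q) X (\<lambda>_. fst) a)"
    "cardinality (strict_fibre (pullback X Y p q) X (\<lambda>_. fst) a) = cardinality (strict_fibre Y Z q (p 0 a))"
    if "a \<in> simplices X 0" for a
    using simplicial_iso_finite_groupoid[OF pullback_fibre_iso[OF S Y p that] F[OF that]] by auto
  show "finite_groupoid (pullback X Y p q)" by (rule fibration_finite(1)[OF l X F'(1)])
  show "cardinality (pullback X Y p q) = (\<Sum>d\<in>pi0 X. cardinality (strict_fibre Y Z q (p 0 (rep d))) * weight X (rep d))"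
    by (subst fibration_finite(2)[OF l X]) (simp_all add: F' pi0_rep(2)[OF K])
qed

text \<open>
  The homotopy fibre at \<open>s\<close> is fibred over \<open>\<alpha>\<close>, and its fibre at \<open>a\<close> is the space of paths from \<open>s\<close> to
  \<open>p a\<close>. The factor \<open>weight S s\<close> cancels the cardinality of the path spaces that are not empty.
\<close>

theorem homotopy_fibre_cardinality:
  assumes S: "locally_finite_groupoid S" and \<alpha>: "finite_groupoid \<alpha>" and p: "simplicial_map \<alpha> S p" and s: "s \<in> simplices S 0"
  shows "cardinality (homotopy_fibre S \<alpha> p s) * weight S s =
    (\<Sum>d\<in>{d\<in>pi0 \<alpha>. (s, p 0 (rep d)) \<in> path_rel S}. weight \<alpha> (rep d))"
proof -
  have K: "kan_complex S" and pS: "\<And>x. x \<in> simplices S 0 \<Longrightarrow> pi_finite S x" using S by (auto simp: locally_finite_iff)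
  have Ka: "kan_complex \<alpha>" and fa: "finite (pi0 \<alpha>)" using \<alpha> by (auto simp: finite_groupoid_def locally_finite_iff)
  note q = left_fibration_slice_proj[OF kan_left_fillable[OF K], of s]
  have pr: "p 0 (rep d) \<in> simplices S 0" if "d \<in> pi0 \<alpha>" for d using pi0_rep(2)[OF Ka that] p by blast
  have F: "finite_groupoid (strict_fibre (slice S s) S (slice_proj S) (p 0 a))" if "a \<in> simplices \<alpha> 0" for a
    using path_space_cardinality(1)[OF S s, of "p 0 a"] p that unfolding path_space_def by blast
  have "cardinality (homotopy_fibre S \<alpha> p s) * weight S s =
     (\<Sum>d\<in>pi0 \<alpha>. cardinality (path_space S s (p 0 (rep d))) * weight \<alpha> (rep d) * weight S s)"
    unfolding homotopy_fibre_def path_space_def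
    by (subst pullback_cardinality(2)[OF \<alpha> q p]) (simp_all add: F sum_distrib_right)
  also have "\<dots> = (\<Sum>d\<in>pi0 \<alpha>. if (s, p 0 (rep d)) \<in> path_rel S then weight \<alpha> (rep d) else 0)"
  proof (rule sum.cong[OF refl])
    fix d assume d: "d \<in> pi0 \<alpha>"
    have "weight S (p 0 (rep d)) = weight S s" if "(s, p 0 (rep d)) \<in> path_rel S"
      using weight_path(1)[OF K that] by simp
    then show "cardinality (path_space S s (p 0 (rep d))) * weight \<alpha> (rep d) * weight S s =
      (if (s, p 0 (rep d)) \<in> path_rel S then weight \<alpha> (rep d) else 0)"
      using path_space_cardinality(2)[OF S s pr[OF d]] weight_nonzero[OF kan_sset[OF K] s pS[OF s]] by simp
  qed
  also have "\<dots> = (\<Sum>d\<in>{d\<in>pi0 \<alpha>. (s, p 0 (rep d)) \<in> path_rel S}. weight \<alpha> (rep d))"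
    using fa by (simp add: sum.inter_filter)
  finally show ?thesis .
qed

section \<open>Connected components\<close>

lemma vertices_connected:
  assumes X: "simplicial_set X" and s: "\<sigma> \<in> simplices X n" and i: "i \<le> n"
  shows "(act X n [0] \<sigma>, act X n [i] \<sigma>) \<in> path_rel X"
proof -
  have m: "[0, i] \<in> mono_maps (Suc 0) n" using i by (auto simp: mono_maps_def)
  show ?thesis
    by (rule path_relI[of "act X n [0, i] \<sigma>"])
      (use X s m in \<open>auto simp: face_act[OF X s m] mono_comp_def coface_1\<close>)
qed

text \<open>
  One vertex decides. So spheres at a vertex of the component, and homotopies between them, belong to
  the component, and its homotopy groups are those of \<open>X\<close>.
\<close>

lemma simplices_component:
  assumes X: "kan_complex X"
  shows "simplices (component X x) n = {\<sigma> \<in> simplices X n. (x, act X n [0] \<sigma>) \<in> path_rel X}"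
proof -
  have "trans (path_rel X)" using path_rel_equiv[OF X] by (simp add: equiv_def)
  then have "(x, act X n [i] \<sigma>) \<in> path_rel X"
    if "\<sigma> \<in> simplices X n" "(x, act X n [0] \<sigma>) \<in> path_rel X" "i \<le> n" for \<sigma> i
    using vertices_connected[OF kan_sset[OF X] that(1,3)] that(2) by (meson transD)
  then show ?thesis unfolding component_def by auto
qed

lemma component_cardinality:
  assumes X: "kan_complex X" and x: "x \<in> simplices X 0"
  shows "cardinality (component X x) = weight X x"
proof -
  note S = kan_sset[OF X] and eq = path_rel_equiv[OF X] and sC = simplices_component[OF X]
  let ?C = "component X x" and ?c = "path_rel X `` {x}"
  have fC: "face ?C = face X" and cC: "const_simplex ?C = const_simplex X"
    by (simp_all add: component_def face_def const_simplex_def fun_eq_iff)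
  have v: "v \<in> simplices X 0" "(x, v) \<in> path_rel X" if "v \<in> ?c" for v using that equiv_type[OF eq] by auto
  have C0: "simplices ?C 0 = ?c" using S equiv_type[OF eq] by (auto simp: sC)
  have "(y, z) \<in> path_rel ?C" if "y \<in> ?c" "z \<in> ?c" for y z
  proof -
    have "(y, z) \<in> path_rel X" using that eq by (meson Image_singleton_iff equiv_def symD transD)
    then obtain e where "e \<in> edges X" "src X e = y" "tgt X e = z" by (rule path_relE)
    then show ?thesis using v(2)[OF that(1)]
      by (intro path_relI[of e]) (auto simp: sC fC edge_ends[OF S])
  qed
  then have "path_rel ?C `` {y} = ?c" if "y \<in> ?c" for y
  proof -
    have "z \<in> ?c" if "(y, z) \<in> path_rel ?C" for z
    proof -
      from that obtain e where "e \<in> simplices ?C (Suc 0)" "src X e = y" "tgt X e = z" unfolding fC[symmetric] by (rule path_relE)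
      then have "(y, z) \<in> path_rel X" by (auto simp: sC intro: path_relI)
      then show ?thesis using \<open>y \<in> ?c\<close> eq by (auto simp: equiv_def dest: transD)
    qed
    then show ?thesis using \<open>\<And>y z. y \<in> ?c \<Longrightarrow> z \<in> ?c \<Longrightarrow> (y, z) \<in> path_rel ?C\<close> that by blast
  qed
  moreover have xc: "x \<in> ?c" using equiv_class_self[OF eq x] .
  ultimately have p0: "pi0 ?C = {?c}" unfolding pi0_def C0 quotient_def by blast
  have sp: "spheres ?C (Suc m) w = spheres X (Suc m) w" if w: "w \<in> ?c" for m w
  proof -
    have "act X (Suc m) [0] \<sigma> = w" if "\<sigma> \<in> spheres X (Suc m) w" for \<sigma>
      using that vertex_of_sphere[OF S v(1)[OF w], of \<sigma> m "Suc m"] by (auto simp: spheres_def)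
    then show ?thesis using v(2)[OF w] unfolding spheres_def sC fC cC by auto
  qed
  have hr: "homotopy_rel ?C (Suc m) w = homotopy_rel X (Suc m) w" if w: "w \<in> ?c" for m w
  proof -
    have "act X (Suc (Suc m)) [0] \<omega> = w"
      if o: "\<omega> \<in> simplices X (Suc (Suc m))" "face X (Suc (Suc m)) (Suc (Suc m)) \<omega> \<in> spheres X (Suc m) w" for \<omega>
      using vertex_face[OF S o(1), of "Suc (Suc m)" 0] vertex_of_sphere[OF S v(1)[OF w], of _ m "Suc m"] o(2)
      by (auto simp: spheres_def)
    then show ?thesis using v(2)[OF w] unfolding homotopy_rel_def sp[OF w] fC cC by (auto simp: sC)
  qed
  have r: "rep ?c \<in> ?c" using xc by (intro rep_in) blast
  have "homotopy_group ?C (Suc m) (rep ?c) = homotopy_group X (Suc m) (rep ?c)" for m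
    by (simp add: homotopy_group_def sp[OF r] hr[OF r])
  then have "weight ?C (rep ?c) = weight X (rep ?c)" by (intro weight_cong(1)) (metis bij_betw_id)
  then show ?thesis using weight_path(1)[OF X v(2)[OF r]] unfolding cardinality_weight p0 by simp
qed

section \<open>The Grothendieck construction\<close>

locale finite_family =
  fixes E :: "'e family" and n :: nat
  assumes E: "E \<in> simplices finite_groupoids n"
begin

lemma fam: "E = family_on n (fib E) (restr E)"
  and lf: "left_fibration (total_space n E) (standard_simplex n) (\<lambda>_. fst)"
  and fin: "i \<le> n \<Longrightarrow> finite_groupoid (fibre E i)"
  using E by (auto simp: finite_groupoids_def)

lemma total_sset: "simplicial_set (total_space n E)" using lf by (simp add: left_fibration_iff)

lemma restr_in:
  assumes "\<phi> \<in> mono_maps m n" "e \<in> fib E \<phi>" "\<psi> \<in> mono_maps k m"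
  shows "restr E \<phi> \<psi> e \<in> fib E (mono_comp \<phi> \<psi>)"
  using sset_act_in[OF total_sset, of "(\<phi>, e)" m \<psi> k] assms by (auto simp: total_space_def)

lemma restr_id:
  assumes "\<phi> \<in> mono_maps m n" "e \<in> fib E \<phi>"
  shows "restr E \<phi> (mono_id m) e = e"
  using sset_act_id[OF total_sset, of "(\<phi>, e)" m] assms by (auto simp: total_space_def)

lemma restr_comp:
  assumes "\<phi> \<in> mono_maps m n" "e \<in> fib E \<phi>" "\<psi> \<in> mono_maps k m" "\<chi> \<in> mono_maps l k"
  shows "restr E \<phi> (mono_comp \<psi> \<chi>) e = restr E (mono_comp \<phi> \<psi>) \<chi> (restr E \<phi> \<psi> e)"
  using sset_act_act[OF total_sset, of "(\<phi>, e)" m \<psi> k \<chi> l] assms by (auto simp: total_space_def)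

end

lemma act_finite_groupoids:
  assumes "\<phi> \<in> mono_maps m n" "\<psi> \<in> mono_maps k m"
  shows "fib (act finite_groupoids n \<phi> E) \<psi> = fib E (mono_comp \<phi> \<psi>)"
    and "e \<in> fib E (mono_comp \<phi> \<psi>) \<Longrightarrow> \<chi> \<in> mono_maps l k \<Longrightarrow>
      restr (act finite_groupoids n \<phi> E) \<psi> \<chi> e = restr E (mono_comp \<phi> \<psi>) \<chi> e"
  using assms mono_maps_length[OF assms(1)] mono_maps_length[OF assms(2)]
  by (auto simp: finite_groupoids_def family_on_def Let_def)

locale finite_valued_functor =
  fixes S :: "'s simplicial" and f :: "nat \<Rightarrow> 's \<Rightarrow> 'e family"
  assumes S: "simplicial_set S" and f: "f \<in> finite_valued S"
begin

lemma fmap: "simplicial_map S finite_groupoids f" using f by (simp add: finite_valued_def)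

lemma family: "s \<in> simplices S n \<Longrightarrow> finite_family (f n s) n"
  by unfold_locales (rule simplicial_map_in[OF fmap])

lemma f_act: "s \<in> simplices S n \<Longrightarrow> \<phi> \<in> mono_maps m n \<Longrightarrow> f m (act S n \<phi> s) = act finite_groupoids n \<phi> (f n s)"
  by (rule simplicial_map_act[OF fmap])

lemma fib_act:
  assumes "s \<in> simplices S n" "\<phi> \<in> mono_maps m n"
  shows "fib (f m (act S n \<phi> s)) (mono_id m) = fib (f n s) \<phi>"
  using act_finite_groupoids(1)[OF assms(2) mono_id_in] mono_comp_id_right[OF assms(2)] f_act[OF assms] by simp

lemma restr_act:
  assumes "s \<in> simplices S n" "\<phi> \<in> mono_maps m n" "e \<in> fib (f n s) \<phi>" "\<chi> \<in> mono_maps l m"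
  shows "restr (f m (act S n \<phi> s)) (mono_id m) \<chi> e = restr (f n s) \<phi> \<chi> e"
  using act_finite_groupoids(2)[OF assms(2) mono_id_in _ assms(4), of e] mono_comp_id_right[OF assms(2)]
    f_act[OF assms(1,2)] assms(3) by simp

lemma simplices_groth: "simplices (grothendieck S f) n = {(s, e). s \<in> simplices S n \<and> e \<in> fib (f n s) (mono_id n)}"
  by (simp add: grothendieck_def)

lemma act_groth [simp]: "act (grothendieck S f) n \<psi> (s, e) = (act S n \<psi> s, restr (f n s) (mono_id n) \<psi> e)"
  by (simp add: grothendieck_def)

lemma simplicial_set_groth: "simplicial_set (grothendieck S f)"
  unfolding simplicial_set_def
proof (intro conjI allI impI)
  fix n m \<phi> z assume a: "\<phi> \<in> mono_maps m n \<and> z \<in> simplices (grothendieck S f) n"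
  then obtain s e where z: "z = (s, e)" "s \<in> simplices S n" "e \<in> fib (f n s) (mono_id n)" by (auto simp: simplices_groth)
  interpret finite_family "f n s" n by (rule family[OF z(2)])
  show "act (grothendieck S f) n \<phi> z \<in> simplices (grothendieck S f) m"
    using a z S restr_in[OF mono_id_in z(3), of \<phi> m] fib_act[OF z(2)] by (auto simp: simplices_groth mono_comp_id_left)
next
  fix n z assume "z \<in> simplices (grothendieck S f) n"
  then obtain s e where z: "z = (s, e)" "s \<in> simplices S n" "e \<in> fib (f n s) (mono_id n)" by (auto simp: simplices_groth)
  interpret finite_family "f n s" n by (rule family[OF z(2)])
  show "act (grothendieck S f) n (mono_id n) z = z" using z restr_id[OF mono_id_in z(3)] sset_act_id[OF S z(2)] by simp
next
  fix n m k \<phi> \<psi> z assume a: "\<phi> \<in> mono_maps m n \<and> \<psi> \<in> mono_maps k m \<and> z \<in> simplices (grothendieck S f) n"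
  then obtain s e where z: "z = (s, e)" "s \<in> simplices S n" "e \<in> fib (f n s) (mono_id n)" by (auto simp: simplices_groth)
  interpret finite_family "f n s" n by (rule family[OF z(2)])
  have phi: "\<phi> \<in> mono_maps m n" "\<psi> \<in> mono_maps k m" using a by auto
  have "restr (f n s) (mono_id n) \<phi> e \<in> fib (f n s) \<phi>"
    using restr_in[OF mono_id_in z(3) phi(1)] by (simp add: mono_comp_id_left[OF phi(1)])
  then show "act (grothendieck S f) n (mono_comp \<phi> \<psi>) z = act (grothendieck S f) m \<psi> (act (grothendieck S f) n \<phi> z)"
    using z sset_act_act[OF S z(2) phi] restr_comp[OF mono_id_in z(3) phi] restr_act[OF z(2) phi(1) _ phi(2)]
    by (simp add: mono_comp_id_left[OF phi(1)])
qed

lemma simplicial_map_groth: "simplicial_map (grothendieck S f) S (\<lambda>_. fst)"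
  by (auto simp: simplicial_map_def simplices_groth)

text \<open>
  Over a simplex \<open>y\<close> of \<open>S\<close>, the Grothendieck construction is the total space of the left fibration
  \<open>f n y\<close> over the standard simplex, and lifts over \<open>y\<close> are lifts over the identity of the standard
  simplex.
\<close>

lemma lifts_groth:
  assumes nk: "1 \<le> n" "k < n" shows "lifts (grothendieck S f) S (\<lambda>_. fst) n k"
  unfolding lifts_def
proof (intro allI impI, elim conjE)
  fix h y assume h: "horn (grothendieck S f) n k h" and y: "y \<in> simplices S n"
    and fc: "\<forall>i\<le>n. i \<noteq> k \<longrightarrow> face S n i y = fst (h i)"
  interpret finite_family "f n y" n by (rule family[OF y])
  obtain m where m: "n = Suc m" using nk by (cases n) auto
  let ?T = "total_space n (f n y)"
  let ?h = "\<lambda>i. (coface n i, snd (h i))"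
  have cf: "coface n i \<in> mono_maps m n" if "i \<le> n" for i using that m by auto
  have hi: "snd (h i) \<in> fib (f n y) (coface n i)" "h i = (act S n (coface n i) y, snd (h i))" if "i \<le> n" "i \<noteq> k" for i
  proof -
    have "h i \<in> simplices (grothendieck S f) m" using h that m by (auto simp: horn_def)
    then have "snd (h i) \<in> fib (f m (fst (h i))) (mono_id m)" by (cases "h i") (simp add: simplices_groth)
    moreover have e: "fst (h i) = act S n (coface n i) y" using fc that by (simp add: face_def)
    ultimately show "snd (h i) \<in> fib (f n y) (coface n i)"
      using fib_act[OF y cf[OF that(1)]] by simp
    show "h i = (act S n (coface n i) y, snd (h i))" by (rule prod_eqI) (simp_all add: e)
  qed
  have "horn ?T n k ?h" unfolding horn_def
  proof (intro conjI allI impI)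
    fix i assume "i \<le> n" "i \<noteq> k"
    then show "?h i \<in> simplices ?T (n - 1)" using cf hi m by (simp add: total_space_def)
  next
    fix i j assume a: "i < j \<and> j \<le> n \<and> i \<noteq> k \<and> j \<noteq> k"
    then obtain l where l: "m = Suc l" using nk m by (cases m) auto
    have ij: "i \<le> m" "j - 1 \<le> m" "i \<le> n" "j \<le> n" using a m by auto
    have "face (grothendieck S f) m i (h j) = face (grothendieck S f) m (j - 1) (h i)"
      using h a m unfolding horn_def by auto
    moreover have fg: "face (grothendieck S f) m i' (h j') = (act S m (coface m i') (act S n (coface n j') y), restr (f n y) (coface n j') (coface m i') (snd (h j')))"
      if "i' \<le> m" "j' \<le> n" "j' \<noteq> k" for i' j'
    proof -
      have "coface m i' \<in> mono_maps l m" using that l by auto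
      note ra = restr_act[OF y cf[OF that(2)] hi(1)[OF that(2,3)] this]
      show ?thesis by (subst hi(2)[OF that(2,3)]) (simp add: face_def ra)
    qed
    ultimately have "restr (f n y) (coface n j) (coface m i) (snd (h j)) = restr (f n y) (coface n i) (coface m (j - 1)) (snd (h i))"
      using ij a by simp
    then show "face ?T (n - 1) i (?h j) = face ?T (n - 1) (j - 1) (?h i)"
      using a m l coface_coface[of i j l] by (simp add: face_def total_space_def)
  qed
  moreover have "mono_id n \<in> simplices (standard_simplex n) n" by (simp add: standard_simplex_def)
  moreover have "\<forall>i\<le>n. i \<noteq> k \<longrightarrow> face (standard_simplex n) n i (mono_id n) = fst (?h i)"
    using mono_comp_id_left[OF cf] by (simp add: face_def standard_simplex_def)
  moreover have "lifts ?T (standard_simplex n) (\<lambda>_. fst) n k" using lf nk by (simp add: left_fibration_iff)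
  ultimately obtain x where x: "x \<in> simplices ?T n" "fst x = mono_id n" "\<forall>i\<le>n. i \<noteq> k \<longrightarrow> face ?T n i x = ?h i"
    unfolding lifts_def by blast
  obtain e where e: "x = (mono_id n, e)" "e \<in> fib (f n y) (mono_id n)" using x(1,2) by (auto simp: total_space_def)
  have "face (grothendieck S f) n i (y, e) = h i" if "i \<le> n" "i \<noteq> k" for i
    using x(3) that e hi(2)[OF that] by (simp add: face_def total_space_def)
  then show "\<exists>x\<in>simplices (grothendieck S f) n. fst x = y \<and> (\<forall>i\<le>n. i \<noteq> k \<longrightarrow> face (grothendieck S f) n i x = h i)"
    using y e by (intro bexI[of _ "(y, e)"]) (auto simp: simplices_groth)
qed

theorem left_fibration_groth: "left_fibration (grothendieck S f) S (\<lambda>_. fst)"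
  using S simplicial_set_groth simplicial_map_groth lifts_groth by (simp add: left_fibration_iff)

lemma fibre_iso:
  assumes s: "s \<in> simplices S 0"
  shows "simplicial_iso (fibre (f 0 s) 0) (strict_fibre (grothendieck S f) S (\<lambda>_. fst) s) (\<lambda>n e. (const_simplex S n s, e))"
proof -
  interpret finite_family "f 0 s" 0 by (rule family[OF s])
  have r: "replicate (Suc n) 0 \<in> mono_maps n 0" for n by (rule replicate_in) simp
  have c: "fib (f n (const_simplex S n s)) (mono_id n) = fib (f 0 s) (replicate (Suc n) 0)" for n
    unfolding const_simplex_def by (rule fib_act[OF s r])
  have "simplicial_set (fibre (f 0 s) 0)"
    using fin[of 0] by (auto simp: finite_groupoid_def locally_finite_iff intro: kan_sset)
  moreover have "simplicial_set (strict_fibre (grothendieck S f) S (\<lambda>_. fst) s)"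
    by (rule simplicial_set_strict_fibre[OF simplicial_set_groth S simplicial_map_groth s])
  moreover have "simplicial_map (fibre (f 0 s) 0) (strict_fibre (grothendieck S f) S (\<lambda>_. fst) s) (\<lambda>n e. (const_simplex S n s, e))"
    unfolding simplicial_map_def
  proof (intro conjI allI impI)
    fix n e assume "e \<in> simplices (fibre (f 0 s) 0) n"
    then show "(const_simplex S n s, e) \<in> simplices (strict_fibre (grothendieck S f) S (\<lambda>_. fst) s) n"
      using c S s by (auto simp: fibre_def simplices_strict_fibre simplices_groth)
  next
    fix n m \<phi> e assume a: "\<phi> \<in> mono_maps m n \<and> e \<in> simplices (fibre (f 0 s) 0) n"
    have "restr (f n (const_simplex S n s)) (mono_id n) \<phi> e = restr (f 0 s) (replicate (Suc n) 0) \<phi> e"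
      unfolding const_simplex_def by (rule restr_act[OF s r]) (use a in \<open>auto simp: fibre_def\<close>)
    then show "(const_simplex S m s, act (fibre (f 0 s) 0) n \<phi> e) =
        act (strict_fibre (grothendieck S f) S (\<lambda>_. fst) s) n \<phi> (const_simplex S n s, e)"
      using act_const[OF S s, of \<phi> m n] a by (simp add: fibre_def)
  qed
  moreover have "bij_betw (\<lambda>e. (const_simplex S n s, e)) (simplices (fibre (f 0 s) 0) n)
     (simplices (strict_fibre (grothendieck S f) S (\<lambda>_. fst) s) n)" for n
    by (rule bij_betwI[of _ _ _ snd]) (use c S s in \<open>auto simp: fibre_def simplices_strict_fibre simplices_groth\<close>)
  ultimately show ?thesis by (simp add: simplicial_iso_def)
qed

lemma groth_fibre:
  assumes s: "s \<in> simplices S 0"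
  shows "finite_groupoid (strict_fibre (grothendieck S f) S (\<lambda>_. fst) s)"
    "cardinality (strict_fibre (grothendieck S f) S (\<lambda>_. fst) s) = cardinality (fibre (f 0 s) 0)"
proof -
  interpret finite_family "f 0 s" 0 by (rule family[OF s])
  have "finite_groupoid (fibre (f 0 s) 0)" by (rule fin) simp
  then show "finite_groupoid (strict_fibre (grothendieck S f) S (\<lambda>_. fst) s)"
    "cardinality (strict_fibre (grothendieck S f) S (\<lambda>_. fst) s) = cardinality (fibre (f 0 s) 0)"
    using simplicial_iso_finite_groupoid[OF fibre_iso[OF s]] by auto
qed

text \<open>
  Both cardinalities, multiplied by the weight of \<open>s\<close>, are the total weight of the components of the
  Grothendieck construction over the component of \<open>s\<close>.
\<close>

lemma fibre_cardinality_path: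
  assumes L: "locally_finite_groupoid S" and st: "(s, t) \<in> path_rel S"
  shows "cardinality (fibre (f 0 s) 0) = cardinality (fibre (f 0 t) 0)"
proof -
  have K: "kan_complex S" and pS: "\<And>x. x \<in> simplices S 0 \<Longrightarrow> pi_finite S x" using L by (auto simp: locally_finite_iff)
  note eq = path_rel_equiv[OF K]
  have s: "s \<in> simplices S 0" "t \<in> simplices S 0" using st equiv_type[OF eq] by auto
  have "components_over (grothendieck S f) S (\<lambda>_. fst) s = components_over (grothendieck S f) S (\<lambda>_. fst) t"
    unfolding components_over_def using st eq by (meson equiv_def symD transD)
  then have "cardinality (fibre (f 0 s) 0) * weight S s = cardinality (fibre (f 0 t) 0) * weight S t"
    using fibration_over_component(2)[OF left_fibration_groth K s(1) pS[OF s(1)] groth_fibre(1)[OF s(1)]]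
      fibration_over_component(2)[OF left_fibration_groth K s(2) pS[OF s(2)] groth_fibre(1)[OF s(2)]] groth_fibre(2) s by simp
  then show ?thesis using weight_path(1)[OF K st] weight_nonzero[OF S s(2) pS[OF s(2)]] by simp
qed

end

section \<open>The pairing\<close>

text \<open>
  The left-hand side is the coefficient of \<open>\<delta>\<^sub>s\<close> in the cardinality of \<open>p\<close>. It is the total weight of the
  components of \<open>\<alpha>\<close> over that of \<open>s\<close>, which shows that it depends only on the component of \<open>s\<close> and vanishes for
  all but finitely many components.
\<close>

lemma homotopy_fibre_component:
  assumes S: "locally_finite_groupoid S" and ap: "(\<alpha>, p) \<in> finite_over S" and s: "s \<in> simplices S 0"
  shows "cardinality (homotopy_fibre S \<alpha> p s) * cardinality (component S s) =
    (\<Sum>d\<in>{d\<in>pi0 \<alpha>. path_rel S `` {p 0 (rep d)} = pi0_class S s}. weight \<alpha> (rep d))"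
proof -
  have K: "kan_complex S" using S by (simp add: locally_finite_iff)
  have a: "finite_groupoid \<alpha>" "simplicial_map \<alpha> S p" using ap by (auto simp: finite_over_def)
  have Ka: "kan_complex \<alpha>" using a by (simp add: finite_groupoid_def locally_finite_iff)
  have "(s, p 0 (rep d)) \<in> path_rel S \<longleftrightarrow> path_rel S `` {p 0 (rep d)} = pi0_class S s" if "d \<in> pi0 \<alpha>" for d
    using eq_equiv_class_iff[OF path_rel_equiv[OF K] s, of "p 0 (rep d)"] pi0_rep(2)[OF Ka that] a(2)
    by (auto simp: pi0_class_def)
  then have "{d\<in>pi0 \<alpha>. (s, p 0 (rep d)) \<in> path_rel S} = {d\<in>pi0 \<alpha>. path_rel S `` {p 0 (rep d)} = pi0_class S s}" by blast
  then show ?thesis using homotopy_fibre_cardinality[OF S a s] component_cardinality[OF K s] by simp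
qed

lemma over_cardinality_sum:
  assumes S: "locally_finite_groupoid S" and ap: "(\<alpha>, p) \<in> finite_over S"
  shows "over_cardinality S \<alpha> p c =
    (if c \<in> pi0 S then \<Sum>d\<in>{d\<in>pi0 \<alpha>. path_rel S `` {p 0 (rep d)} = c}. weight \<alpha> (rep d) else 0)"
proof -
  have K: "kan_complex S" using S by (simp add: locally_finite_iff)
  have "pi0_class S (rep c) = c" if "c \<in> pi0 S" using pi0_rep(3)[OF K that] by (simp add: pi0_class_def)
  then show ?thesis using homotopy_fibre_component[OF S ap pi0_rep(2)[OF K]] by (simp add: over_cardinality_def)
qed

lemma evaluation_delta: "evaluation (delta i) \<phi> = \<phi> i"
proof -
  have "{j. delta i j \<noteq> 0} = {i}" by (auto simp: delta_def)
  then show ?thesis by (simp add: evaluation_def delta_def)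
qed

theorem proposition8p10:
  fixes S :: "'s simplicial"
  assumes "locally_finite_groupoid S"
  shows
    "(\<forall>(\<alpha> :: 'a simplicial) p (f :: nat \<Rightarrow> 's \<Rightarrow> 'e family).
        (\<alpha>, p) \<in> finite_over S \<and> f \<in> finite_valued S \<longrightarrow>
          finite_groupoid (pairing S \<alpha> p f) \<and>
          over_cardinality S \<alpha> p \<in> free_space (pi0 S) \<and>
          (\<forall>s\<in>simplices S 0.
             over_cardinality S \<alpha> p (pi0_class S s) =
               cardinality (homotopy_fibre S \<alpha> p s) * cardinality (component S s) \<and>
             functor_cardinality S f (pi0_class S s) = cardinality (fibre (f 0 s) 0)) \<and>
          cardinality (pairing S \<alpha> p f) =
            evaluation (over_cardinality S \<alpha> p) (functor_cardinality S f)) \<and>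
     (\<forall>s\<in>simplices S 0. \<forall>t\<in>simplices S 0.
        evaluation (delta (pi0_class S s)) (delta (pi0_class S t)) =
          (if (s, t) \<in> path_rel S then 1 else 0))"
proof (intro conjI allI impI ballI)
  have K: "kan_complex S" using assms by (simp add: locally_finite_iff)
  note eq = path_rel_equiv[OF K]
  have cl: "pi0_class S s \<in> pi0 S" if "s \<in> simplices S 0" for s
    using pi0_classI[OF that] by (simp add: pi0_class_def)
  show "evaluation (delta (pi0_class S s)) (delta (pi0_class S t)) = (if (s, t) \<in> path_rel S then 1 else 0)"
    if "s \<in> simplices S 0" "t \<in> simplices S 0" for s t
    using eq_equiv_class_iff[OF eq that] by (simp add: evaluation_delta) (simp add: delta_def pi0_class_def)
  fix \<alpha> :: "'a simplicial" and p and f :: "nat \<Rightarrow> 's \<Rightarrow> 'e family"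
  assume a: "(\<alpha>, p) \<in> finite_over S \<and> f \<in> finite_valued S"
  then have ap: "(\<alpha>, p) \<in> finite_over S" and fa: "finite_groupoid \<alpha>" and p: "simplicial_map \<alpha> S p"
    by (auto simp: finite_over_def)
  have Ka: "kan_complex \<alpha>" and f0: "finite (pi0 \<alpha>)" using fa by (auto simp: finite_groupoid_def locally_finite_iff)
  interpret finite_valued_functor S f by unfold_locales (use a kan_sset[OF K] in auto)
  have pr: "p 0 (rep d) \<in> simplices S 0" if "d \<in> pi0 \<alpha>" for d using pi0_rep(2)[OF Ka that] p by blast
  let ?G = "strict_fibre (grothendieck S f) S (\<lambda>_. fst)"
  have fin: "finite_groupoid (?G (p 0 a))" if "a \<in> simplices \<alpha> 0" for a
    using groth_fibre(1)[of "p 0 a"] p that by blast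
  show "finite_groupoid (pairing S \<alpha> p f)" unfolding pairing_def
    by (rule pullback_cardinality(1)[OF fa left_fibration_groth p fin])
  let ?g = "\<lambda>d. path_rel S `` {p 0 (rep d)}"
  have gS: "?g d \<in> pi0 S" if "d \<in> pi0 \<alpha>" for d using pr[OF that] by (rule pi0_classI)
  note oc = over_cardinality_sum[OF assms ap]
  have supp: "{c. over_cardinality S \<alpha> p c \<noteq> 0} \<subseteq> ?g ` pi0 \<alpha>"
  proof
    fix c assume "c \<in> {c. over_cardinality S \<alpha> p c \<noteq> 0}"
    then have "(\<Sum>d\<in>{d\<in>pi0 \<alpha>. ?g d = c}. weight \<alpha> (rep d)) \<noteq> 0" by (auto simp: oc split: if_splits)
    then obtain d where "d \<in> {d\<in>pi0 \<alpha>. ?g d = c}" using sum.not_neutral_contains_not_neutral by blast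
    then show "c \<in> ?g ` pi0 \<alpha>" by blast
  qed
  then show "over_cardinality S \<alpha> p \<in> free_space (pi0 S)"
    using f0 gS unfolding free_space_def by (auto intro: finite_subset)
  show "over_cardinality S \<alpha> p (pi0_class S s) = cardinality (homotopy_fibre S \<alpha> p s) * cardinality (component S s)"
    if "s \<in> simplices S 0" for s
    using oc cl[OF that] homotopy_fibre_component[OF assms ap that] by simp
  show fc: "functor_cardinality S f (pi0_class S s) = cardinality (fibre (f 0 s) 0)" if "s \<in> simplices S 0" for s
  proof -
    have "s \<in> pi0_class S s" using equiv_class_self[OF eq that] by (simp add: pi0_class_def)
    then show ?thesis using cl[OF that] fibre_cardinality_path[OF assms pi0_rep(4)[OF K cl[OF that]]]
      by (simp add: functor_cardinality_def)
  qed
  \<comment> \<open>Fubini: the pairing is fibred over \<open>\<alpha>\<close> with the values of \<open>f\<close> as fibres; then sort by components of \<open>S\<close>.\<close>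
  have "cardinality (pairing S \<alpha> p f) = (\<Sum>d\<in>pi0 \<alpha>. weight \<alpha> (rep d) * functor_cardinality S f (?g d))"
  proof -
    have "functor_cardinality S f (?g d) = cardinality (?G (p 0 (rep d)))" if "d \<in> pi0 \<alpha>" for d
      using fc[OF pr[OF that]] groth_fibre(2)[OF pr[OF that]] by (simp add: pi0_class_def)
    then show ?thesis unfolding pairing_def
      by (subst pullback_cardinality(2)[OF fa left_fibration_groth p]) (auto simp: fin mult.commute intro!: sum.cong)
  qed
  also have "\<dots> = (\<Sum>c\<in>?g ` pi0 \<alpha>. \<Sum>d\<in>{d\<in>pi0 \<alpha>. ?g d = c}. weight \<alpha> (rep d) * functor_cardinality S f (?g d))"
    by (rule sum.image_gen[OF f0])
  also have "\<dots> = (\<Sum>c\<in>?g ` pi0 \<alpha>. over_cardinality S \<alpha> p c * functor_cardinality S f c)"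
    by (rule sum.cong) (auto simp: oc gS sum_distrib_right)
  also have "\<dots> = evaluation (over_cardinality S \<alpha> p) (functor_cardinality S f)"
    unfolding evaluation_def by (rule sum.mono_neutral_right) (use f0 supp in auto)
  finally show "cardinality (pairing S \<alpha> p f) = evaluation (over_cardinality S \<alpha> p) (functor_cardinality S f)" .
qed

end
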